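(* Let $p\in\{5,7\}$ and let $E\subset \mathbb{F}_p^3$ be a nonempty subset. Then $E$ is spectral if and only if $E$ tiles $\mathbb{F}_p^3$ by translations.
   Context: For a prime $p$, $\mathbb{F}_p$ is the field with $p$ elements and $x\cdot a$ denotes the standard dot product on $\mathbb{F}_p^d$. A subset $E\subset\mathbb{F}_p^d$ is called spectral if there is a subset $A\subset\mathbb{F}_p^d$ (a spectrum of $E$) such that the family of functions $\chi_a(x)=e^{\frac{2\pi i}{p}x\cdot a}$, $a\in A$, restricted to $E$, is an orthogonal basis (indexed by $A$) of the complex vector space $L^2(E)$ of functions $E\to\mathbb{C}$ with inner product $\langle f,g\rangle=\sum_{x\in E}f(x)\overline{g(x)}$. A subset $E\subset\mathbb{F}_p^d$ tiles $\mathbb{F}_p^d$ by translations if there is a subset $A\subset\mathbb{F}_p^d$ such that $\sum_{a\in A}E(x-a)=1$ for all $x\in\mathbb{F}_p^d$, where $E(\cdot)$ is the indicator function of $E$. *)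

theory Defs
  imports
    "HOL-Analysis.Analysis"
    "HOL-Library.Function_Algebras"
    "Berlekamp_Zassenhaus.Finite_Field"
begin

text \<open>
  For \<open>'p :: prime_card\<close> the type \<open>'p mod_ring\<close> is the prime field with \<open>CARD('p)\<close> elements,
  so \<open>'p mod_ring ^ 'd\<close> is the space of dimension \<open>CARD('d)\<close> over it.
\<close>

definition dot :: "'p::prime_card mod_ring ^ 'd::finite \<Rightarrow> 'p mod_ring ^ 'd \<Rightarrow> 'p mod_ring"
  where "dot x a = (\<Sum>i\<in>UNIV. x $ i * a $ i)"

text \<open>
  The exponent uses the representative of \<open>dot x a\<close> in \<open>{0..<p}\<close>; by periodicity of \<open>exp\<close>
  the choice of representative is immaterial.
\<close>

definition character :: "'p::prime_card mod_ring ^ 'd::finite \<Rightarrow> 'p mod_ring ^ 'd \<Rightarrow> complex"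
  where "character a x =
    exp (2 * complex_of_real pi * \<i> / of_nat CARD('p) * of_int (to_int_mod_ring (dot x a)))"

text \<open>
  Functions \<open>E \<rightarrow> \<complex>\<close> are represented by their extensions by zero to the whole type, which form
  a subspace of the complex vector space of all functions with pointwise operations.
\<close>

definition cscale :: "complex \<Rightarrow> ('x \<Rightarrow> complex) \<Rightarrow> 'x \<Rightarrow> complex"
  where "cscale c f = (\<lambda>x. c * f x)"

global_interpretation cfun: vector_space cscale
  by unfold_locales (auto simp: cscale_def fun_eq_iff algebra_simps)

definition L2 :: "'x set \<Rightarrow> ('x \<Rightarrow> complex) set"
  where "L2 E = {f. \<forall>x. x \<notin> E \<longrightarrow> f x = 0}"

definition restrict_to :: "'x set \<Rightarrow> ('x \<Rightarrow> complex) \<Rightarrow> 'x \<Rightarrow> complex"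
  where "restrict_to E f = (\<lambda>x. if x \<in> E then f x else 0)"

definition L2_inner :: "'x set \<Rightarrow> ('x \<Rightarrow> complex) \<Rightarrow> ('x \<Rightarrow> complex) \<Rightarrow> complex"
  where "L2_inner E f g = (\<Sum>x\<in>E. f x * cnj (g x))"

text \<open>
  The basis is a family indexed by \<open>A\<close>, hence the injectivity requirement: distinct indices
  must give distinct functions.
\<close>

definition orthogonal_basis_on :: "'x set \<Rightarrow> 'i set \<Rightarrow> ('i \<Rightarrow> 'x \<Rightarrow> complex) \<Rightarrow> bool"
  where "orthogonal_basis_on E A f \<longleftrightarrow>
    inj_on f A \<and>
    cfun.independent (f ` A) \<and>
    cfun.span (f ` A) = L2 E \<and>
    (\<forall>a\<in>A. \<forall>b\<in>A. a \<noteq> b \<longrightarrow> L2_inner E (f a) (f b) = 0)"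

definition is_spectrum ::
  "('p::prime_card mod_ring ^ 'd::finite) set \<Rightarrow> ('p mod_ring ^ 'd) set \<Rightarrow> bool"
  where "is_spectrum E A \<longleftrightarrow> orthogonal_basis_on E A (\<lambda>a. restrict_to E (character a))"

definition spectral :: "('p::prime_card mod_ring ^ 'd::finite) set \<Rightarrow> bool"
  where "spectral E \<longleftrightarrow> (\<exists>A. is_spectrum E A)"

definition tiles :: "('p::prime_card mod_ring ^ 'd::finite) set \<Rightarrow> bool"
  where "tiles E \<longleftrightarrow> (\<exists>A. \<forall>x. (\<Sum>a\<in>A. indicator E (x - a)) = (1::nat))"

end

theory Submission
  imports Defs
begin

text \<open>
  Two characters with frequencies \<open>a\<close> and \<open>b\<close> are orthogonal on \<open>E\<close> iff a sum of \<open>p\<close>-th roots of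
  unity vanishes, whose coefficients count the points of \<open>E\<close> in the planes normal to \<open>a - b\<close>. As \<open>p\<close>
  is prime, this forces the coefficients to be equal (\<open>root_of_unity_sum_zero\<close>): \<open>E\<close> is equidistributed
  over these planes. A spectrum of \<open>E\<close> is therefore a set \<open>A\<close> of the same size whose differences are
  directions of equidistribution of \<open>E\<close> (\<open>is_spectrum_iff\<close>), and the relation between \<open>E\<close> and \<open>A\<close> is
  symmetric (\<open>orthogonal_frequencies_dual\<close>). Equidistribution is invariant under scaling, so the
  argument takes place in the projective plane of directions.

  Extreme sizes are easy for every \<open>p\<close>. A spectral set with at least two points has \<open>k * p\<close> points. If
  \<open>k = 1\<close>, it meets every plane of one direction once; if \<open>k = p\<close>, it is a graph over a plane; if
  \<open>k > p\<close>, it is the whole space (\<open>spectral_imp_tiles_from_middle\<close>). Conversely a tile has \<open>1\<close>,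
  \<open>p\<close>, \<open>p\<^sup>2\<close> or \<open>p\<^sup>3\<close> points and the same descriptions provide spectra (\<open>tiles_imp_spectral\<close>). The
  theorem thus says that there is no pair \<open>E\<close>, \<open>A\<close> of \<open>k * p\<close> points each with \<open>2 \<le> k < p\<close>; such a pair
  is the locale \<open>spectral_pair\<close>.

  In such a pair every direction is a zero of \<open>E\<close>, with \<open>k\<close> points in each of its planes, or a nonzero,
  and the directions of the differences of \<open>A\<close> are zeros of \<open>E\<close>. Counting the points of \<open>E\<close> in the
  \<open>p + 1\<close> planes through an affine line (\<open>line_identity\<close>) shows that the directions normal to a
  difference of \<open>E\<close> contain many nonzeros. On the other hand, the \<open>k\<close> points of \<open>A\<close> in a plane normal to
  that difference determine several directions, which are zeros. The two bounds contradict each other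
  for \<open>k = p - 1\<close> and for \<open>(p, k) = (5, 3), (7, 5)\<close>. For \<open>(7, 4)\<close> they are equalities and determine the
  number of zeros of \<open>E\<close>, which is then refuted by a quadratic double count over the projective lines.

  The pairs \<open>(5, 2)\<close>, \<open>(7, 2)\<close> and \<open>(7, 3)\<close> need power sums. The moment of order \<open>j \<le> p - 2\<close> vanishes at
  the zeros of \<open>E\<close>, and along a projective line it is a form of degree \<open>j\<close>. A line therefore carries
  either at least three nonzeros or a single one, which is then flat: each of its planes contains no
  point or \<open>p\<close> points of \<open>E\<close> (\<open>line_dichotomy\<close>). A flat direction would cut \<open>E\<close> and \<open>A\<close> into \<open>k\<close> plane
  sections so rigidly related that one of them overlaps a translate of itself too much
  (\<open>no_flat_dirs_2\<close>, \<open>no_flat_dirs_3\<close>). With three nonzeros on every line, the quadratic double count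
  settles \<open>(5, 2)\<close>.

  For \<open>p = 7\<close> the directions are graded by the largest order of a vanishing initial segment of moments.
  If the moments of order at most \<open>3\<close> vanish, the numbers of points in the planes are, modulo \<open>7\<close>, the
  values of a polynomial of degree at most two, and a finite check of all such profiles controls
  parity, sum of squares and number of full lines (\<open>quadratic_plane_count\<close>). If they do not all vanish
  at some direction, they fail to vanish at so many that most lines carry few zeros, and the quadratic
  double count bounds the number of zeros from above. Counting ordered pairs of points by their
  direction bounds this number from below. For \<open>k = 2\<close> the bounds are \<open>23\<close> and \<open>26\<close>; for \<open>k = 3\<close> they
  are \<open>24\<close> and \<open>29\<close> (\<open>k_not_2\<close>, \<open>contradiction_7_3\<close>).
\<close>

hide_const (open) up_ring.monom up_ring.coeff Coset.order module.smult

section \<open>Vanishing sums of roots of unity\<close>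

text \<open>
  The \<open>p\<close>-th cyclotomic polynomial when \<open>p\<close> is prime.
\<close>

abbreviation cyclotomic_prime :: "nat \<Rightarrow> 'a::comm_ring_1 poly"
  where "cyclotomic_prime p \<equiv> (\<Sum>i<p. monom 1 i)"

lemma cyclotomic_prime_mult:
  "[:-1, 1:] * cyclotomic_prime p = (monom 1 p - 1 :: 'a::comm_ring_1 poly)"
proof (induction p)
  case (Suc p)
  have "[:-1, 1:] * monom (1::'a) p = monom 1 (Suc p) - monom 1 p"
    by (simp add: monom_Suc)
  with Suc show ?case
    by (simp add: algebra_simps)
qed (simp add: monom_0)

text \<open>
  In characteristic \<open>p\<close> the Frobenius map turns \<open>X ^ p - 1\<close> into \<open>(X - 1) ^ p\<close>; cancelling one
  factor leaves the claim.
\<close>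

lemma cyclotomic_prime_mod:
  "cyclotomic_prime CARD('p) = ([:-1, 1:] ^ (CARD('p) - 1) :: 'p::prime_card mod_ring poly)"
proof -
  have ch: "CHAR('p mod_ring poly) = CARD('p)"
    by simp
  have p: "CARD('p) = Suc (CARD('p) - 1)"
    using prime_card[where 'a='p] prime_gt_0_nat by fastforce
  have "([:-1, 1:] :: 'p mod_ring poly) = monom 1 1 + (-1)"
    by (simp add: monom_altdef one_pCons)
  also have "\<dots> ^ CARD('p) = monom 1 1 ^ CARD('p) + (-1) ^ CARD('p)"
    by (rule freshmans_dream) (simp_all only: ch prime_card)
  also have "(-1 :: 'p mod_ring poly) ^ CARD('p) = -1"
  proof -
    have "((-1) + 1 :: 'p mod_ring poly) ^ CARD('p) = (-1) ^ CARD('p) + 1 ^ CARD('p)"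
      by (rule freshmans_dream) (simp_all only: ch prime_card)
    then show ?thesis
      using prime_card[where 'a='p] prime_gt_0_nat[of "CARD('p)"] by (simp add: eq_neg_iff_add_eq_0 power_0_left)
  qed
  also have "monom 1 1 ^ CARD('p) = (monom 1 CARD('p) :: 'p mod_ring poly)"
    by (simp add: monom_power)
  finally have "([:-1, 1:] :: 'p mod_ring poly) ^ CARD('p) = monom 1 CARD('p) - 1"
    by simp
  then have "([:-1, 1:] :: 'p mod_ring poly) * [:-1, 1:] ^ (CARD('p) - 1) = [:-1, 1:] * cyclotomic_prime CARD('p)"
    by (metis cyclotomic_prime_mult p power_Suc)
  then show ?thesis
    by (metis mult_left_cancel pCons_eq_0_iff zero_neq_one)
qed

text \<open>
  Modulo \<open>p\<close> the product is a power of \<open>X - 1\<close>. The order of the root \<open>1\<close> in the reduction of \<open>h\<close> is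
  at most its degree, so a factor \<open>X - 1\<close> is left for \<open>g\<close>.
\<close>

lemma of_int_poly_root_1_mod:
  fixes g h :: "int poly"
  assumes eq: "g * h = cyclotomic_prime CARD('p::prime_card)" and deg: "degree g > 0"
  shows "int CARD('p) dvd poly g 1"
proof -
  let ?r = "of_int_poly :: int poly \<Rightarrow> 'p mod_ring poly"
  have p1: "CARD('p) > 1"
    using prime_card[where 'a='p] prime_gt_1_nat by blast
  have cyc: "?r (cyclotomic_prime CARD('p)) = cyclotomic_prime CARD('p)"
    by (simp add: of_int_poly_hom.hom_sum)
  have prod: "?r g * ?r h = [:-1, 1:] ^ (CARD('p) - 1)"
    by (metis cyc cyclotomic_prime_mod eq of_int_poly_hom.hom_mult)
  have dPhi: "degree (cyclotomic_prime CARD('p) :: int poly) = CARD('p) - 1"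
  proof -
    have "degree ([:-1, 1:] * cyclotomic_prime CARD('p) :: int poly) = CARD('p)"
      unfolding cyclotomic_prime_mult using p1
      by (simp add: degree_add_eq_left degree_monom_eq flip: add_uminus_conv_diff)
    moreover have "(cyclotomic_prime CARD('p) :: int poly) \<noteq> 0"
      using calculation p1 by auto
    ultimately show ?thesis
      by (subst (asm) degree_mult_eq) auto
  qed
  have nz: "g \<noteq> 0" "h \<noteq> 0"
    using eq dPhi p1 by auto
  have dgh: "degree g + degree h = CARD('p) - 1"
    using degree_mult_eq[OF nz] eq dPhi by simp
  have nz': "?r g * ?r h \<noteq> 0"
    by (simp add: prod)
  have "order 1 (?r g) + order 1 (?r h) = CARD('p) - 1"
    using order_mult[OF nz'] prod order_power_n_n[of "1::'p mod_ring" "CARD('p) - 1"] by simp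
  moreover have "order 1 (?r h) \<le> degree h"
    using nz' order_degree[of "?r h" 1] degree_map_poly_le[of "of_int :: int \<Rightarrow> 'p mod_ring" h] by auto
  ultimately have "order 1 (?r g) > 0"
    using dgh deg by linarith
  then have "poly (?r g) 1 = 0"
    using order_root[of "?r g" 1] nz' by auto
  then have "(of_int (poly g 1) :: 'p mod_ring) = 0"
    by simp
  then show ?thesis
    by (simp only: of_int_eq_0_iff_char_dvd semiring_char_mod_ring)
qed

text \<open>
  Eisenstein's argument: two nonconstant factors would both be divisible by \<open>p\<close> at \<open>1\<close>, where the
  product has the value \<open>p\<close>.
\<close>

lemma prime_cyclotomic_irreducible:
  fixes g h :: "int poly"
  assumes eq: "g * h = cyclotomic_prime CARD('p::prime_card)" and deg: "degree g > 0"
  shows "degree h = 0"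
proof (rule ccontr)
  assume "degree h \<noteq> 0"
  then have "int CARD('p) dvd poly h 1"
    using eq by (intro of_int_poly_root_1_mod[of h g]) (auto simp: mult.commute)
  moreover have "int CARD('p) dvd poly g 1"
    using eq deg by (rule of_int_poly_root_1_mod)
  ultimately have "int CARD('p) * int CARD('p) dvd poly (g * h) 1"
    by (simp add: mult_dvd_mono)
  also have "poly (g * h) 1 = int CARD('p)"
    by (simp add: eq poly_sum poly_monom)
  finally show False
    using prime_card[where 'a='p] prime_gt_1_nat[of "CARD('p)"] by simp
qed

text \<open>
  Gauss's lemma: the content is multiplicative.
\<close>

lemma primitive_dvd_smult:
  fixes g f :: "int poly"
  assumes "content g = 1" "g dvd smult c f" "c \<noteq> 0"
  shows "g dvd f"
proof -
  obtain q where q: "smult c f = g * q"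
    using assms(2) by blast
  have "content q = content (g * q)"
    by (simp add: content_mult assms(1))
  also have "\<dots> = \<bar>c\<bar> * content f"
    by (simp flip: q)
  finally have "c dvd content q"
    by simp
  then have "[:c:] dvd q"
    by (simp add: const_poly_dvd_iff_dvd_content)
  then obtain q' where "q = smult c q'"
    by (auto elim!: dvdE)
  then have "smult c f = smult c (g * q')"
    using q by simp
  then have "f = g * q'"
    using \<open>c \<noteq> 0\<close> by (metis poly_eqI coeff_smult mult_cancel_left)
  then show ?thesis
    by simp
qed

text \<open>
  The minimal integer polynomial of \<open>w\<close> is the cyclotomic polynomial, whose coefficients are all
  \<open>1\<close>; an integer polynomial of degree less than \<open>p\<close> with root \<open>w\<close> is a constant multiple of it.
\<close>

theorem root_of_unity_sum_zero:
  fixes c :: "nat \<Rightarrow> int" and w :: complex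
  assumes w: "w ^ CARD('p::prime_card) = 1" "w \<noteq> 1"
    and zero: "(\<Sum>i<CARD('p). of_int (c i) * w ^ i) = 0"
    and "i < CARD('p)" "j < CARD('p)"
  shows "c i = c j"
proof -
  let ?p = "CARD('p)"
  let ?P = "\<lambda>f::int poly. f \<noteq> 0 \<and> poly (of_int_poly f) w = 0"
  let ?Phi = "cyclotomic_prime ?p :: int poly"
  have coeffPhi: "coeff ?Phi n = (if n < ?p then 1 else 0)" for n
    by (simp add: coeff_sum)
  have p1: "?p > 1"
    using prime_card[where 'a='p] prime_gt_1_nat by blast
  have Phi: "?P ?Phi"
  proof
    show "?Phi \<noteq> 0"
      using coeffPhi[of 0] p1 by auto
    have "(w - 1) * (\<Sum>i<?p. w ^ i) = w ^ ?p - 1"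
      by (simp add: power_diff_1_eq)
    then show "poly (of_int_poly ?Phi) w = 0"
      using w by (simp add: of_int_poly_hom.hom_sum poly_sum poly_monom)
  qed
  (* a primitive integer polynomial \<open>g\<close> of least degree with root \<open>w\<close>
     divides all others up to a constant, by pseudo-division *)
  define n where "n = (LEAST n. \<exists>f. ?P f \<and> degree f = n)"
  obtain g0 where g0: "?P g0" "degree g0 = n"
    using LeastI_ex[of "\<lambda>n. \<exists>f. ?P f \<and> degree f = n"] Phi unfolding n_def by blast
  have min: "n \<le> degree f" if "?P f" for f
    unfolding n_def using that by (intro Least_le) blast
  define g where "g = primitive_part g0"
  have g: "?P g" "degree g = n" "content g = 1"
  proof -
    have "of_int_poly g0 = smult (of_int (content g0)) (of_int_poly g :: complex poly)"
      unfolding g_def by (metis content_times_primitive_part of_int_hom.map_poly_hom_smult)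
    then show "?P g"
      using g0 by (auto simp: g_def)
  qed (use g0 in \<open>auto simp: g_def\<close>)
  have dvd: "\<exists>a. a \<noteq> 0 \<and> g dvd smult a f" if "poly (of_int_poly f) w = 0" for f
  proof -
    obtain q r where qr: "pseudo_divmod f g = (q, r)"
      by fastforce
    let ?a = "lead_coeff g ^ (Suc (degree f) - degree g)"
    have eq: "smult ?a f = g * q + r" and r: "r = 0 \<or> degree r < degree g"
      using pseudo_divmod[OF _ qr] g(1) by auto
    have "poly (of_int_poly (smult ?a f)) w = poly (of_int_poly r) w"
      unfolding eq using g(1) by (simp add: of_int_poly_hom.hom_add of_int_poly_hom.hom_mult)
    then have "poly (of_int_poly r) w = 0"
      using that by (simp add: of_int_hom.map_poly_hom_smult)
    then have "r = 0"
      using r min[of r] g(2) by (cases "r = 0") auto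
    then show ?thesis
      using eq g(1) by (intro exI[of _ ?a]) auto
  qed
  have "g dvd ?Phi"
    using dvd[of ?Phi] Phi g(3) primitive_dvd_smult by blast
  then obtain h where h: "g * h = ?Phi"
    by (metis dvdE)
  have "degree g > 0"
  proof (rule ccontr)
    assume "\<not> degree g > 0"
    then obtain a where "g = [:a:]"
      by (auto elim: degree_eq_zeroE)
    with g(1) show False
      by auto
  qed
  then have "degree h = 0"
    using h by (intro prime_cyclotomic_irreducible[where 'p='p])
  then obtain b where b: "h = [:b:]"
    by (auto elim: degree_eq_zeroE)
  have degPhi: "degree g = degree ?Phi"
    using h b Phi by (metis degree_smult_eq mult_zero_right pCons_0_0 smult_0_left mult.commute mult_pCons_right add.right_neutral)
  have gPhi: "smult b g = ?Phi"
    using h b by simp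
  define f where "f = (\<Sum>i<?p. monom (c i) i)"
  have coeff_f: "coeff f n = (if n < ?p then c n else 0)" for n
    by (simp add: f_def coeff_sum)
  have "poly (of_int_poly f) w = 0"
    using zero by (simp add: f_def of_int_poly_hom.hom_sum poly_sum poly_monom map_poly_monom)
  then obtain a q where aq: "a \<noteq> 0" "smult a f = g * q"
    using dvd by (metis dvdE)
  have degf: "degree f \<le> degree ?Phi"
  proof -
    have "degree f \<le> ?p - 1"
      by (rule degree_le) (auto simp: coeff_f)
    moreover have "?p - 1 \<le> degree ?Phi"
      using p1 by (intro le_degree) (auto simp: coeffPhi)
    ultimately show ?thesis by linarith
  qed
  have "degree q = 0"
  proof (cases "q = 0")
    case False
    then have "degree (smult a f) = degree g + degree q"
      using g(1) by (simp add: aq degree_mult_eq)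
    then show ?thesis
      using degf degPhi aq(1) by simp
  qed auto
  then obtain d where d: "q = [:d:]"
    by (auto elim: degree_eq_zeroE)
  have "smult (a * b) f = smult d ?Phi"
    using aq(2) d by (simp add: ac_simps flip: gPhi) (metis mult.commute smult_smult)
  then have eq: "a * b * coeff f n = d * coeff ?Phi n" for n
    by (metis coeff_smult)
  have "b \<noteq> 0"
    using gPhi Phi by auto
  have "a * b * c i = a * b * c j"
    using eq[of i] eq[of j] assms(4,5) by (simp add: coeff_f coeffPhi)
  with \<open>b \<noteq> 0\<close> aq(1) show ?thesis
    by simp
qed

section \<open>Spectra and equidistribution\<close>

text \<open>
  The combinatorial form of the vanishing, at the frequency \<open>v\<close>, of the Fourier transform of the
  indicator function of \<open>E\<close>; see \<open>sum_character_eq_0_iff\<close>.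
\<close>

definition equidistributed :: "('p::prime_card mod_ring ^ 'd::finite) set \<Rightarrow> 'p mod_ring ^ 'd \<Rightarrow> bool"
  where "equidistributed E v \<longleftrightarrow> (\<forall>s t. card {e\<in>E. dot e v = s} = card {e\<in>E. dot e v = t})"

lemma dot_commute: "dot x y = dot y x"
  by (simp add: dot_def mult.commute)

lemma dot_add_left [simp]: "dot (x + y) z = dot x z + dot y z"
  by (simp add: dot_def distrib_right sum.distrib)

lemma dot_add_right [simp]: "dot z (x + y) = dot z x + dot z y"
  by (simp add: dot_def distrib_left sum.distrib)

lemma dot_minus_left [simp]: "dot (- x) z = - dot x z"
  by (simp add: dot_def sum_negf)

lemma dot_minus_right [simp]: "dot z (- x) = - dot z x"
  by (simp add: dot_def sum_negf)

lemma dot_diff_left [simp]: "dot (x - y) z = dot x z - dot y z"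
  by (simp add: dot_def left_diff_distrib sum_subtractf)

lemma dot_diff_right [simp]: "dot z (x - y) = dot z x - dot z y"
  by (simp add: dot_def right_diff_distrib sum_subtractf)

lemma dot_scale_left [simp]: "dot (c *s x) y = c * dot x y"
  by (simp add: dot_def sum_distrib_left mult.assoc)

lemma dot_scale_right [simp]: "dot x (c *s y) = c * dot x y"
  by (simp add: dot_def sum_distrib_left mult_ac)

lemma dot_zero_left [simp]: "dot 0 x = 0"
  by (simp add: dot_def)

lemma dot_zero_right [simp]: "dot x 0 = 0"
  by (simp add: dot_def)

definition additive_character :: "'p::prime_card mod_ring \<Rightarrow> complex"
  where "additive_character s = exp (2 * complex_of_real pi * \<i> / of_nat CARD('p) * of_int (to_int_mod_ring s))"

lemma character_altdef: "character a x = additive_character (dot x a)"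
  by (simp add: character_def additive_character_def)

lemma card_p_gt_1: "CARD('p::prime_card) > 1"
  using prime_card[where 'a='p] prime_gt_1_nat by blast

lemma exp_mod_prime:
  "exp (2 * complex_of_real pi * \<i> / of_nat CARD('p::prime_card) * of_int (n mod int CARD('p)))
   = exp (2 * complex_of_real pi * \<i> / of_nat CARD('p) * of_int n)"
proof -
  let ?p = "CARD('p)" and ?c = "2 * complex_of_real pi * \<i> / of_nat CARD('p)"
  have "(of_int n :: complex) = of_int (n mod int ?p + int ?p * (n div int ?p))"
    by (simp only: mod_mult_div_eq)
  also have "\<dots> = of_int (n mod int ?p) + of_nat ?p * of_int (n div int ?p)"
    by (simp only: of_int_add of_int_mult of_int_of_nat_eq)
  finally have *: "?c * of_int n = ?c * of_int (n mod int ?p) + (?c * of_nat ?p) * of_int (n div int ?p)"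
    by (simp only: distrib_left mult.assoc)
  have "?c * of_nat ?p = 2 * complex_of_real pi * \<i>"
    by simp
  then have "exp (?c * of_int n) = exp (?c * of_int (n mod int ?p) + 2 * complex_of_real pi * \<i> * of_int (n div int ?p))"
    by (simp only: *)
  also have "\<dots> =
      exp (?c * of_int (n mod int ?p))"
    using exp_plus_2pin[of "?c * of_int (n mod int ?p)" "n div int ?p"] by (simp only: mult_ac)
  finally show ?thesis
    by (rule sym)
qed

lemma additive_character_add: "additive_character (s + t) = additive_character s * additive_character t"
  unfolding additive_character_def to_int_mod_ring_add exp_mod_prime
  by (simp add: distrib_left exp_add)

lemma additive_character_0 [simp]: "additive_character 0 = 1"
  by (simp add: additive_character_def)

lemma norm_additive_character [simp]: "norm (additive_character s) = 1"
proof -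
  have "additive_character s = exp (\<i> * of_real (2 * pi / CARD('a) * of_int (to_int_mod_ring s)))"
    by (simp add: additive_character_def mult_ac)
  then show ?thesis
    using norm_exp_i_times by metis
qed

lemma additive_character_mult_cnj: "additive_character s * cnj (additive_character t) = additive_character (s - t)"
proof -
  have "additive_character s = additive_character (s - t) * additive_character t"
    by (simp flip: additive_character_add)
  then have "additive_character s * cnj (additive_character t) =
      additive_character (s - t) * (additive_character t * cnj (additive_character t))"
    by (simp only: mult.assoc)
  also have "additive_character t * cnj (additive_character t) = 1"
    by (simp add: complex_norm_square[symmetric])
  finally show ?thesis
    by simp
qed

lemma additive_character_of_nat:
  "additive_character (of_nat n :: 'p::prime_card mod_ring) = additive_character (1 :: 'p mod_ring) ^ n"
  by (induction n) (simp_all add: additive_character_add)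

lemma additive_character_one_neq: "additive_character (1 :: 'p::prime_card mod_ring) \<noteq> 1"
proof
  assume "additive_character (1 :: 'p mod_ring) = 1"
  then have "exp (2 * of_real pi * \<i> / of_nat CARD('p)) = 1"
    by (simp add: additive_character_def)
  then obtain n :: int where "2 * pi / CARD('p) = of_int (2 * n) * pi"
    by (auto simp: exp_eq_1)
  then have "1 / CARD('p) = (of_int n :: real)"
    by (simp add: field_simps)
  then have "1 = (of_int (n * int CARD('p)) :: real)"
    by (simp add: field_simps)
  then have "1 = n * int CARD('p)"
    by linarith
  then show False
    using card_p_gt_1[where 'p='p] zmult_eq_1_iff[of n "int CARD('p)"] by simp
qed

lemma UNIV_mod_ring_of_nat: "(UNIV :: 'p::prime_card mod_ring set) = of_nat ` {..<CARD('p)}"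
proof (intro equalityI subsetI)
  fix x :: "'p mod_ring"
  show "x \<in> of_nat ` {..<CARD('p)}"
    using surj_of_nat_mod_ring[of x] by auto
qed simp

lemma inj_on_of_nat_mod_ring: "inj_on (of_nat :: nat \<Rightarrow> 'p::prime_card mod_ring) {..<CARD('p)}"
  proof (rule eq_card_imp_inj_on)
  show "card (of_nat ` {..<CARD('p)} :: 'p mod_ring set) = card {..<CARD('p)}"
    unfolding UNIV_mod_ring_of_nat[symmetric] by simp
qed simp

lemma sum_mod_ring_of_nat:
  "(\<Sum>t\<in>(UNIV :: 'p::prime_card mod_ring set). f t) = (\<Sum>i<CARD('p). f (of_nat i))"
  unfolding UNIV_mod_ring_of_nat by (subst sum.reindex[OF inj_on_of_nat_mod_ring]) simp

lemma sum_by_dot: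
  fixes E :: "('p::prime_card mod_ring ^ 'd::finite) set" and f :: "'p mod_ring \<Rightarrow> 'c::semiring_1"
  shows "(\<Sum>x\<in>E. f (dot x v)) = (\<Sum>t\<in>UNIV. of_nat (card {x\<in>E. dot x v = t}) * f t)"
proof -
  have "(\<Sum>x\<in>E. f (dot x v)) = (\<Sum>t\<in>UNIV. \<Sum>x\<in>{x\<in>E. dot x v = t}. f (dot x v))"
    by (rule sum.group[symmetric]) auto
  also have "\<dots> = (\<Sum>t\<in>UNIV. of_nat (card {x\<in>E. dot x v = t}) * f t)"
    by (intro sum.cong refl) simp
  finally show ?thesis .
qed

text \<open>
  The character sum is a combination of the \<open>p\<close>-th roots of unity with the plane counts as
  coefficients.
\<close>

lemma sum_character_eq_0_iff:
  fixes E :: "('p::prime_card mod_ring ^ 'd::finite) set"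
  shows "(\<Sum>x\<in>E. character v x) = 0 \<longleftrightarrow> equidistributed E v"
proof -
  let ?w = "additive_character (1 :: 'p mod_ring)"
  let ?n = "\<lambda>t. card {x\<in>E. dot x v = t}"
  have eq: "(\<Sum>x\<in>E. character v x) = (\<Sum>i<CARD('p). of_int (int (?n (of_nat i))) * ?w ^ i)"
    unfolding character_altdef sum_by_dot sum_mod_ring_of_nat additive_character_of_nat by simp
  have w: "?w ^ CARD('p) = 1"
    by (simp flip: additive_character_of_nat)
  show ?thesis
  proof
    assume "(\<Sum>x\<in>E. character v x) = 0"
    with eq have "int (?n (of_nat i)) = int (?n (of_nat j))" if "i < CARD('p)" "j < CARD('p)" for i j
      using root_of_unity_sum_zero[OF w additive_character_one_neq _ that, of "\<lambda>i. int (?n (of_nat i))"] by simp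
    then show "equidistributed E v"
      unfolding equidistributed_def
    proof (intro allI)
      fix s t :: "'p mod_ring"
      obtain i j where ij: "i < CARD('p)" "s = of_nat i" "j < CARD('p)" "t = of_nat j"
        using surj_of_nat_mod_ring by blast
      show "?n s = ?n t"
        using \<open>\<And>i j. i < CARD('p) \<Longrightarrow> j < CARD('p) \<Longrightarrow> int (?n (of_nat i)) = int (?n (of_nat j))\<close>[OF ij(1,3)] ij
        by simp
    qed
  next
    assume "equidistributed E v"
    then have n0: "?n t = ?n 0" for t
      unfolding equidistributed_def by blast
    have "(\<Sum>x\<in>E. character v x) = (\<Sum>i<CARD('p). of_nat (?n 0) * ?w ^ i)"
      unfolding eq by (intro sum.cong refl, subst n0) simp
    also have "\<dots> = of_nat (?n 0) * (\<Sum>i<CARD('p). ?w ^ i)"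
      by (simp add: sum_distrib_left)
    also have "(\<Sum>i<CARD('p). ?w ^ i) = 0"
      using power_diff_1_eq[of ?w "CARD('p)"] w additive_character_one_neq[where 'p='p] by auto
    finally show "(\<Sum>x\<in>E. character v x) = 0"
      by simp
  qed
qed

text \<open>
  Mutual orthogonality on \<open>E\<close> of the characters with frequencies in \<open>A\<close>.
\<close>

definition orthogonal_frequencies :: "('p::prime_card mod_ring ^ 'd::finite) set \<Rightarrow> ('p mod_ring ^ 'd) set \<Rightarrow> bool"
  where "orthogonal_frequencies E A \<longleftrightarrow> (\<forall>a\<in>A. \<forall>b\<in>A. a \<noteq> b \<longrightarrow> equidistributed E (a - b))"

lemma L2_inner_character:
  fixes E :: "('p::prime_card mod_ring ^ 'd::finite) set"
  shows "L2_inner E (restrict_to E (character a)) (restrict_to E (character b)) = (\<Sum>x\<in>E. character (a - b) x)"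
  unfolding L2_inner_def restrict_to_def character_altdef
proof (rule sum.cong)
  fix x assume "x \<in> E"
  then show "(if x \<in> E then additive_character (dot x a) else 0) * cnj (if x \<in> E then additive_character (dot x b) else 0) =
      additive_character (dot x (a - b))"
    by (simp add: additive_character_mult_cnj)
qed simp

lemma sum_fun_apply: "(\<Sum>a\<in>A. f a) x = (\<Sum>a\<in>A. f a x)"
  by (induction A rule: infinite_finite_induct) auto

text \<open>
  The basis of point masses computes the dimension of the space of functions on \<open>E\<close>.
\<close>

lemma card_L2_basis:
  fixes E :: "'x::finite set"
  defines "D \<equiv> (\<lambda>e. (\<lambda>x. if x = e then 1 else 0) :: 'x \<Rightarrow> complex) ` E"
  shows "finite D" "card D = card E" "cfun.independent D" "cfun.span D = L2 E"
proof -
  let ?d = "\<lambda>e. (\<lambda>x. if x = e then 1 else 0) :: 'x \<Rightarrow> complex"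
  show fin: "finite D"
    by (simp add: D_def)
  have inj: "inj ?d"
    by (rule injI) (metis (full_types) zero_neq_one)
  show "card D = card E"
    unfolding D_def using inj by (intro card_image) (auto intro: inj_on_subset)
  have expand: "(\<Sum>e\<in>E. cscale (g e) (?d e)) = (\<lambda>x. if x \<in> E then g x else 0)" for g
    by (auto simp: fun_eq_iff cscale_def sum_fun_apply if_distrib cong: if_cong)
  show "cfun.independent D"
  proof
    assume "cfun.dependent D"
    then obtain u e where u: "e \<in> E" "u (?d e) \<noteq> 0" "(\<Sum>v\<in>D. cscale (u v) v) = 0"
      using cfun.dependent_finite[OF fin] by (auto simp: D_def)
    have "(\<Sum>v\<in>D. cscale (u v) v) = (\<Sum>e\<in>E. cscale (u (?d e)) (?d e))"
      unfolding D_def using inj by (subst sum.reindex) (auto intro: inj_on_subset)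
    then have "(\<lambda>x. if x \<in> E then u (?d x) else 0) = (0 :: 'x \<Rightarrow> complex)"
      unfolding u(3) expand by (rule sym)
    from fun_cong[OF this, of e] show False
      using u(1,2) by simp
  qed
  show "cfun.span D = L2 E"
  proof
    show "cfun.span D \<subseteq> L2 E"
      by (rule cfun.span_minimal)
        (auto simp: D_def L2_def cscale_def intro!: cfun.subspaceI)
    show "L2 E \<subseteq> cfun.span D"
    proof
      fix f assume "f \<in> L2 E"
      then have "f = (\<Sum>e\<in>E. cscale (f e) (?d e))"
        unfolding expand by (auto simp: L2_def)
      also have "\<dots> \<in> cfun.span D"
        by (intro cfun.span_sum cfun.span_scale cfun.span_base) (auto simp: D_def)
      finally show "f \<in> cfun.span D" .
    qed
  qed
qed

text \<open>
  Orthogonal nonzero vectors are independent, so an orthogonal family is a basis iff its size is the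
  dimension \<open>card E\<close>. The family is injective because a function of positive norm is not orthogonal
  to itself.
\<close>

theorem is_spectrum_iff:
  fixes E :: "('p::prime_card mod_ring ^ 'd::finite) set"
  assumes "E \<noteq> {}"
  shows "is_spectrum E A \<longleftrightarrow> card A = card E \<and> orthogonal_frequencies E A"
proof -
  let ?f = "\<lambda>a. restrict_to E (character a)"
  let ?d = "\<lambda>e. (\<lambda>x. if x = e then 1 else 0) :: 'p mod_ring ^ 'd \<Rightarrow> complex"
  note D = card_L2_basis[of E]
  have spanL2: "cfun.span (L2 E) = L2 E"
    unfolding D(4)[symmetric] by (rule cfun.span_span)
  have orth: "(\<forall>a\<in>A. \<forall>b\<in>A. a \<noteq> b \<longrightarrow> L2_inner E (?f a) (?f b) = 0) \<longleftrightarrow> orthogonal_frequencies E A"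
    by (simp add: L2_inner_character sum_character_eq_0_iff orthogonal_frequencies_def)
  show ?thesis
  proof
    assume "is_spectrum E A"
    then have *: "inj_on ?f A" "cfun.independent (?f ` A)" "cfun.span (?f ` A) = L2 E" "orthogonal_frequencies E A"
      by (auto simp: is_spectrum_def orthogonal_basis_on_def orth)
    have "cfun.dim (L2 E) = card (?f ` A)"
      by (rule cfun.dim_eq_card[OF _ *(2)]) (simp only: *(3) spanL2)
    moreover have "cfun.dim (L2 E) = card (?d ` E)"
      by (rule cfun.dim_eq_card[OF _ D(3)]) (simp only: D(4) spanL2)
    ultimately show "card A = card E \<and> orthogonal_frequencies E A"
      using *(4) card_image[OF *(1)] D(2) by simp
  next
    assume *: "card A = card E \<and> orthogonal_frequencies E A"
    have inner0: "L2_inner E (?f a) (?f b) = 0" if "a \<in> A" "b \<in> A" "a \<noteq> b" for a b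
      using * that orth by blast
    have inner1: "L2_inner E (?f a) (?f a) \<noteq> 0" for a
      using \<open>E \<noteq> {}\<close> by (simp add: L2_inner_character character_altdef)
    have inj: "inj_on ?f A"
    proof (rule inj_onI, rule ccontr)
      fix a b assume "a \<in> A" "b \<in> A" "?f a = ?f b" "a \<noteq> b"
      then show False
        using inner0[of a b] inner1[of a] by simp
    qed
    have ind: "cfun.independent (?f ` A)"
    proof
      assume "cfun.dependent (?f ` A)"
      then obtain u a where u: "a \<in> A" "u (?f a) \<noteq> 0" "(\<Sum>v\<in>?f ` A. cscale (u v) v) = 0"
        using cfun.dependent_finite[of "?f ` A"] by auto
      have "(\<Sum>b\<in>A. cscale (u (?f b)) (?f b)) = 0"
        using u(3) unfolding sum.reindex[OF inj] o_def .
      then have "0 = L2_inner E (\<Sum>b\<in>A. cscale (u (?f b)) (?f b)) (?f a)"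
        by (simp add: L2_inner_def)
      also have "\<dots> = (\<Sum>b\<in>A. u (?f b) * L2_inner E (?f b) (?f a))"
        unfolding L2_inner_def sum_fun_apply cscale_def
        by (simp add: sum_distrib_right sum_distrib_left mult.assoc) (rule sum.swap)
      also have "\<dots> = (\<Sum>b\<in>{a}. u (?f b) * L2_inner E (?f b) (?f a))"
        using u(1) inner0 by (intro sum.mono_neutral_right) auto
      also have "\<dots> \<noteq> 0"
        using u(2) inner1 by simp
      finally show False by simp
    qed
    have "?f ` A \<subseteq> L2 E"
      by (auto simp: L2_def restrict_to_def)
    have "L2 E \<subseteq> cfun.span (?f ` A)"
    proof
      fix g assume g: "g \<in> L2 E"
      show "g \<in> cfun.span (?f ` A)"
      proof (rule ccontr)
        assume g': "g \<notin> cfun.span (?f ` A)"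
        then have "cfun.independent (insert g (?f ` A))"
          using ind by (rule cfun.independent_insertI)
        then have le: "card (insert g (?f ` A)) \<le> card (?d ` E)"
        proof (intro conjunct2[OF cfun.independent_span_bound[OF D(1)]])
          show "insert g (?f ` A) \<subseteq> cfun.span (?d ` E)"
            unfolding D(4) using g \<open>?f ` A \<subseteq> L2 E\<close> by (rule insert_subsetI)
        qed
        have "g \<notin> ?f ` A"
          using g' by (rule contrapos_nn) (rule cfun.span_base)
        then have "card (insert g (?f ` A)) = Suc (card (?f ` A))"
          by (intro card_insert_disjoint finite_imageI finite)
        also have "card (?f ` A) = card E"
          using card_image[OF inj] * by (simp only:)
        finally show False
          using le unfolding D(2) by simp
      qed
    qed
    moreover have "cfun.span (?f ` A) \<subseteq> L2 E"
      using cfun.span_mono[OF \<open>?f ` A \<subseteq> L2 E\<close>] spanL2 by simp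
    ultimately show "is_spectrum E A"
      using inj ind * orth by (auto simp: is_spectrum_def orthogonal_basis_on_def)
  qed
qed

lemma sum_swap_pairs:
  "(\<Sum>x\<in>X. \<Sum>y\<in>Y. \<Sum>a\<in>A. \<Sum>b\<in>B. f x y a b) = (\<Sum>a\<in>A. \<Sum>b\<in>B. \<Sum>x\<in>X. \<Sum>y\<in>Y. f x y a b)"
proof -
  have "(\<Sum>x\<in>X. \<Sum>y\<in>Y. \<Sum>a\<in>A. \<Sum>b\<in>B. f x y a b) = (\<Sum>x\<in>X. \<Sum>a\<in>A. \<Sum>b\<in>B. \<Sum>y\<in>Y. f x y a b)"
    by (intro sum.cong refl, subst sum.swap, intro sum.cong refl, rule sum.swap)
  also have "\<dots> = (\<Sum>a\<in>A. \<Sum>x\<in>X. \<Sum>b\<in>B. \<Sum>y\<in>Y. f x y a b)"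
    by (rule sum.swap)
  also have "\<dots> = (\<Sum>a\<in>A. \<Sum>b\<in>B. \<Sum>x\<in>X. \<Sum>y\<in>Y. f x y a b)"
    by (intro sum.cong refl) (rule sum.swap)
  finally show ?thesis .
qed

text \<open>
  A square matrix whose rows are orthogonal and of equal norm has orthogonal columns. Concretely,
  the sum of the squared moduli of the inner products \<open>?G x y\<close> of columns can be computed from the
  rows; the diagonal terms already exhaust it, so the other terms vanish.
\<close>

lemma orthogonal_frequencies_dual:
  fixes E A :: "('p::prime_card mod_ring ^ 'd::finite) set"
  assumes card: "card A = card E" and orth: "orthogonal_frequencies E A"
  shows "orthogonal_frequencies A E"
proof -
  let ?G = "\<lambda>x y. \<Sum>a\<in>A. character a x * cnj (character a y)"
  have inner: "(\<Sum>x\<in>E. cnj (character a x) * character b x) = (if a = b then of_nat (card E) else 0)"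
    if "a \<in> A" "b \<in> A" for a b
  proof -
    have "(\<Sum>x\<in>E. cnj (character a x) * character b x) = (\<Sum>x\<in>E. character (b - a) x)"
      unfolding character_altdef
      by (intro sum.cong refl, subst mult.commute) (simp add: additive_character_mult_cnj)
    also have "\<dots> = (if a = b then of_nat (card E) else 0)"
    proof (cases "a = b")
      case False
      then show ?thesis
        using orth that by (simp add: orthogonal_frequencies_def sum_character_eq_0_iff)
    qed (simp add: character_altdef)
    finally show ?thesis .
  qed
  have "(\<Sum>x\<in>E. \<Sum>y\<in>E. ?G x y * cnj (?G x y)) =
      (\<Sum>x\<in>E. \<Sum>y\<in>E. \<Sum>a\<in>A. \<Sum>b\<in>A. (character a x * cnj (character b x)) * (cnj (character a y) * character b y))"
    unfolding cnj_sum complex_cnj_mult complex_cnj_cnj sum_product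
    by (intro sum.cong refl) (simp only: mult_ac)
  also have "\<dots> = (\<Sum>a\<in>A. \<Sum>b\<in>A. (\<Sum>x\<in>E. character a x * cnj (character b x)) * (\<Sum>y\<in>E. cnj (character a y) * character b y))"
    unfolding sum_product by (rule sum_swap_pairs)
  also have "\<dots> = (\<Sum>a\<in>A. \<Sum>b\<in>A. if a = b then of_nat (card E) * of_nat (card E) else 0)"
  proof (intro sum.cong refl)
    fix a b assume ab: "a \<in> A" "b \<in> A"
    have "(\<Sum>x\<in>E. character a x * cnj (character b x)) = (\<Sum>x\<in>E. cnj (character b x) * character a x)"
      by (intro sum.cong refl) (rule mult.commute)
    then show "(\<Sum>x\<in>E. character a x * cnj (character b x)) * (\<Sum>y\<in>E. cnj (character a y) * character b y) =
        (if a = b then of_nat (card E) * of_nat (card E) else 0)"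
      using inner[OF ab] inner[OF ab(2,1)] by simp
  qed
  also have "\<dots> = (\<Sum>x\<in>E. \<Sum>y\<in>E. complex_of_real (if x = y then real (card E) * real (card E) else 0))"
    by (simp add: card if_distrib[of complex_of_real] cong: if_cong)
  finally have eq: "(\<Sum>x\<in>E. \<Sum>y\<in>E. ?G x y * cnj (?G x y)) =
      (\<Sum>x\<in>E. \<Sum>y\<in>E. complex_of_real (if x = y then real (card E) * real (card E) else 0))" .
  (* subtracting the diagonal leaves a sum of nonnegative terms equal to zero *)
  have diag: "?G x x = of_nat (card E)" for x
    by (simp add: character_altdef additive_character_mult_cnj card)
  define F where "F x y = (norm (?G x y))\<^sup>2 - (if x = y then real (card E) * real (card E) else 0)" for x y
  have "complex_of_real (\<Sum>x\<in>E. \<Sum>y\<in>E. F x y) = 0"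
    unfolding F_def of_real_sum of_real_diff sum_subtractf complex_norm_square eq by (rule diff_self)
  then have "(\<Sum>x\<in>E. \<Sum>y\<in>E. F x y) = 0"
    by (simp only: of_real_eq_0_iff)
  moreover have F: "F x y \<ge> 0" for x y
    using diag[of x] by (auto simp: F_def power2_eq_square)
  ultimately have "(\<Sum>y\<in>E. F x y) = 0" if "x \<in> E" for x
    using that by (subst (asm) sum_nonneg_eq_0_iff) (auto intro: sum_nonneg)
  then have F0: "F x y = 0" if "x \<in> E" "y \<in> E" for x y
    using that F by (subst (asm) sum_nonneg_eq_0_iff) auto
  have G0: "?G x y = 0" if "x \<in> E" "y \<in> E" "x \<noteq> y" for x y
    using that(3) F0[OF that(1,2)] unfolding F_def by simp
  have "?G x y = (\<Sum>a\<in>A. character (x - y) a)" for x y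
    unfolding character_altdef additive_character_mult_cnj dot_diff_right
    by (simp only: dot_commute[of x] dot_commute[of y])
  with G0 show ?thesis
    by (simp add: orthogonal_frequencies_def flip: sum_character_eq_0_iff)
qed

section \<open>Planes, lines and directions\<close>

lemma dot_nonzero_witness:
  fixes v :: "'p::prime_card mod_ring ^ 'd::finite"
  assumes "v \<noteq> 0"
  obtains u where "dot u v = 1"
proof -
  obtain i where i: "v $ i \<noteq> 0"
    using assms by (auto simp: vec_eq_iff)
  have "dot (axis i (inverse (v $ i))) v = (\<Sum>j\<in>UNIV. if j = i then 1 else 0)"
    unfolding dot_def using i by (intro sum.cong refl) (auto simp: axis_def)
  then show thesis
    using that by simp
qed

text \<open>
  If \<open>v $ i \<noteq> 0\<close>, a vector orthogonal to all \<open>v $ i *s axis j 1 - v $ j *s axis i 1\<close>, which are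
  orthogonal to \<open>v\<close>, is a multiple of \<open>v\<close>.
\<close>

lemma perp_witness:
  fixes v w :: "'p::prime_card mod_ring ^ 'd::finite"
  assumes "v \<noteq> 0" "\<nexists>c. w = c *s v"
  obtains u where "dot u v = 0" "dot u w \<noteq> 0"
proof -
  obtain i where i: "v $ i \<noteq> 0"
    using assms(1) by (auto simp: vec_eq_iff)
  define u where "u j = v $ i *s axis j 1 - v $ j *s axis i (1 :: 'p mod_ring)" for j
  have dot_axis: "dot (axis j 1) x = x $ j" for j and x :: "'p mod_ring ^ 'd"
  proof -
    have "dot (axis j 1) x = (\<Sum>k\<in>UNIV. if k = j then x $ j else 0)"
      unfolding dot_def by (intro sum.cong refl) (auto simp: axis_def)
    then show ?thesis by simp
  qed
  have u: "dot (u j) x = v $ i * x $ j - v $ j * x $ i" for j x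
    by (simp add: u_def dot_axis)
  have "\<exists>j. dot (u j) w \<noteq> 0"
  proof (rule ccontr)
    assume "\<not> (\<exists>j. dot (u j) w \<noteq> 0)"
    then have wj: "w $ j = (w $ i / v $ i) * v $ j" for j
      using i by (simp add: u field_simps)
    have "w = (w $ i / v $ i) *s v"
      unfolding vec_eq_iff vector_smult_component using wj by (rule allI)
    then show False
      using assms(2) by blast
  qed
  then obtain j where "dot (u j) w \<noteq> 0"
    by blast
  moreover have "dot (u j) v = 0"
    by (simp add: u)
  ultimately show thesis
    using that by blast
qed

definition plane_count :: "('p::prime_card mod_ring ^ 'd::finite) set \<Rightarrow> 'p mod_ring ^ 'd \<Rightarrow> 'p mod_ring \<Rightarrow> nat"
  where "plane_count E v t = card {e\<in>E. dot e v = t}"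

lemma equidistributed_iff: "equidistributed E v \<longleftrightarrow> (\<forall>s t. plane_count E v s = plane_count E v t)"
  unfolding equidistributed_def plane_count_def ..

lemma equidistributedD: "equidistributed E v \<Longrightarrow> plane_count E v s = plane_count E v t"
  unfolding equidistributed_iff by blast

lemma sum_plane_count:
  "(\<Sum>t\<in>UNIV. plane_count E v t) = card (E :: ('p::prime_card mod_ring ^ 'd::finite) set)"
proof -
  have "(\<Sum>x\<in>E. 1 :: nat) = (\<Sum>t\<in>UNIV. of_nat (card {x\<in>E. dot x v = t}) * 1)"
    by (rule sum_by_dot)
  then show ?thesis
    unfolding plane_count_def by (simp only: of_nat_id mult_1_right card_eq_sum[of E])
qed

lemma equidistributed_plane_count:
  fixes E :: "('p::prime_card mod_ring ^ 'd::finite) set"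
  assumes "equidistributed E v"
  shows "CARD('p) * plane_count E v t = card E"
proof -
  have "card E = (\<Sum>s\<in>(UNIV :: 'p mod_ring set). plane_count E v t)"
    unfolding sum_plane_count[of E v, symmetric]
    using assms by (intro sum.cong refl equidistributedD)
  then show ?thesis
    by simp
qed

lemma equidistributed_scale:
  fixes E :: "('p::prime_card mod_ring ^ 'd::finite) set"
  assumes "c \<noteq> 0"
  shows "equidistributed E (c *s v) \<longleftrightarrow> equidistributed E v"
proof -
  have *: "plane_count E (c *s v) t = plane_count E v (t / c)" for t
    unfolding plane_count_def using assms
    by (intro arg_cong[where f=card]) (auto simp: field_simps)
  have "equidistributed E (c *s v)" if "equidistributed E v"
    unfolding equidistributed_iff * using equidistributedD[OF that] by blast
  moreover have "equidistributed E v" if "equidistributed E (c *s v)"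
    unfolding equidistributed_iff
  proof (intro allI)
    fix s t
    show "plane_count E v s = plane_count E v t"
      using equidistributedD[OF that, of "c * s" "c * t"] assms by (simp add: *)
  qed
  ultimately show ?thesis
    by blast
qed

text \<open>
  Translations along \<open>u\<close> permute the planes normal to \<open>v\<close> transitively.
\<close>

lemma equidistributed_invariant:
  fixes S :: "('p::prime_card mod_ring ^ 'd::finite) set"
  assumes inv: "\<And>x c. x \<in> S \<Longrightarrow> x + c *s u \<in> S" and "dot u v \<noteq> 0"
  shows "equidistributed S v"
proof -
  have le: "plane_count S v s \<le> plane_count S v t" for s t
    unfolding plane_count_def
  proof (rule card_inj_on_le)
    let ?f = "\<lambda>x. x + ((t - s) / dot u v) *s u"
    show "inj_on ?f {e\<in>S. dot e v = s}"
      by (auto simp: inj_on_def)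
    show "?f ` {e\<in>S. dot e v = s} \<subseteq> {e\<in>S. dot e v = t}"
      using assms by auto
  qed simp
  then show ?thesis
    unfolding equidistributed_iff by (meson le_antisym)
qed

type_synonym 'p space3 = "'p mod_ring ^ 3"

lemma card_space3: "card (UNIV :: 'p::prime_card space3 set) = CARD('p) ^ 3"
  by simp

lemma card_plane:
  fixes v :: "'p::prime_card space3"
  assumes "v \<noteq> 0"
  shows "card {x. dot x v = t} = CARD('p)\<^sup>2"
proof -
  obtain u where "dot u v = 1"
    using assms dot_nonzero_witness by blast
  then have "equidistributed UNIV v"
    by (intro equidistributed_invariant[of _ u]) auto
  from equidistributed_plane_count[OF this, of t] have "CARD('p) * card {x. dot x v = t} = CARD('p) ^ 3"
    by (simp add: plane_count_def)
  then show ?thesis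
    using card_p_gt_1[where 'p='p] by (simp add: power3_eq_cube power2_eq_square)
qed

lemma card_line:
  fixes v w :: "'p::prime_card space3"
  assumes "v \<noteq> 0" "\<nexists>c. w = c *s v"
  shows "card {x. dot x v = s \<and> dot x w = t} = CARD('p)"
proof -
  obtain u where u: "dot u v = 0" "dot u w \<noteq> 0"
    using perp_witness[OF assms] by blast
  then have "equidistributed {x. dot x v = s} w"
    by (intro equidistributed_invariant[of _ u]) auto
  from equidistributed_plane_count[OF this, of t] have "CARD('p) * card {x. dot x v = s \<and> dot x w = t} = CARD('p)\<^sup>2"
    by (simp add: plane_count_def card_plane[OF assms(1)])
  then show ?thesis
    using card_p_gt_1[where 'p='p] by (simp add: power2_eq_square)
qed

text \<open>
  The points of the projective plane, as vectors whose first nonzero coordinate is \<open>1\<close>.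
\<close>

definition proj_points :: "'p::prime_card space3 set"
  where "proj_points = {v. v $ 1 = 1 \<or> (v $ 1 = 0 \<and> v $ 2 = 1) \<or> (v $ 1 = 0 \<and> v $ 2 = 0 \<and> v $ 3 = 1)}"

lemma proj_points_nonzero: "v \<in> proj_points \<Longrightarrow> v \<noteq> 0"
  by (auto simp: proj_points_def)

lemma proj_points_scale_eq:
  assumes "v \<in> proj_points" "c *s v \<in> proj_points"
  shows "c = 1"
  using assms by (auto simp: proj_points_def)

lemma proj_points_rep:
  fixes x :: "'p::prime_card space3"
  assumes "x \<noteq> 0"
  obtains c v where "v \<in> proj_points" "c \<noteq> 0" "x = c *s v"
proof -
  define a where "a = (if x $ 1 \<noteq> 0 then x $ 1 else if x $ 2 \<noteq> 0 then x $ 2 else x $ 3)"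
  have "a \<noteq> 0"
    using assms by (auto simp: a_def vec_eq_iff forall_3)
  moreover have "(1 / a) *s x \<in> proj_points"
    using \<open>a \<noteq> 0\<close> by (auto simp: a_def proj_points_def)
  ultimately show thesis
    by (intro that[of "(1 / a) *s x" a]) (simp_all add: vec_eq_iff)
qed

text \<open>
  Every class of nonzero vectors up to scaling has \<open>p - 1\<close> elements and one normalized
  representative.
\<close>

lemma card_cone:
  fixes S :: "'p::prime_card space3 set"
  assumes "0 \<notin> S" "\<And>x c. x \<in> S \<Longrightarrow> c \<noteq> 0 \<Longrightarrow> c *s x \<in> S"
  shows "card S = (CARD('p) - 1) * card (S \<inter> proj_points)"
proof -
  have "bij_betw (\<lambda>(c, v). c *s v) ((UNIV - {0}) \<times> (S \<inter> proj_points)) S"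
  proof (rule bij_betwI')
    fix x y :: "'p mod_ring \<times> 'p space3"
    assume "x \<in> (UNIV - {0}) \<times> (S \<inter> proj_points)" "y \<in> (UNIV - {0}) \<times> (S \<inter> proj_points)"
    then obtain c v d w where xy: "x = (c, v)" "y = (d, w)" "c \<noteq> 0" "d \<noteq> 0" "v \<in> proj_points" "w \<in> proj_points"
      by auto
    show "((case x of (c, v) \<Rightarrow> c *s v) = (case y of (c, v) \<Rightarrow> c *s v)) = (x = y)"
    proof
      assume "(case x of (c, v) \<Rightarrow> c *s v) = (case y of (c, v) \<Rightarrow> c *s v)"
      then have "c *s v = d *s w"
        by (simp add: xy)
      then have w: "w = (c / d) *s v"
        using xy(4) by (simp add: vec_eq_iff field_simps)
      have "c / d = 1"
        by (rule proj_points_scale_eq[OF xy(5) xy(6)[unfolded w]])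
      then show "x = y"
        using w xy(1,2,4) by simp
    qed simp
  next
    fix x :: "'p mod_ring \<times> 'p space3"
    assume "x \<in> (UNIV - {0}) \<times> (S \<inter> proj_points)"
    then show "(case x of (c, v) \<Rightarrow> c *s v) \<in> S"
      using assms(2) by auto
  next
    fix y :: "'p space3"
    assume "y \<in> S"
    then have "y \<noteq> 0"
      using assms(1) by blast
    then obtain c v where cv: "v \<in> proj_points" "c \<noteq> 0" "y = c *s v"
      by (rule proj_points_rep)
    have "(1 / c) *s y \<in> S"
      by (rule assms(2)[OF \<open>y \<in> S\<close>]) (simp add: cv(2))
    then have "v \<in> S"
      by (simp add: cv(2,3))
    then show "\<exists>x\<in>(UNIV - {0}) \<times> (S \<inter> proj_points). y = (case x of (c, v) \<Rightarrow> c *s v)"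
      using cv by (intro bexI[of _ "(c, v)"]) simp_all
  qed
  from bij_betw_same_card[OF this, symmetric] show ?thesis
    by (simp only: card_cartesian_product) (simp add: card_Diff_subset)
qed

lemma scale_eq_0_iff [simp]: "c *s v = 0 \<longleftrightarrow> c = 0 \<or> v = (0 :: 'p::prime_card mod_ring ^ 'd::finite)"
  by (auto simp: vec_eq_iff)

lemma card_proj_points: "card (proj_points :: 'p::prime_card space3 set) = CARD('p)\<^sup>2 + CARD('p) + 1"
proof -
  let ?p = "CARD('p)"
  have "card (UNIV - {0 :: 'p space3}) = (?p - 1) * card ((UNIV - {0}) \<inter> (proj_points :: 'p space3 set))"
    by (rule card_cone) auto
  also have "(UNIV - {0}) \<inter> (proj_points :: 'p space3 set) = proj_points"
    using proj_points_nonzero by auto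
  also have "card (UNIV - {0 :: 'p space3}) = ?p ^ 3 - 1"
    by (subst card_Diff_subset) (simp_all add: card_space3)
  also have "\<dots> = (?p - 1) * (?p\<^sup>2 + ?p + 1)"
    by (cases ?p) (simp_all add: power3_eq_cube power2_eq_square algebra_simps)
  finally have "(?p - 1) * (?p\<^sup>2 + ?p + 1) = (?p - 1) * card (proj_points :: 'p space3 set)" .
  then show ?thesis
    using card_p_gt_1[where 'p='p] by (simp only: mult_cancel1) linarith
qed

text \<open>
  A line of the projective plane. Its points are read in two ways: as normals, they are the planes
  that contain the affine lines of direction \<open>v\<close>; as directions, they are the directions of the
  affine lines in a plane with normal \<open>v\<close>.
\<close>

definition proj_line :: "'p::prime_card space3 \<Rightarrow> 'p space3 set"
  where "proj_line v = {d\<in>proj_points. dot d v = 0}"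

lemma proj_line_scale: "c \<noteq> 0 \<Longrightarrow> proj_line (c *s v) = proj_line v"
  by (simp add: proj_line_def)

lemma in_proj_line_commute:
  "v \<in> proj_points \<Longrightarrow> d \<in> proj_points \<Longrightarrow> d \<in> proj_line v \<longleftrightarrow> v \<in> proj_line d"
  by (simp add: proj_line_def dot_commute[of d v])

lemma proj_line_subset: "proj_line v \<subseteq> proj_points"
  by (auto simp: proj_line_def)

lemma card_proj_line:
  fixes v :: "'p::prime_card space3"
  assumes "v \<noteq> 0"
  shows "card (proj_line v) = CARD('p) + 1"
proof -
  let ?p = "CARD('p)"
  let ?S = "{x. dot x v = 0} - {0}"
  have "card ?S = (?p - 1) * card (?S \<inter> proj_points)"
    by (rule card_cone) auto
  also have "?S \<inter> proj_points = proj_line v"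
    using proj_points_nonzero by (auto simp: proj_line_def)
  also have "card ?S = ?p\<^sup>2 - 1"
    by (subst card_Diff_subset) (simp_all add: card_plane[OF assms])
  also have "\<dots> = (?p - 1) * (?p + 1)"
    by (cases ?p) (simp_all add: power2_eq_square algebra_simps)
  finally have "(?p - 1) * (?p + 1) = (?p - 1) * card (proj_line v)" .
  then show ?thesis
    using card_p_gt_1[where 'p='p] by (simp only: mult_cancel1) linarith
qed

lemma card_proj_line_Int:
  fixes v w :: "'p::prime_card space3"
  assumes "v \<noteq> 0" "\<nexists>c. w = c *s v"
  shows "card (proj_line v \<inter> proj_line w) = 1"
proof -
  let ?p = "CARD('p)"
  let ?S = "{x. dot x v = 0 \<and> dot x w = 0} - {0}"
  have "card ?S = (?p - 1) * card (?S \<inter> proj_points)"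
    by (rule card_cone) auto
  also have "?S \<inter> proj_points = proj_line v \<inter> proj_line w"
    using proj_points_nonzero by (auto simp: proj_line_def)
  also have "card ?S = (?p - 1) * 1"
    by (subst card_Diff_subset) (simp_all add: card_line[OF assms])
  finally show ?thesis
    using card_p_gt_1[where 'p='p] by simp
qed

lemma proj_points_not_parallel:
  assumes "v \<in> proj_points" "w \<in> proj_points" "v \<noteq> w"
  shows "\<nexists>c. w = c *s v"
proof
  assume "\<exists>c. w = c *s v"
  then obtain c where c: "w = c *s v"
    by blast
  have "c = 1"
    by (rule proj_points_scale_eq[OF assms(1) assms(2)[unfolded c]])
  with assms(3) c show False
    by simp
qed

lemma card_proj_line_Int_points:
  assumes "v \<in> proj_points" "w \<in> proj_points" "v \<noteq> w"
  shows "card (proj_line v \<inter> proj_line w) = 1"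
  by (rule card_proj_line_Int[OF proj_points_nonzero[OF assms(1)] proj_points_not_parallel[OF assms]])

section \<open>Counting incidences\<close>

lemma card_filter_eq_sum: "finite I \<Longrightarrow> card {i\<in>I. P i} = (\<Sum>i\<in>I. if P i then 1 else 0)"
  by (simp add: sum.If_cases Int_def)

lemma sum_card_swap:
  assumes "finite D" "finite I"
  shows "(\<Sum>d\<in>D. card {i\<in>I. R d i}) = (\<Sum>i\<in>I. card {d\<in>D. R d i})"
  unfolding card_filter_eq_sum[OF assms(1)] card_filter_eq_sum[OF assms(2)] by (rule sum.swap)

lemma proj_line_0 [simp]: "proj_line 0 = proj_points"
  by (simp add: proj_line_def)

text \<open>
  The point \<open>x\<close> lies on all planes through \<open>x\<close>, any other point on \<open>p + 1\<close> of them. The points form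
  a family because the lemma is applied to the combinations of the points of two sets.
\<close>

lemma sum_planes_through_point:
  fixes \<phi> :: "'i \<Rightarrow> 'p::prime_card space3"
  assumes "finite I"
  shows "(\<Sum>d\<in>proj_points. card {i\<in>I. dot (\<phi> i) d = dot x d}) =
    CARD('p)\<^sup>2 * card {i\<in>I. \<phi> i = x} + (CARD('p) + 1) * card I"
proof -
  have "(\<Sum>d\<in>proj_points. card {i\<in>I. dot (\<phi> i) d = dot x d}) = (\<Sum>i\<in>I. card (proj_line (\<phi> i - x)))"
    by (subst sum_card_swap) (simp_all add: assms proj_line_def dot_commute)
  also have "\<dots> = (\<Sum>i\<in>I. CARD('p)\<^sup>2 * (if \<phi> i = x then 1 else 0) + (CARD('p) + 1))"
    by (intro sum.cong refl) (simp add: card_proj_points card_proj_line)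
  also have "\<dots> = CARD('p)\<^sup>2 * card {i\<in>I. \<phi> i = x} + (CARD('p) + 1) * card I"
    unfolding card_filter_eq_sum[OF assms] sum.distrib sum_distrib_left by simp
  finally show ?thesis .
qed

definition line_count :: "('p::prime_card mod_ring ^ 'd::finite) set \<Rightarrow> 'p mod_ring ^ 'd \<Rightarrow> 'p mod_ring ^ 'd \<Rightarrow> nat"
  where "line_count E v x = card {e\<in>E. \<exists>c. e - x = c *s v}"

text \<open>
  Of the \<open>p + 1\<close> planes through an affine line, a point on the line lies on all and any other point
  on one.
\<close>

lemma sum_planes_through_line:
  fixes E :: "'p::prime_card space3 set"
  assumes "v \<noteq> 0"
  shows "(\<Sum>d\<in>proj_line v. plane_count E d (dot x d)) = CARD('p) * line_count E v x + card E"
proof -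
  have "(\<Sum>d\<in>proj_line v. plane_count E d (dot x d)) = (\<Sum>e\<in>E. card {d\<in>proj_line v. dot e d = dot x d})"
    unfolding plane_count_def by (rule sum_card_swap) simp_all
  also have "\<dots> = (\<Sum>e\<in>E. CARD('p) * (if \<exists>c. e - x = c *s v then 1 else 0) + 1)"
  proof (intro sum.cong refl)
    fix e
    have eq: "{d\<in>proj_line v. dot e d = dot x d} = proj_line v \<inter> proj_line (e - x)"
      by (auto simp: proj_line_def dot_commute[of _ e] dot_commute[of _ x])
    show "card {d\<in>proj_line v. dot e d = dot x d} = CARD('p) * (if \<exists>c. e - x = c *s v then 1 else 0) + 1"
    proof (cases "\<exists>c. e - x = c *s v")
      case True
      then have "proj_line v \<inter> proj_line (e - x) = proj_line v"
        by (auto simp: proj_line_def simp del: dot_diff_right)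
      with True show ?thesis
        unfolding eq by (simp add: card_proj_line[OF assms])
    next
      case False
      then show ?thesis
        unfolding eq by (simp only: card_proj_line_Int[OF assms False]) simp
    qed
  qed
  also have "\<dots> = CARD('p) * line_count E v x + card E"
    unfolding line_count_def card_filter_eq_sum[OF finite] sum.distrib sum_distrib_left by simp
  finally show ?thesis .
qed

text \<open>
  Equidistribution in all directions makes the number of incidences with the planes through \<open>x\<close>
  independent of \<open>x\<close>, hence also the number of members equal to \<open>x\<close>.
\<close>

lemma uniform_family_fibre:
  fixes \<phi> :: "'i \<Rightarrow> 'p::prime_card space3"
  assumes "finite I" and unif: "\<And>d t. d \<in> proj_points \<Longrightarrow> CARD('p) * card {i\<in>I. dot (\<phi> i) d = t} = card I"
  shows "CARD('p) ^ 3 * card {i\<in>I. \<phi> i = x} = card I"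
proof -
  let ?p = "CARD('p)"
  have "(?p\<^sup>2 + ?p + 1) * card I = (\<Sum>d\<in>(proj_points :: 'p space3 set). ?p * card {i\<in>I. dot (\<phi> i) d = dot x d})"
    by (simp add: unif card_proj_points)
  also have "\<dots> = ?p * (?p\<^sup>2 * card {i\<in>I. \<phi> i = x} + (?p + 1) * card I)"
    by (simp only: sum_planes_through_point[OF assms(1)] flip: sum_distrib_left)
  finally show ?thesis
    by (simp add: power3_eq_cube power2_eq_square algebra_simps)
qed

lemma equidistributed_everywhere:
  fixes E :: "'p::prime_card space3 set"
  assumes "\<And>d. d \<in> proj_points \<Longrightarrow> equidistributed E d"
  shows "E = {} \<or> E = UNIV"
proof -
  have eq: "CARD('p) ^ 3 * card {e\<in>E. e = x} = card E" for x
    using uniform_family_fibre[of E "\<lambda>e. e" x] equidistributed_plane_count[OF assms]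
    by (simp add: plane_count_def)
  show ?thesis
  proof (cases "E = UNIV")
    case False
    then obtain x where "x \<notin> E"
      by blast
    then have "{e\<in>E. e = x} = {}"
      by blast
    with eq[of x] show ?thesis
      by simp
  qed simp
qed

section \<open>Sets of extreme size\<close>

text \<open>
  The set is the graph of a partial function on the quotient by the line spanned by \<open>u\<close>.
\<close>

definition misses_direction :: "('p::prime_card mod_ring ^ 'd::finite) set \<Rightarrow> 'p mod_ring ^ 'd \<Rightarrow> bool"
  where "misses_direction E u \<longleftrightarrow> (\<forall>e\<in>E. \<forall>e'\<in>E. \<forall>c. e - e' = c *s u \<longrightarrow> e = e')"

lemma misses_direction_inj:
  assumes "misses_direction E u" "u \<noteq> 0"
  shows "inj_on (\<lambda>(e, s). e + s *s u) (E \<times> UNIV)"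
proof (rule inj_onI)
  fix x y assume xy: "x \<in> E \<times> UNIV" "y \<in> E \<times> UNIV"
    and eq: "(case x of (e, s) \<Rightarrow> e + s *s u) = (case y of (e, s) \<Rightarrow> e + s *s u)"
  obtain e s e' s' where x: "x = (e, s)" and y: "y = (e', s')"
    by fastforce
  have "e - e' = (s' - s) *s u"
    using eq x y by (simp add: vector_sub_rdistrib algebra_simps)
  then have "e = e'"
    using assms(1) xy x y unfolding misses_direction_def by blast
  moreover from this have "(s' - s) *s u = 0"
    using \<open>e - e' = (s' - s) *s u\<close> by simp
  ultimately show "x = y"
    using assms(2) x y by simp
qed

lemma misses_direction_card:
  fixes E :: "'p::prime_card space3 set"
  assumes "misses_direction E u" "u \<noteq> 0"
  shows "card E \<le> CARD('p)\<^sup>2"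
proof -
  have "card (E \<times> (UNIV :: 'p mod_ring set)) \<le> card (UNIV :: 'p space3 set)"
    by (rule card_inj_on_le[OF misses_direction_inj[OF assms]]) simp_all
  then show ?thesis
    using card_p_gt_1[where 'p='p]
    by (simp only: card_cartesian_product card_space3 CARD_mod_ring) (simp add: power3_eq_cube power2_eq_square)
qed

lemma misses_direction_bij:
  fixes E :: "'p::prime_card space3 set"
  assumes "misses_direction E u" "u \<noteq> 0" "card E = CARD('p)\<^sup>2"
  shows "bij_betw (\<lambda>(e, s). e + s *s u) (E \<times> UNIV) UNIV"
proof -
  let ?f = "\<lambda>(e, s). e + s *s u"
  have "card (?f ` (E \<times> UNIV)) = card (UNIV :: 'p space3 set)"
    unfolding card_image[OF misses_direction_inj[OF assms(1,2)]] card_space3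
    by (simp only: card_cartesian_product assms(3) CARD_mod_ring) (simp add: power3_eq_cube power2_eq_square)
  then have "?f ` (E \<times> UNIV) = UNIV"
    by (intro card_subset_eq) simp_all
  with misses_direction_inj[OF assms(1,2)] show ?thesis
    by (simp add: bij_betw_def)
qed

lemma tiles_iff: "tiles (E :: ('p::prime_card mod_ring ^ 'd::finite) set) \<longleftrightarrow> (\<exists>A. \<forall>x. \<exists>!a. a \<in> A \<and> x - a \<in> E)"
proof -
  have "(\<Sum>a\<in>A. indicator E (x - a)) = (1::nat) \<longleftrightarrow> (\<exists>!a. a \<in> A \<and> x - a \<in> E)" for A and x :: "'p mod_ring ^ 'd"
  proof -
    have "(\<Sum>a\<in>A. indicator E (x - a)) = card {a\<in>A. x - a \<in> E}"
      by (simp add: indicator_def sum.If_cases Int_def)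
    also have "\<dots> = 1 \<longleftrightarrow> (\<exists>!a. a \<in> A \<and> x - a \<in> E)"
      unfolding One_nat_def card_1_singleton_iff set_eq_iff mem_Collect_eq singleton_iff Ex1_def by blast
    finally show ?thesis .
  qed
  then show ?thesis
    unfolding tiles_def by (simp only:)
qed

text \<open>
  By cardinality the partial function is total, and the multiples of \<open>u\<close> are the translations.
\<close>

lemma misses_direction_tiles:
  fixes E :: "'p::prime_card space3 set"
  assumes "misses_direction E u" "u \<noteq> 0" "card E = CARD('p)\<^sup>2"
  shows "tiles E"
proof -
  note bij = misses_direction_bij[OF assms]
  have "\<exists>!a. a \<in> range (\<lambda>s. s *s u) \<and> x - a \<in> E" for x
  proof -
    have "x \<in> (\<lambda>(e, s). e + s *s u) ` (E \<times> UNIV)"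
      using bij_betw_imp_surj_on[OF bij] by simp
    then obtain e s where es: "e \<in> E" "x = e + s *s u"
      by auto
    show ?thesis
    proof (rule ex1I[of _ "s *s u"])
      fix a assume "a \<in> range (\<lambda>s. s *s u) \<and> x - a \<in> E"
      then obtain s' where s': "a = s' *s u" "x - s' *s u \<in> E"
        by auto
      have "(x - s' *s u, s') = (e, s)"
        using s' es by (intro inj_onD[OF bij_betw_imp_inj_on[OF bij]]) simp_all
      then show "a = s *s u"
        using s' by simp
    next
      show "s *s u \<in> range (\<lambda>s. s *s u) \<and> x - s *s u \<in> E"
        using es by auto
    qed
  qed
  then show ?thesis
    unfolding tiles_iff by blast
qed

lemma equidistributed_UNIV: "v \<noteq> 0 \<Longrightarrow> equidistributed (UNIV :: ('p::prime_card mod_ring ^ 'd::finite) set) v"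
proof -
  assume "v \<noteq> 0"
  then obtain u where "dot u v = 1"
    by (rule dot_nonzero_witness)
  then show ?thesis
    by (intro equidistributed_invariant[of _ u]) auto
qed

lemma spectralI:
  assumes "E \<noteq> {}" "card A = card E" "orthogonal_frequencies E A"
  shows "spectral E"
  using assms is_spectrum_iff unfolding spectral_def by blast

text \<open>
  The translates of \<open>E\<close> along \<open>u\<close> fill every plane whose normal is orthogonal to \<open>u\<close>, so \<open>E\<close> has \<open>p\<close>
  points in each of them; the vectors orthogonal to \<open>u\<close> form a spectrum.
\<close>

lemma misses_direction_spectral:
  fixes E :: "'p::prime_card space3 set"
  assumes "misses_direction E u" "u \<noteq> 0" "card E = CARD('p)\<^sup>2"
  shows "spectral E"
proof (rule spectralI)
  let ?p = "CARD('p)" and ?f = "\<lambda>(e, s). e + s *s u"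
  note bij = misses_direction_bij[OF assms]
  show "E \<noteq> {}"
    using assms(3) card_p_gt_1[where 'p='p] by auto
  show "card {b. dot b u = 0} = card E"
    by (simp add: card_plane[OF assms(2)] assms(3))
  have "equidistributed E c" if c: "c \<noteq> 0" "dot c u = 0" for c
  proof -
    have "?p * plane_count E c t = ?p\<^sup>2" for t
    proof -
      have "?f ` ({e\<in>E. dot e c = t} \<times> UNIV) = {x. dot x c = t}"
      proof
        show "{x. dot x c = t} \<subseteq> ?f ` ({e\<in>E. dot e c = t} \<times> UNIV)"
        proof
          fix x assume x: "x \<in> {x. dot x c = t}"
          have "x \<in> ?f ` (E \<times> UNIV)"
            using bij_betw_imp_surj_on[OF bij] by simp
          then obtain e s where es: "e \<in> E" "x = e + s *s u"
            by auto
          then have "dot e c = t"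
            using x c by (simp add: dot_commute[of u])
          then show "x \<in> ?f ` ({e\<in>E. dot e c = t} \<times> UNIV)"
            using es by (intro image_eqI[of _ _ "(e, s)"]) simp_all
        qed
      qed (use c in \<open>auto simp: dot_commute[of u]\<close>)
      moreover have "inj_on ?f ({e\<in>E. dot e c = t} \<times> UNIV)"
        by (rule inj_on_subset[OF bij_betw_imp_inj_on[OF bij]]) auto
      ultimately have "card ({e\<in>E. dot e c = t} \<times> (UNIV :: 'p mod_ring set)) = card {x. dot x c = t}"
        using card_image[of ?f "{e\<in>E. dot e c = t} \<times> UNIV"] by (simp only:)
      then show ?thesis
        by (simp only: card_cartesian_product card_plane[OF c(1)] CARD_mod_ring plane_count_def mult.commute)
    qed
    then have "plane_count E c t = ?p" for t
      using card_p_gt_1[where 'p='p] by (simp add: power2_eq_square)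
    then show ?thesis
      by (simp add: equidistributed_iff)
  qed
  then show "orthogonal_frequencies E {b. dot b u = 0}"
    unfolding orthogonal_frequencies_def by simp
qed

text \<open>
  There is one point in each plane normal to \<open>v\<close>, so the plane through the origin is a set of
  translations.
\<close>

lemma equidistributed_prime_tiles:
  fixes E :: "'p::prime_card space3 set"
  assumes "card E = CARD('p)" "equidistributed E v"
  shows "tiles E"
proof -
  have one: "card {e\<in>E. dot e v = t} = 1" for t
    using equidistributed_plane_count[OF assms(2), of t] assms(1) card_p_gt_1[where 'p='p]
    by (simp add: plane_count_def)
  have "\<exists>!a. a \<in> {a. dot a v = 0} \<and> x - a \<in> E" for x
  proof -
    obtain e where e: "{e\<in>E. dot e v = dot x v} = {e}"
      using one[of "dot x v"] by (auto simp: card_1_singleton_iff)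
    then have e': "e \<in> E" "dot e v = dot x v"
      by blast+
    show ?thesis
    proof (rule ex1I[of _ "x - e"])
      fix a assume "a \<in> {a. dot a v = 0} \<and> x - a \<in> E"
      then have "x - a \<in> {e\<in>E. dot e v = dot x v}"
        by simp
      then show "a = x - e"
        unfolding e by (simp add: algebra_simps)
    qed (simp add: e')
  qed
  then show ?thesis
    unfolding tiles_iff by blast
qed

lemma not_misses_direction_obtain:
  assumes "\<not> misses_direction E u"
  obtains e e' c where "e \<in> E" "e' \<in> E" "e \<noteq> e'" "e - e' = c *s u" "c \<noteq> 0"
proof -
  obtain e e' c where *: "e \<in> E" "e' \<in> E" "e \<noteq> e'" "e - e' = c *s u"
    using assms unfolding misses_direction_def by blast
  moreover have "c \<noteq> 0"
    using * by auto
  ultimately show thesis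
    using that by blast
qed

text \<open>
  Equidistribution is invariant under scaling of the frequency, so directions of differences of
  frequencies suffice.
\<close>

lemma orthogonal_frequencies_direction:
  assumes "orthogonal_frequencies E A" "\<not> misses_direction A u"
  shows "equidistributed E u"
proof -
  obtain a a' c where "a \<in> A" "a' \<in> A" "a \<noteq> a'" "a - a' = c *s u" "c \<noteq> 0"
    using not_misses_direction_obtain[OF assms(2)] by metis
  then show ?thesis
    using assms(1) equidistributed_scale[of c E u] unfolding orthogonal_frequencies_def by metis
qed

lemma card_ge_2_obtain:
  fixes A :: "'x::finite set"
  assumes "card A \<ge> 2"
  obtains a b where "a \<in> A" "b \<in> A" "a \<noteq> b"
proof -
  have "\<not> card A \<le> Suc 0"
    using assms by simp
  then have "\<exists>a\<in>A. \<exists>b\<in>A. a \<noteq> b"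
    unfolding card_le_Suc0_iff_eq[OF finite] by blast
  then show thesis
    using that by blast
qed

text \<open>
  The size of a spectral set with two points or more is divisible by \<open>p\<close>, as it is equidistributed
  in some direction. If \<open>card E \<ge> p\<^sup>2\<close>, the counts force a missed direction, or else
  equidistribution in all directions.
\<close>

theorem spectral_imp_tiles_from_middle:
  fixes E :: "'p::prime_card space3 set"
  assumes middle: "\<And>A k. card E = k * CARD('p) \<Longrightarrow> card A = card E \<Longrightarrow> orthogonal_frequencies E A \<Longrightarrow>
      2 \<le> k \<Longrightarrow> k < CARD('p) \<Longrightarrow> False"
    and "E \<noteq> {}" "spectral E"
  shows "tiles E"
proof -
  let ?p = "CARD('p)"
  obtain A where A: "card A = card E" "orthogonal_frequencies E A"
    using assms(2,3) is_spectrum_iff unfolding spectral_def by blast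
  have A': "orthogonal_frequencies A E"
    by (rule orthogonal_frequencies_dual[OF A])
  have "card E > 0"
    using assms(2) by (simp add: card_gt_0_iff)
  consider "card E = 1" | "card E \<ge> 2"
    using \<open>card E > 0\<close> by linarith
  then show ?thesis
  proof cases
    case 1
    then obtain e where e: "E = {e}"
      by (auto simp: card_1_singleton_iff)
    have "\<exists>!a. a \<in> UNIV \<and> x - a \<in> E" for x
      unfolding e by (rule ex1I[of _ "x - e"]) (auto simp: algebra_simps)
    then show ?thesis
      unfolding tiles_iff by blast
  next
    case 2
    then have "card A \<ge> 2"
      using A by simp
    then obtain a b where ab: "a \<in> A" "b \<in> A" "a \<noteq> b"
      by (rule card_ge_2_obtain)
    then have eq: "equidistributed E (a - b)"
      using A(2) by (simp add: orthogonal_frequencies_def)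
    define k where "k = plane_count E (a - b) 0"
    have k: "card E = k * ?p"
      using equidistributed_plane_count[OF eq, of 0] by (simp add: k_def mult.commute)
    have "k > 0"
      using \<open>card E > 0\<close> k by (cases k) simp_all
    then consider "k = 1" | "2 \<le> k" "k < ?p" | "k = ?p" | "k > ?p"
      by linarith
    then show ?thesis
    proof cases
      case 1
      then show ?thesis
        using k eq by (intro equidistributed_prime_tiles[OF _ eq]) simp
    next
      case 2
      then show ?thesis
        using middle[OF k A] by blast
    next
      case 3
      then have cE: "card E = ?p\<^sup>2"
        using k by (simp add: power2_eq_square)
      show ?thesis
      proof (cases "\<exists>u\<in>proj_points. misses_direction E u")
        case True
        then show ?thesis
          using misses_direction_tiles[OF _ proj_points_nonzero cE] by blast
      next
        case False
        then have "A = {} \<or> A = UNIV"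
          using equidistributed_everywhere orthogonal_frequencies_direction[OF A'] by blast
        then have "card A = 0 \<or> card A = ?p ^ 3"
          by auto
        then show ?thesis
          using A(1) cE card_p_gt_1[where 'p='p] by (auto simp: power2_eq_square power3_eq_cube)
      qed
    next
      case 4
      then have "card A > ?p\<^sup>2"
        using A(1) k card_p_gt_1[where 'p='p] by (simp add: power2_eq_square)
      then have "\<not> misses_direction A u" if "u \<in> proj_points" for u
        using misses_direction_card[of A u] proj_points_nonzero[OF that] by auto
      then have "E = UNIV"
        using equidistributed_everywhere orthogonal_frequencies_direction[OF A(2)] \<open>E \<noteq> {}\<close> by blast
      then have "\<exists>!a. a \<in> {0} \<and> x - a \<in> E" for x
        by auto
      then show ?thesis
        unfolding tiles_iff by blast
    qed
  qed
qed

section \<open>Tiles are spectral\<close>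

lemma sum_character_UNIV:
  "v \<noteq> 0 \<Longrightarrow> (\<Sum>x\<in>(UNIV :: ('p::prime_card mod_ring ^ 'd::finite) set). character v x) = 0"
  by (simp add: sum_character_eq_0_iff equidistributed_UNIV)

lemma tiling_bij:
  fixes E A :: "('p::prime_card mod_ring ^ 'd::finite) set"
  assumes "\<forall>x. \<exists>!a. a \<in> A \<and> x - a \<in> E"
  shows "bij_betw (\<lambda>(e, a). e + a) (E \<times> A) UNIV"
proof (rule bij_betw_imageI)
  show "inj_on (\<lambda>(e, a). e + a) (E \<times> A)"
  proof (rule inj_onI)
    fix x y assume x: "x \<in> E \<times> A" and y: "y \<in> E \<times> A"
      and eq: "(case x of (e, a) \<Rightarrow> e + a) = (case y of (e, a) \<Rightarrow> e + a)"
    have sum: "fst x + snd x = fst y + snd y"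
      using eq by (simp add: split_beta)
    have "snd x \<in> A \<and> (fst x + snd x) - snd x \<in> E" "snd y \<in> A \<and> (fst x + snd x) - snd y \<in> E"
    proof -
      show "snd x \<in> A \<and> (fst x + snd x) - snd x \<in> E"
        using x by auto
      show "snd y \<in> A \<and> (fst x + snd x) - snd y \<in> E"
        unfolding sum using y by auto
    qed
    then have "snd x = snd y"
      using assms by blast
    with eq show "x = y"
      by (simp add: split_beta prod_eq_iff)
  qed
  show "(\<lambda>(e, a). e + a) ` (E \<times> A) = UNIV"
  proof (intro equalityI subsetI)
    fix x :: "'p mod_ring ^ 'd"
    obtain a where "a \<in> A" "x - a \<in> E"
      using assms by blast
    then show "x \<in> (\<lambda>(e, a). e + a) ` (E \<times> A)"
      by (intro image_eqI[of _ _ "(x - a, a)"]) simp_all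
  qed simp
qed

text \<open>
  The convolution of the two indicator functions is constant, so the product of the two character
  sums vanishes.
\<close>

lemma tiling_equidistributed:
  fixes E A :: "('p::prime_card mod_ring ^ 'd::finite) set"
  assumes "\<forall>x. \<exists>!a. a \<in> A \<and> x - a \<in> E" "v \<noteq> 0"
  shows "equidistributed E v \<or> equidistributed A v"
proof -
  have "(\<Sum>e\<in>E. character v e) * (\<Sum>a\<in>A. character v a) = (\<Sum>(e, a)\<in>E \<times> A. character v (e + a))"
    unfolding sum_product sum.cartesian_product
    by (intro sum.cong refl) (auto simp: character_altdef additive_character_add)
  also have "\<dots> = (\<Sum>x\<in>UNIV. character v x)"
    using sum.reindex_bij_betw[OF tiling_bij[OF assms(1)], of "character v"] by (simp add: split_beta)
  also have "\<dots> = 0"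
    by (rule sum_character_UNIV[OF assms(2)])
  finally show ?thesis
    by (simp add: sum_character_eq_0_iff)
qed

text \<open>
  Scaling the translations by \<open>- c\<close> preserves a tiling: in every direction one of the two sets is
  equidistributed, which survives scaling and makes the family of all \<open>x - c *s y\<close> equidistributed
  in every direction, hence injective. Two points of \<open>E\<close> with difference \<open>c *s (a - b)\<close> would give
  two equal members.
\<close>

lemma tiling_misses_direction:
  fixes E A :: "'p::prime_card space3 set"
  assumes tiling: "\<forall>x. \<exists>!a. a \<in> A \<and> x - a \<in> E" and ab: "a \<in> A" "b \<in> A" "a \<noteq> b"
  shows "misses_direction E (a - b)"
proof (rule ccontr)
  assume "\<not> misses_direction E (a - b)"
  then obtain e e' c where e: "e \<in> E" "e' \<in> E" "e \<noteq> e'" "e - e' = c *s (a - b)" "c \<noteq> 0"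
    by (rule not_misses_direction_obtain)
  let ?p = "CARD('p)"
  (* the scaled family; its fibre over \<open>\<phi> (e, a)\<close> also contains \<open>(e',
     b)\<close> *)
  define \<phi> where "\<phi> = (\<lambda>(x, y). x - c *s y :: 'p space3)"
  have card: "card (E \<times> A) = ?p ^ 3"
    using bij_betw_same_card[OF tiling_bij[OF tiling]] card_space3[where 'p='p] by simp
  have unif: "?p * card {i\<in>E \<times> A. dot (\<phi> i) d = t} = card (E \<times> A)" if "d \<in> proj_points" for d t
    using tiling_equidistributed[OF tiling proj_points_nonzero[OF that]]
  proof
    assume E: "equidistributed E d"
    have "{i\<in>E \<times> A. dot (\<phi> i) d = t} = (\<lambda>(y, x). (x, y)) ` (SIGMA y:A. {x\<in>E. dot x d = t + c * dot y d})"
      by (auto simp: \<phi>_def algebra_simps image_iff)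
    also have "card \<dots> = (\<Sum>y\<in>A. plane_count E d (t + c * dot y d))"
      by (subst card_image) (auto simp: inj_on_def plane_count_def)
    finally have "?p * card {i\<in>E \<times> A. dot (\<phi> i) d = t} = (\<Sum>y\<in>A. ?p * plane_count E d (t + c * dot y d))"
      by (simp add: sum_distrib_left)
    then show ?thesis
      by (simp add: equidistributed_plane_count[OF E] card_cartesian_product)
  next
    assume A: "equidistributed A d"
    have "{i\<in>E \<times> A. dot (\<phi> i) d = t} = (SIGMA x:E. {y\<in>A. dot y d = (dot x d - t) / c})"
      using e(5) by (auto simp: \<phi>_def field_simps)
    also have "card \<dots> = (\<Sum>x\<in>E. plane_count A d ((dot x d - t) / c))"
      by (simp add: plane_count_def)
    finally have "?p * card {i\<in>E \<times> A. dot (\<phi> i) d = t} = (\<Sum>x\<in>E. ?p * plane_count A d ((dot x d - t) / c))"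
      by (simp add: sum_distrib_left)
    then show ?thesis
      by (simp add: equidistributed_plane_count[OF A] card_cartesian_product)
  qed
  have "?p ^ 3 * card {i\<in>E \<times> A. \<phi> i = \<phi> (e, a)} = ?p ^ 3"
    using uniform_family_fibre[OF _ unif] card by simp
  then have "card {i\<in>E \<times> A. \<phi> i = \<phi> (e, a)} = 1"
    using card_p_gt_1[where 'p='p] by simp
  then obtain z where z: "{i\<in>E \<times> A. \<phi> i = \<phi> (e, a)} = {z}"
    by (auto simp: card_1_singleton_iff)
  have "\<phi> (e', b) = \<phi> (e, a)"
    using e(4) by (simp add: \<phi>_def algebra_simps vector_sub_rdistrib vector_ssub_ldistrib)
  then have "(e, a) \<in> {z}" "(e', b) \<in> {z}"
    using e ab unfolding z[symmetric] by simp_all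
  then have "(e, a) = (e', b)"
    by (simp only: singleton_iff)
  with e(3) show False
    by simp
qed

text \<open>
  Divisibility leaves the sizes \<open>1, p, p\<^sup>2, p\<^sup>3\<close>. For \<open>p\<close> points, \<open>A\<close> is not equidistributed in some
  direction, so \<open>E\<close> is, and the multiples of that direction form a spectrum. For \<open>p\<^sup>2\<close> points, a
  difference of translations is a direction missed by \<open>E\<close>.
\<close>

theorem tiles_imp_spectral:
  fixes E :: "'p::prime_card space3 set"
  assumes "tiles E"
  shows "spectral E"
proof -
  let ?p = "CARD('p)"
  obtain A where tiling: "\<forall>x. \<exists>!a. a \<in> A \<and> x - a \<in> E"
    using assms unfolding tiles_iff by blast
  have card: "card E * card A = ?p ^ 3"
    using bij_betw_same_card[OF tiling_bij[OF tiling]] card_space3[where 'p='p]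
    by (simp only: card_cartesian_product)
  have ne: "E \<noteq> {}" "A \<noteq> {}"
    using card card_p_gt_1[where 'p='p] by auto
  have "card E dvd ?p ^ 3"
    by (metis card dvd_triv_left)
  then obtain j where j: "j \<le> 3" "card E = ?p ^ j"
    using divides_primepow_nat[OF prime_card] by blast
  consider "j = 0" | "j = 1" | "j = 2" | "j = 3"
    using j(1) by linarith
  then show ?thesis
  proof cases
    case 1
    then show ?thesis
      using j ne(1) by (intro spectralI[of E "{0}"]) (simp_all add: orthogonal_frequencies_def)
  next
    case 2
    have cA: "card A = ?p\<^sup>2"
      using card j 2 card_p_gt_1[where 'p='p] by (simp add: power2_eq_square power3_eq_cube)
    have "\<exists>d\<in>proj_points. equidistributed E d"
    proof (rule ccontr)
      assume "\<not> ?thesis"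
      then have "A = {} \<or> A = UNIV"
        using equidistributed_everywhere tiling_equidistributed[OF tiling] proj_points_nonzero by metis
      then show False
        using ne(2) cA card_space3[where 'p='p] card_p_gt_1[where 'p='p]
        by (auto simp: power2_eq_square power3_eq_cube)
    qed
    then obtain d where d: "d \<in> proj_points" "equidistributed E d"
      by blast
    show ?thesis
    proof (rule spectralI[OF ne(1)])
      have "inj (\<lambda>s. s *s d)"
      proof (rule injI)
        fix s t assume "s *s d = t *s d"
        then have "(s - t) *s d = 0"
          by (simp add: vector_sub_rdistrib)
        then show "s = t"
          using proj_points_nonzero[OF d(1)] by simp
      qed
      then show "card (range (\<lambda>s. s *s d)) = card E"
        using j 2 by (simp add: card_image)
      show "orthogonal_frequencies E (range (\<lambda>s. s *s d))"
        unfolding orthogonal_frequencies_def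
      proof (intro ballI impI)
        fix a b assume "a \<in> range (\<lambda>s. s *s d)" "b \<in> range (\<lambda>s. s *s d)" "a \<noteq> b"
        then obtain s t where "a - b = (s - t) *s d" "s - t \<noteq> 0"
          by (auto simp: vector_sub_rdistrib)
        then show "equidistributed E (a - b)"
          using d(2) equidistributed_scale[of "s - t" E d] by simp
      qed
    qed
  next
    case 3
    have "card A = ?p"
      using card j 3 card_p_gt_1[where 'p='p] by (simp add: power2_eq_square power3_eq_cube)
    then have "card A \<ge> 2"
      using card_p_gt_1[where 'p='p] by simp
    then obtain a b where ab: "a \<in> A" "b \<in> A" "a \<noteq> b"
      by (rule card_ge_2_obtain)
    show ?thesis
      using misses_direction_spectral[OF tiling_misses_direction[OF tiling ab]] ab j 3 by simp
  next
    case 4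
    then have "E = UNIV"
      using j by (intro card_subset_eq) simp_all
    then show ?thesis
      by (intro spectralI[of E UNIV]) (simp_all add: orthogonal_frequencies_def equidistributed_UNIV)
  qed
qed

section \<open>Zeros, nonzeros and directions\<close>

text \<open>
  The zeros of the Fourier transform of the indicator function, up to scaling.
\<close>

definition zero_dirs :: "'p::prime_card space3 set \<Rightarrow> 'p space3 set"
  where "zero_dirs E = {d\<in>proj_points. equidistributed E d}"

definition nonzero_dirs :: "'p::prime_card space3 set \<Rightarrow> 'p space3 set"
  where "nonzero_dirs E = {d\<in>proj_points. \<not> equidistributed E d}"

text \<open>
  The directions of the differences of two distinct points.
\<close>

definition dirs :: "'p::prime_card space3 set \<Rightarrow> 'p space3 set"
  where "dirs E = {d\<in>proj_points. \<not> misses_direction E d}"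

definition pdir :: "'p::prime_card space3 \<Rightarrow> 'p space3"
  where "pdir x = (SOME v. v \<in> proj_points \<and> (\<exists>c. c \<noteq> 0 \<and> x = c *s v))"

lemma pdir:
  assumes "x \<noteq> 0"
  shows "pdir x \<in> proj_points" "\<exists>c. c \<noteq> 0 \<and> x = c *s pdir x"
proof -
  obtain c v where "v \<in> proj_points" "c \<noteq> 0" "x = c *s v"
    using proj_points_rep[OF assms] .
  then have "\<exists>v. v \<in> proj_points \<and> (\<exists>c. c \<noteq> 0 \<and> x = c *s v)"
    by blast
  from someI_ex[OF this] show "pdir x \<in> proj_points" "\<exists>c. c \<noteq> 0 \<and> x = c *s pdir x"
    unfolding pdir_def by blast+
qed

lemma pdir_parallel:
  assumes "x \<noteq> 0" "y \<noteq> 0" "pdir x = pdir y"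
  shows "\<exists>c. c \<noteq> 0 \<and> x = c *s y"
proof -
  obtain c where c: "c \<noteq> 0" "x = c *s pdir x"
    using pdir(2)[OF assms(1)] by blast
  obtain d where d: "d \<noteq> 0" "y = d *s pdir x"
    using pdir(2)[OF assms(2)] unfolding assms(3) by blast
  have "x = (c / d) *s (d *s pdir x)"
    using c(2) d(1) by simp
  then have "x = (c / d) *s y"
    using d(2) by simp
  then show ?thesis
    using c(1) d(1) by (intro exI[of _ "c / d"]) simp
qed

lemma pdir_scale:
  assumes "v \<in> proj_points" "c \<noteq> 0"
  shows "pdir (c *s v) = v"
proof -
  have nz: "c *s v \<noteq> 0"
    using assms proj_points_nonzero by simp
  obtain d where d: "d \<noteq> 0" "c *s v = d *s pdir (c *s v)"
    using pdir(2)[OF nz] by blast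
  have eq: "pdir (c *s v) = (c / d) *s v"
  proof -
    have "pdir (c *s v) = (1 / d) *s (d *s pdir (c *s v))"
      using d(1) by simp
    also have "\<dots> = (1 / d) *s (c *s v)"
      by (simp only: d(2)[symmetric])
    finally show ?thesis
      by simp
  qed
  then have "c / d = 1"
    using proj_points_scale_eq[OF assms(1), of "c / d"] pdir(1)[OF nz] by simp
  then show ?thesis
    using eq by simp
qed

lemma proj_line_pdir: "x \<noteq> 0 \<Longrightarrow> proj_line (pdir x) = proj_line x"
  using pdir(2)[of x] proj_line_scale by metis

lemma pdir_in_proj_line: "x \<noteq> 0 \<Longrightarrow> pdir x \<in> proj_line v \<longleftrightarrow> dot x v = 0"
proof -
  assume x: "x \<noteq> 0"
  obtain c where c: "c \<noteq> 0" "x = c *s pdir x"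
    using pdir(2)[OF x] by blast
  have "dot x v = c * dot (pdir x) v"
    by (subst c(2)) (rule dot_scale_left)
  then show ?thesis
    using c(1) pdir(1)[OF x] by (simp add: proj_line_def)
qed

lemma pdir_diff_in_dirs:
  assumes "e \<in> E" "e' \<in> E" "e \<noteq> e'"
  shows "pdir (e - e') \<in> dirs E"
proof -
  have "e - e' \<noteq> 0"
    using assms by simp
  then show ?thesis
    using pdir[of "e - e'"] assms unfolding dirs_def misses_direction_def by blast
qed

lemma card_zero_nonzero_line:
  fixes v :: "'p::prime_card space3"
  assumes "v \<noteq> 0"
  shows "card (nonzero_dirs E \<inter> proj_line v) + card (zero_dirs E \<inter> proj_line v) = CARD('p) + 1"
proof -
  have "card (nonzero_dirs E \<inter> proj_line v) + card (zero_dirs E \<inter> proj_line v) =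
      card ((nonzero_dirs E \<inter> proj_line v) \<union> (zero_dirs E \<inter> proj_line v))"
    by (rule card_Un_disjoint[symmetric]) (auto simp: zero_dirs_def nonzero_dirs_def)
  also have "(nonzero_dirs E \<inter> proj_line v) \<union> (zero_dirs E \<inter> proj_line v) = proj_line v"
    by (auto simp: zero_dirs_def nonzero_dirs_def proj_line_def)
  finally show ?thesis
    using card_proj_line[OF assms] by simp
qed

lemma line_count_pos: "e \<in> E \<Longrightarrow> line_count E v e \<ge> 1"
proof -
  assume "e \<in> E"
  then have "e \<in> {e'\<in>E. \<exists>c. e' - e = c *s v}"
    using exI[of "\<lambda>c. e - e = c *s v" 0] by simp
  then show ?thesis
    unfolding line_count_def One_nat_def Suc_le_eq card_gt_0_iff by auto
qed

lemma line_count_ge_2: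
  assumes "e \<in> E" "e' \<in> E" "e \<noteq> e'" "e' - e = c *s v"
  shows "line_count E v e \<ge> 2"
proof -
  have "{e, e'} \<subseteq> {e'\<in>E. \<exists>c. e' - e = c *s v}"
    using assms exI[of "\<lambda>c. e - e = c *s v" 0] by auto
  from card_mono[OF finite this] show ?thesis
    using assms(3) by (simp add: line_count_def)
qed

section \<open>Double counting over projective lines\<close>

lemma sum_lines_card:
  fixes X :: "'p::prime_card space3 set"
  assumes "X \<subseteq> proj_points"
  shows "(\<Sum>v\<in>proj_points. card (X \<inter> proj_line v)) = (CARD('p) + 1) * card X"
proof -
  have "(\<Sum>v\<in>proj_points. card (X \<inter> proj_line v)) = (\<Sum>v\<in>proj_points. card {x\<in>X. dot x v = 0})"
    using assms by (intro sum.cong refl arg_cong[where f=card]) (auto simp: proj_line_def)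
  also have "\<dots> = (\<Sum>x\<in>X. card {v\<in>proj_points. dot x v = 0})"
    by (rule sum_card_swap) simp_all
  also have "\<dots> = (\<Sum>x\<in>X. card (proj_line x))"
    by (simp add: proj_line_def dot_commute)
  also have "\<dots> = (CARD('p) + 1) * card X"
    using assms proj_points_nonzero card_proj_line by (subst sum.cong[OF refl, of X _ "\<lambda>_. CARD('p) + 1"]) auto
  finally show ?thesis .
qed

text \<open>
  Two distinct points lie on one common line, a single point on \<open>p + 1\<close> lines.
\<close>

lemma sum_lines_card_squared:
  fixes X :: "'p::prime_card space3 set"
  assumes "X \<subseteq> proj_points"
  shows "(\<Sum>v\<in>proj_points. card (X \<inter> proj_line v) ^ 2) = card X * (card X + CARD('p))"
proof -
  have "(\<Sum>v\<in>proj_points. card (X \<inter> proj_line v) ^ 2) = (\<Sum>v\<in>proj_points. card {(x, y)\<in>X \<times> X. dot x v = 0 \<and> dot y v = 0})"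
  proof (intro sum.cong refl)
    fix v :: "'p space3"
    have "{(x, y)\<in>X \<times> X. dot x v = 0 \<and> dot y v = 0} = (X \<inter> proj_line v) \<times> (X \<inter> proj_line v)"
      using assms by (auto simp: proj_line_def)
    then show "card (X \<inter> proj_line v) ^ 2 = card {(x, y)\<in>X \<times> X. dot x v = 0 \<and> dot y v = 0}"
      by (simp add: card_cartesian_product power2_eq_square)
  qed
  also have "\<dots> = (\<Sum>v\<in>proj_points. card {z\<in>X \<times> X. dot (fst z) v = 0 \<and> dot (snd z) v = 0})"
    by (intro sum.cong refl arg_cong[where f=card]) auto
  also have "\<dots> = (\<Sum>z\<in>X \<times> X. card {v\<in>proj_points. dot (fst z) v = 0 \<and> dot (snd z) v = 0})"
    by (rule sum_card_swap) simp_all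
  also have "\<dots> = (\<Sum>x\<in>X. \<Sum>y\<in>X. card (proj_line x \<inter> proj_line y))"
    unfolding sum.cartesian_product
    by (intro sum.cong refl) (auto simp: proj_line_def dot_commute intro!: arg_cong[where f=card])
  also have "\<dots> = (\<Sum>x\<in>X. \<Sum>y\<in>X. if x = y then CARD('p) + 1 else 1)"
    using assms by (intro sum.cong refl) (auto simp: card_proj_line[OF proj_points_nonzero] card_proj_line_Int_points subset_iff)
  also have "\<dots> = (\<Sum>x\<in>X. \<Sum>y\<in>X. (if x = y then CARD('p) else 0) + 1)"
    by (intro sum.cong refl) simp
  also have "\<dots> = card X * (card X + CARD('p))"
    unfolding sum.distrib by (simp add: algebra_simps)
  finally show ?thesis .
qed

text \<open>
  Both sides count the triples of a direction in \<open>X\<close> and two points of \<open>E\<close> in a common plane normal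
  to it; the term \<open>card X * card E\<close> accounts for equal points.
\<close>

lemma sum_pairs_dirs:
  fixes X E :: "'p::prime_card space3 set"
  assumes "X \<subseteq> proj_points"
  shows "(\<Sum>e\<in>E. \<Sum>e'\<in>E - {e}. card (X \<inter> proj_line (e - e'))) + card X * card E =
    (\<Sum>d\<in>X. \<Sum>t\<in>UNIV. (plane_count E d t)\<^sup>2)"
proof -
  have "(\<Sum>e\<in>E. \<Sum>e'\<in>E. card (X \<inter> proj_line (e - e'))) = (\<Sum>e\<in>E. \<Sum>e'\<in>E. card {d\<in>X. dot e d = dot e' d})"
    using assms by (intro sum.cong refl arg_cong[where f=card]) (auto simp: proj_line_def dot_commute)
  also have "\<dots> = (\<Sum>e\<in>E. \<Sum>d\<in>X. card {e'\<in>E. dot e d = dot e' d})"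
    by (intro sum.cong refl sum_card_swap[symmetric]) simp_all
  also have "\<dots> = (\<Sum>d\<in>X. \<Sum>e\<in>E. card {e'\<in>E. dot e d = dot e' d})"
    by (rule sum.swap)
  also have "\<dots> = (\<Sum>d\<in>X. \<Sum>t\<in>UNIV. (plane_count E d t)\<^sup>2)"
  proof (intro sum.cong refl)
    fix d
    have "(\<Sum>e\<in>E. card {e'\<in>E. dot e d = dot e' d}) = (\<Sum>e\<in>E. plane_count E d (dot e d))"
      by (simp add: plane_count_def eq_commute)
    also have "\<dots> = (\<Sum>t\<in>UNIV. of_nat (card {e\<in>E. dot e d = t}) * plane_count E d t)"
      by (rule sum_by_dot)
    finally show "(\<Sum>e\<in>E. card {e'\<in>E. dot e d = dot e' d}) = (\<Sum>t\<in>UNIV. (plane_count E d t)\<^sup>2)"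
      by (simp add: plane_count_def power2_eq_square)
  qed
  also have "(\<Sum>e\<in>E. \<Sum>e'\<in>E. card (X \<inter> proj_line (e - e'))) =
      (\<Sum>e\<in>E. (\<Sum>e'\<in>E - {e}. card (X \<inter> proj_line (e - e'))) + card X)"
  proof (intro sum.cong refl)
    fix e assume "e \<in> E"
    then have "(\<Sum>e'\<in>E. card (X \<inter> proj_line (e - e'))) =
        card (X \<inter> proj_line (e - e)) + (\<Sum>e'\<in>E - {e}. card (X \<inter> proj_line (e - e')))"
      by (intro sum.remove) simp_all
    moreover have "X \<inter> proj_points = X"
      using assms by blast
    ultimately show "(\<Sum>e'\<in>E. card (X \<inter> proj_line (e - e'))) = (\<Sum>e'\<in>E - {e}. card (X \<inter> proj_line (e - e'))) + card X"
      by simp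
  qed
  finally show ?thesis
    by (simp add: sum.distrib mult.commute)
qed

section \<open>Spectral pairs of intermediate size\<close>

text \<open>
  The sizes that the elementary arguments leave open. The assumptions are symmetric in \<open>E\<close> and \<open>A\<close>,
  so every consequence has a dual.
\<close>

locale spectral_pair =
  fixes E A :: "'p::prime_card space3 set" and k p :: nat
  assumes card_p [simp]: "CARD('p) = p"
    and card_E: "card E = k * p"
    and card_A: "card A = k * p"
    and orth: "orthogonal_frequencies E A"
    and orth': "orthogonal_frequencies A E"
    and k2: "2 \<le> k" and kp: "k < p"
begin

lemma p_gt_1: "p > 1"
  using card_p_gt_1[where 'p='p] by simp

lemma dual: "spectral_pair A E k p"
  by unfold_locales (rule card_p card_A card_E orth orth' k2 kp)+

lemma dirs_subset_zero: "dirs A \<subseteq> zero_dirs E"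
  using orthogonal_frequencies_direction[OF orth] by (auto simp: dirs_def zero_dirs_def)

lemma zero_plane_count:
  assumes "d \<in> zero_dirs E"
  shows "plane_count E d t = k"
  using equidistributed_plane_count[of E d t] assms card_E p_gt_1
  by (simp add: zero_dirs_def mult.commute)

text \<open>
  The count over the planes through a line, in which every zero contributes \<open>k\<close>.
\<close>

lemma line_identity:
  assumes "v \<noteq> 0"
  shows "(\<Sum>d\<in>nonzero_dirs E \<inter> proj_line v. plane_count E d (dot x d)) + k * card (zero_dirs E \<inter> proj_line v) =
    p * line_count E v x + k * p"
proof -
  have "(\<Sum>d\<in>zero_dirs E \<inter> proj_line v. plane_count E d (dot x d)) = k * card (zero_dirs E \<inter> proj_line v)"
    by (simp add: zero_plane_count)
  then have "(\<Sum>d\<in>nonzero_dirs E \<inter> proj_line v. plane_count E d (dot x d)) + k * card (zero_dirs E \<inter> proj_line v) =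
      (\<Sum>d\<in>(nonzero_dirs E \<inter> proj_line v) \<union> (zero_dirs E \<inter> proj_line v). plane_count E d (dot x d))"
    by (subst sum.union_disjoint) (auto simp: zero_dirs_def nonzero_dirs_def)
  also have "(nonzero_dirs E \<inter> proj_line v) \<union> (zero_dirs E \<inter> proj_line v) = proj_line v"
    by (auto simp: zero_dirs_def nonzero_dirs_def proj_line_def)
  finally show ?thesis
    by (simp add: sum_planes_through_line[OF assms] card_E)
qed

text \<open>
  If the line carried zeros only, \<open>line_identity\<close> would make \<open>k\<close> divisible by \<open>p\<close>.
\<close>

lemma nonzero_on_line:
  assumes "v \<noteq> 0"
  shows "nonzero_dirs E \<inter> proj_line v \<noteq> {}"
proof
  assume empty: "nonzero_dirs E \<inter> proj_line v = {}"
  then have "card (zero_dirs E \<inter> proj_line v) = p + 1"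
    using card_zero_nonzero_line[OF assms, of E] by simp
  then have "k = p * line_count E v 0"
    using line_identity[OF assms, of 0] by (simp add: empty)
  then show False
    using k2 kp by (cases "line_count E v 0") simp_all
qed

text \<open>
  Some plane normal to \<open>v\<close> contains two points of \<open>E\<close>, as \<open>k \<ge> 2\<close>.
\<close>

lemma dirs_on_line:
  assumes "v \<noteq> 0"
  shows "dirs E \<inter> proj_line v \<noteq> {}"
proof -
  have "\<exists>t. plane_count E v t \<ge> 2"
  proof (rule ccontr)
    assume "\<not> ?thesis"
    then have "\<not> 2 \<le> plane_count E v t" for t
      by blast
    then have "plane_count E v t \<le> 1" for t
      by (simp add: not_le less_Suc_eq_le numeral_2_eq_2)
    then have "(\<Sum>t\<in>UNIV. plane_count E v t) \<le> (\<Sum>t\<in>(UNIV :: 'p mod_ring set). 1)"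
      by (intro sum_mono)
    then show False
      using k2 p_gt_1 by (simp add: sum_plane_count card_E)
  qed
  then obtain t e e' where "e \<in> E" "e' \<in> E" "e \<noteq> e'" "dot e v = t" "dot e' v = t"
    unfolding plane_count_def by (metis (mono_tags, lifting) card_ge_2_obtain mem_Collect_eq)
  then show ?thesis
    using pdir_diff_in_dirs[of e E e'] pdir_in_proj_line[of "e - e'" v] by auto
qed

text \<open>
  More than \<open>p\<close> points in a plane determine all directions of the plane. These would be zeros of \<open>A\<close>
  and fill a projective line, which \<open>nonzero_on_line\<close> forbids.
\<close>

lemma plane_count_le:
  assumes "d \<noteq> 0"
  shows "plane_count E d t \<le> p"
proof (rule ccontr)
  interpret dual: spectral_pair A E k p
    by (rule dual)
  assume "\<not> ?thesis"
  then have gt: "plane_count E d t > p"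
    by simp
  let ?G = "{e\<in>E. dot e d = t}"
  have "v \<in> dirs E" if v: "v \<in> proj_line d" for v
  proof (rule ccontr)
    assume "v \<notin> dirs E"
    then have "misses_direction ?G v"
      using v unfolding dirs_def misses_direction_def proj_line_def by auto
    moreover have v0: "v \<noteq> 0"
      using v proj_points_nonzero by (auto simp: proj_line_def)
    ultimately have inj: "inj_on (\<lambda>(e, s). e + s *s v) (?G \<times> UNIV)"
      by (rule misses_direction_inj)
    have "card (?G \<times> (UNIV :: 'p mod_ring set)) \<le> card {x. dot x d = t}"
      by (rule card_inj_on_le[OF inj]) (use v in \<open>auto simp: proj_line_def\<close>)
    then have "card ?G * p \<le> p * p"
      by (simp only: card_cartesian_product card_plane[OF assms] CARD_mod_ring power2_eq_square card_p)
    then show False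
      using gt p_gt_1 by (simp add: plane_count_def)
  qed
  then have "proj_line d \<subseteq> zero_dirs A"
    using dual.dirs_subset_zero by blast
  then show False
    using dual.nonzero_on_line[OF assms] by (auto simp: zero_dirs_def nonzero_dirs_def)
qed

lemma zero_on_line:
  assumes "v \<noteq> 0"
  shows "card (zero_dirs E \<inter> proj_line v) \<ge> 1"
proof -
  interpret dual: spectral_pair A E k p
    by (rule dual)
  have "zero_dirs E \<inter> proj_line v \<noteq> {}"
    using dual.dirs_on_line[OF assms] dirs_subset_zero by blast
  then show ?thesis
    by (simp add: Suc_le_eq card_gt_0_iff)
qed

lemma line_count_le_plane_count:
  "d \<in> proj_line v \<Longrightarrow> line_count E v x \<le> plane_count E d (dot x d)"
  unfolding line_count_def plane_count_def
proof (rule card_mono)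
  assume d: "d \<in> proj_line v"
  show "{e \<in> E. \<exists>c. e - x = c *s v} \<subseteq> {e \<in> E. dot e d = dot x d}"
  proof
    fix e assume "e \<in> {e \<in> E. \<exists>c. e - x = c *s v}"
    then obtain c where c: "e \<in> E" "e - x = c *s v"
      by blast
    have "dot (e - x) d = 0"
      unfolding c(2) using d by (simp add: proj_line_def dot_commute)
    then show "e \<in> {e \<in> E. dot e d = dot x d}"
      using c(1) by simp
  qed
qed simp

text \<open>
  The line lies in a plane normal to a zero of \<open>E\<close>, which contains only \<open>k\<close> points.
\<close>

lemma line_count_le:
  assumes "v \<noteq> 0"
  shows "line_count E v x \<le> k"
proof -
  interpret dual: spectral_pair A E k p
    by (rule dual)
  obtain d where "d \<in> dirs A" "d \<in> proj_line v"
    using dual.dirs_on_line[OF assms] by blast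
  then show ?thesis
    using line_count_le_plane_count[of d v x] zero_plane_count[of d] dirs_subset_zero by auto
qed

text \<open>
  Estimating the nonzero terms of \<open>line_identity\<close> by \<open>p\<close> turns collinear points into nonzeros.
\<close>

lemma line_count_bound:
  assumes "v \<noteq> 0" "line_count E v x \<ge> j"
  shows "j * p + k * p \<le> p * card (nonzero_dirs E \<inter> proj_line v) + k * card (zero_dirs E \<inter> proj_line v)"
proof -
  have "(\<Sum>d\<in>nonzero_dirs E \<inter> proj_line v. plane_count E d (dot x d)) \<le> (\<Sum>d\<in>nonzero_dirs E \<inter> proj_line v. p)"
    by (intro sum_mono plane_count_le) (auto simp: nonzero_dirs_def dest: proj_points_nonzero)
  also have "\<dots> = p * card (nonzero_dirs E \<inter> proj_line v)"
    by simp
  finally have "(\<Sum>d\<in>nonzero_dirs E \<inter> proj_line v. plane_count E d (dot x d)) \<le> p * card (nonzero_dirs E \<inter> proj_line v)" .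
  moreover have "j * p \<le> p * line_count E v x"
    using mult_le_mono1[OF assms(2), of p] by (simp only: mult.commute)
  ultimately show ?thesis
    using line_identity[OF assms(1), of x] by linarith
qed

lemma dirs_line_count:
  assumes "v \<in> dirs E"
  obtains x where "line_count E v x \<ge> 2" "x \<in> E"
proof -
  obtain e e' c where *: "e \<in> E" "e' \<in> E" "e \<noteq> e'" "e - e' = c *s v" "c \<noteq> 0"
    using assms not_misses_direction_obtain[of E v] unfolding dirs_def by blast
  then have "line_count E v e' \<ge> 2"
    by (intro line_count_ge_2[of e' E e c v]) auto
  then show thesis
    using that * by blast
qed

lemma zero_dirs_pairs:
  assumes "X \<subseteq> zero_dirs E"
  shows "(\<Sum>e\<in>E. \<Sum>e'\<in>E - {e}. card (X \<inter> proj_line (e - e'))) = card X * (k * p * (k - 1))"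
proof -
  have "X \<subseteq> proj_points"
    using assms by (auto simp: zero_dirs_def)
  from sum_pairs_dirs[OF this, of E]
  have "(\<Sum>e\<in>E. \<Sum>e'\<in>E - {e}. card (X \<inter> proj_line (e - e'))) + card X * (k * p) =
      (\<Sum>d\<in>X. \<Sum>t\<in>UNIV. (plane_count E d t)\<^sup>2)"
    by (simp add: card_E)
  also have "\<dots> = (\<Sum>d\<in>X. p * k\<^sup>2)"
    using assms by (intro sum.cong refl) (simp add: zero_plane_count subset_iff)
  also have "\<dots> = card X * (k * p * (k - 1)) + card X * (k * p)"
    using k2 by (cases k) (simp_all add: power2_eq_square algebra_simps)
  finally show ?thesis
    by simp
qed

text \<open>
  The constraints on the numbers of zeros and nonzeros normal to a difference of \<open>E\<close>, collected for
  the small cases.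
\<close>

lemma line_pair_bounds:
  assumes "v \<in> dirs E"
  shows "2 * p + k * p \<le> p * card (nonzero_dirs E \<inter> proj_line v) + k * card (zero_dirs E \<inter> proj_line v)"
    and "card (nonzero_dirs E \<inter> proj_line v) + card (zero_dirs E \<inter> proj_line v) = p + 1"
    and "card (zero_dirs E \<inter> proj_line v) \<ge> 1"
    and "card (dirs A \<inter> proj_line v) \<le> card (zero_dirs E \<inter> proj_line v)"
proof -
  have v0: "v \<noteq> 0"
    using assms proj_points_nonzero by (auto simp: dirs_def)
  show "2 * p + k * p \<le> p * card (nonzero_dirs E \<inter> proj_line v) + k * card (zero_dirs E \<inter> proj_line v)"
    using dirs_line_count[OF assms] line_count_bound[OF v0] by metis
  show "card (nonzero_dirs E \<inter> proj_line v) + card (zero_dirs E \<inter> proj_line v) = p + 1"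
    using card_zero_nonzero_line[OF v0] by simp
  show "card (zero_dirs E \<inter> proj_line v) \<ge> 1"
    by (rule zero_on_line[OF v0])
  show "card (dirs A \<inter> proj_line v) \<le> card (zero_dirs E \<inter> proj_line v)"
    using dirs_subset_zero by (intro card_mono) auto
qed

lemma dirs_nonempty: "dirs E \<noteq> {}"
  using dirs_on_line[of "axis 1 1"] by (auto simp: axis_eq_0_iff)

end

section \<open>Directions determined by few points of a plane\<close>

definition independent2 :: "'p::prime_card space3 \<Rightarrow> 'p space3 \<Rightarrow> bool"
  where "independent2 u w \<longleftrightarrow> (\<forall>s t. s *s u + t *s w = 0 \<longrightarrow> s = 0 \<and> t = 0)"

lemma independent2I:
  assumes "u \<noteq> 0" "\<nexists>s. w = s *s u"
  shows "independent2 u w"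
  unfolding independent2_def
proof (intro allI impI)
  fix s t assume eq: "s *s u + t *s w = 0"
  have "t = 0"
  proof (rule ccontr)
    assume "t \<noteq> 0"
    have "t *s w = (- s) *s u"
      using eq by (simp add: eq_neg_iff_add_eq_0 add.commute)
    then have "(1 / t) *s (t *s w) = (1 / t) *s ((- s) *s u)"
      by simp
    then have "w = ((1 / t) * (- s)) *s u"
      using \<open>t \<noteq> 0\<close> by (simp del: vector_smult_lneg)
    then show False
      using assms(2) by blast
  qed
  then show "s = 0 \<and> t = 0"
    using eq assms(1) by simp
qed

lemma independent2_combination_eq:
  assumes "independent2 u w" "s *s u + t *s w = s' *s u + t' *s w"
  shows "s = s' \<and> t = t'"
proof -
  have "(s - s') *s u + (t - t') *s w = 0"
    using assms(2) by (simp add: vector_sub_rdistrib algebra_simps)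
  then show ?thesis
    using assms(1) unfolding independent2_def by (metis right_minus_eq)
qed

lemma plane_coordinates:
  fixes v :: "'p::prime_card space3"
  assumes "v \<noteq> 0" "dot u v = 0" "dot w v = 0" "independent2 u w" "dot x v = 0"
  obtains s t where "x = s *s u + t *s w"
proof -
  let ?f = "\<lambda>(s, t). s *s u + t *s w"
  have inj: "inj ?f"
    by (rule injI) (auto dest!: independent2_combination_eq[OF assms(4)])
  have "card (range ?f) = card {x. dot x v = 0}"
    unfolding card_image[OF inj] card_plane[OF assms(1)] by (simp add: power2_eq_square)
  moreover have "range ?f \<subseteq> {x. dot x v = 0}"
    using assms(2,3) by auto
  ultimately have "range ?f = {x. dot x v = 0}"
    by (intro card_subset_eq) simp_all
  then have "x \<in> range ?f"
    using assms(5) by simp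
  then show thesis
    using that by auto
qed

text \<open>
  The directions of the sides of the triangle with vertices \<open>0\<close>, \<open>u\<close>, \<open>w\<close>, in coordinates.
\<close>

lemma pdir_combination:
  assumes ind: "independent2 u w" and x: "x = s *s u + t *s w" "x \<noteq> 0"
  shows "pdir x = pdir u \<longleftrightarrow> t = 0" "pdir x = pdir w \<longleftrightarrow> s = 0" "pdir x = pdir (w - u) \<longleftrightarrow> s + t = 0"
proof -
  have u: "u \<noteq> 0"
    using ind[unfolded independent2_def, rule_format, of 1 0] by auto
  have w: "w \<noteq> 0"
    using ind[unfolded independent2_def, rule_format, of 0 1] by auto
  have wu: "w - u \<noteq> 0"
    using ind[unfolded independent2_def, rule_format, of "-1" 1] by auto
  have pd: "pdir (c *s y) = pdir y" if cy: "c \<noteq> 0" "y \<noteq> 0" for c y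
  proof -
    obtain d where d: "d \<noteq> 0" "y = d *s pdir y"
      using pdir(2)[OF cy(2)] by blast
    have "c *s y = (c * d) *s pdir y"
      by (subst d(2)) simp
    then show ?thesis
      using pdir_scale[OF pdir(1)[OF cy(2)], of "c * d"] cy(1) d(1) by simp
  qed
  show "pdir x = pdir u \<longleftrightarrow> t = 0"
  proof
    assume "pdir x = pdir u"
    then obtain c where "x = c *s u"
      using pdir_parallel[OF x(2) u] by blast
    then show "t = 0"
      using independent2_combination_eq[OF ind, of s t c 0] x(1) by simp
  next
    assume "t = 0"
    then show "pdir x = pdir u"
      using x pd[OF _ u, of s] by auto
  qed
  show "pdir x = pdir w \<longleftrightarrow> s = 0"
  proof
    assume "pdir x = pdir w"
    then obtain c where "x = c *s w"
      using pdir_parallel[OF x(2) w] by blast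
    then show "s = 0"
      using independent2_combination_eq[OF ind, of s t 0 c] x(1) by simp
  next
    assume "s = 0"
    then show "pdir x = pdir w"
      using x pd[OF _ w, of t] by auto
  qed
  show "pdir x = pdir (w - u) \<longleftrightarrow> s + t = 0"
  proof
    assume "pdir x = pdir (w - u)"
    then obtain c where "x = c *s (w - u)"
      using pdir_parallel[OF x(2) wu] by blast
    then have "s *s u + t *s w = (- c) *s u + c *s w"
      using x(1) by (simp add: vector_ssub_ldistrib)
    then show "s + t = 0"
      using independent2_combination_eq[OF ind] by fastforce
  next
    assume "s + t = 0"
    then have "x = t *s (w - u)"
      using x(1) by (simp add: vector_ssub_ldistrib eq_neg_iff_add_eq_0[symmetric])
    then show "pdir x = pdir (w - u)"
      using x(2) pd[OF _ wu, of t] by auto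
  qed
qed

lemma triangle_pdirs:
  assumes "independent2 u w"
  shows "card {pdir u, pdir w, pdir (w - u)} = 3"
proof -
  have u: "u \<noteq> 0"
    using assms[unfolded independent2_def, rule_format, of 1 0] by auto
  have w: "w \<noteq> 0"
    using assms[unfolded independent2_def, rule_format, of 0 1] by auto
  have "pdir u \<noteq> pdir w" "pdir u \<noteq> pdir (w - u)"
    using pdir_combination[OF assms, of u 1 0] u by auto
  moreover have "pdir w \<noteq> pdir (w - u)"
    using pdir_combination[OF assms, of w 0 1] w by auto
  ultimately show ?thesis
    by simp
qed

text \<open>
  A triangle and a fourth point determine a fourth direction, unless the points and their directions
  form a Fano plane; that needs characteristic two.
\<close>

lemma fourth_point_pdir:
  fixes u w :: "'p::prime_card space3"
  assumes ind: "independent2 u w" and x: "x = s *s u + t *s w" "x \<noteq> 0" "x \<noteq> u" "x \<noteq> w"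
    and odd: "(2 :: 'p mod_ring) \<noteq> 0"
  shows "pdir x \<notin> {pdir u, pdir w, pdir (w - u)} \<or> pdir (x - u) \<notin> {pdir u, pdir w, pdir (w - u)} \<or>
    pdir (x - w) \<notin> {pdir u, pdir w, pdir (w - u)}"
proof (rule ccontr)
  assume contr: "\<not> ?thesis"
  have xu: "x - u = (s - 1) *s u + t *s w" and xw: "x - w = s *s u + (t - 1) *s w"
    using x(1) by (simp_all add: vector_sub_rdistrib)
  have c1: "t = 0 \<or> s = 0 \<or> s + t = 0"
    using contr pdir_combination[OF ind x(1,2)] by auto
  have c2: "t = 0 \<or> s = 1 \<or> s + t = 1"
    using contr pdir_combination[OF ind xu] x(3) by (auto simp: algebra_simps)
  have c3: "t = 1 \<or> s = 0 \<or> s + t = 1"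
    using contr pdir_combination[OF ind xw] x(4) by (auto simp: algebra_simps)
  have n: "\<not> (s = 0 \<and> t = 0)" "\<not> (s = 1 \<and> t = 0)" "\<not> (s = 0 \<and> t = 1)"
    using x by auto
  have "t \<noteq> 0"
    using c3 n by auto
  have "s \<noteq> 0"
    using c2 n \<open>t \<noteq> 0\<close> by auto
  have "s + t = 0"
    using c1 \<open>t \<noteq> 0\<close> \<open>s \<noteq> 0\<close> by simp
  then have "s = 1" "t = 1"
    using c2 c3 \<open>t \<noteq> 0\<close> \<open>s \<noteq> 0\<close> by simp_all
  with \<open>s + t = 0\<close> show False
    using odd by simp
qed

lemma obtain_off_line:
  fixes G :: "'p::prime_card space3 set"
  assumes "line_count G (b - a) a < card G" "a \<in> G" "b \<in> G" "a \<noteq> b"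
  obtains c where "c \<in> G" "independent2 (b - a) (c - a)"
proof -
  have "\<exists>c\<in>G. \<nexists>s. c - a = s *s (b - a)"
  proof (rule ccontr)
    assume "\<not> ?thesis"
    then have "{e\<in>G. \<exists>c. e - a = c *s (b - a)} = G"
      by blast
    then show False
      using assms(1) by (simp add: line_count_def)
  qed
  then show thesis
    using that independent2I[of "b - a"] assms(4) by auto
qed

text \<open>
  Three noncollinear points determine the three directions of a triangle, and a fourth point adds
  one by \<open>fourth_point_pdir\<close>.
\<close>

lemma noncollinear_dirs:
  fixes G :: "'p::prime_card space3 set"
  assumes v: "v \<noteq> 0" and G: "\<And>x. x \<in> G \<Longrightarrow> dot x v = \<tau>" and odd: "(2 :: 'p mod_ring) \<noteq> 0"
    and lines: "\<And>u x. u \<noteq> 0 \<Longrightarrow> line_count G u x < card G" and card: "card G = 3 \<or> card G = 4"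
  shows "card G \<le> card (dirs G \<inter> proj_line v)"
proof -
  let ?S = "dirs G \<inter> proj_line v"
  have inS: "pdir (x - y) \<in> ?S" if "x \<in> G" "y \<in> G" "x \<noteq> y" for x y
    using that pdir_diff_in_dirs[OF that] pdir_in_proj_line[of "x - y" v] G by simp
  have "card G \<ge> 2"
    using card by auto
  then obtain a b where ab: "a \<in> G" "b \<in> G" "a \<noteq> b"
    by (rule card_ge_2_obtain)
  then obtain c where c: "c \<in> G" "independent2 (b - a) (c - a)"
    using obtain_off_line[of G b a] lines[of "b - a" a] by auto
  have ca: "c \<noteq> a" "c \<noteq> b"
    using c(2)[unfolded independent2_def, rule_format, of 0 1] c(2)[unfolded independent2_def, rule_format, of "-1" 1]
    by auto
  let ?T = "{pdir (b - a), pdir (c - a), pdir (c - a - (b - a))}"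
  have T3: "card ?T = 3"
    by (rule triangle_pdirs[OF c(2)])
  have TS: "?T \<subseteq> ?S"
    using inS[of b a] inS[of c a] inS[of c b] ab c(1) ca by auto
  show ?thesis
  proof (cases "card G = 3")
    case True
    then show ?thesis
      using T3 card_mono[OF _ TS] by simp
  next
    case False
    then have "card G = 4"
      using card by simp
    moreover have "card {a, b, c} \<le> 3"
      by (simp add: card_insert_if)
    ultimately have "\<not> G \<subseteq> {a, b, c}"
      using card_mono[of "{a, b, c}" G] by auto
    then obtain d where d: "d \<in> G" "d \<noteq> a" "d \<noteq> b" "d \<noteq> c"
      by blast
    obtain s t where st: "d - a = s *s (b - a) + t *s (c - a)"
      by (rule plane_coordinates[OF v _ _ c(2)]) (use G ab c(1) d(1) in auto)
    have "pdir (d - a) \<notin> ?T \<or> pdir (d - a - (b - a)) \<notin> ?T \<or> pdir (d - a - (c - a)) \<notin> ?T"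
      by (rule fourth_point_pdir[OF c(2) st _ _ _ odd]) (use d in auto)
    then obtain z where z: "z \<in> ?S" "z \<notin> ?T"
      using inS[of d a] inS[of d b] inS[of d c] d ab(1,2) c(1) by auto
    have "card (insert z ?T) = 4"
      using z(2) T3 by (subst card_insert_disjoint) simp_all
    moreover have "insert z ?T \<subseteq> ?S"
      using z(1) TS by blast
    ultimately show ?thesis
      using card_mono[of ?S "insert z ?T"] \<open>card G = 4\<close> by simp
  qed
qed

text \<open>
  If no three points are collinear, the lines that join \<open>a\<close> to the other points have different
  directions.
\<close>

lemma pencil_dirs:
  fixes G :: "'p::prime_card space3 set"
  assumes v: "v \<noteq> 0" and G: "\<And>x. x \<in> G \<Longrightarrow> dot x v = \<tau>" and a: "a \<in> G"
    and lines: "\<And>u x. u \<noteq> 0 \<Longrightarrow> line_count G u x \<le> 2"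
  shows "card G \<le> card (dirs G \<inter> proj_line v) + 1"
proof -
  have inj: "inj_on (\<lambda>x. pdir (x - a)) (G - {a})"
  proof (rule inj_onI, rule ccontr)
    fix x y assume x: "x \<in> G - {a}" and y: "y \<in> G - {a}" and eq: "pdir (x - a) = pdir (y - a)" and "x \<noteq> y"
    then obtain c where c: "x - a = c *s (y - a)"
      using pdir_parallel[of "x - a" "y - a"] by auto
    have "a - a = 0 *s (y - a)" "y - a = 1 *s (y - a)"
      by simp_all
    then have "{a, x, y} \<subseteq> {e\<in>G. \<exists>c. e - a = c *s (y - a)}"
      using x y a c by blast
    then have "card {a, x, y} \<le> line_count G (y - a) a"
      unfolding line_count_def by (rule card_mono[OF finite])
    moreover have "card {a, x, y} = 3"
      using x y \<open>x \<noteq> y\<close> by auto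
    ultimately show False
      using lines[of "y - a" a] y by simp
  qed
  have "(\<lambda>x. pdir (x - a)) ` (G - {a}) \<subseteq> dirs G \<inter> proj_line v"
  proof
    fix z assume "z \<in> (\<lambda>x. pdir (x - a)) ` (G - {a})"
    then obtain x where "x \<in> G" "x \<noteq> a" "z = pdir (x - a)"
      by blast
    then show "z \<in> dirs G \<inter> proj_line v"
      using pdir_diff_in_dirs[of x G a] pdir_in_proj_line[of "x - a" v] a G by simp
  qed
  from card_inj_on_le[OF inj this] have "card (G - {a}) \<le> card (dirs G \<inter> proj_line v)"
    by simp
  then show ?thesis
    using a by (simp add: card_Diff_subset)
qed

lemma dirs_mono: "G \<subseteq> A \<Longrightarrow> dirs G \<subseteq> dirs A"
  unfolding dirs_def misses_direction_def by blast

lemma line_count_mono: "G \<subseteq> A \<Longrightarrow> line_count G u x \<le> line_count A u x"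
  unfolding line_count_def by (rule card_mono) auto

context spectral_pair
begin

section \<open>Pairs with many points in each plane\<close>

lemma plane_section_card:
  assumes "v \<in> dirs E"
  shows "card {a\<in>A. dot a v = t} = k"
proof -
  interpret dual: spectral_pair A E k p
    by (rule dual)
  show ?thesis
    using dual.zero_plane_count[of v t] dual.dirs_subset_zero assms by (auto simp: plane_count_def)
qed

lemma plane_section_dirs:
  "card (dirs {a\<in>A. dot a v = t} \<inter> proj_line v) \<le> card (dirs A \<inter> proj_line v)"
  using dirs_mono[of "{a\<in>A. dot a v = t}" A] by (intro card_mono) auto

text \<open>
  Here \<open>line_pair_bounds\<close> requires \<open>p + 1\<close> nonzeros and a zero on a line with \<open>p + 1\<close> points.
\<close>

lemma not_k_pred: "k \<noteq> p - 1"
proof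
  assume k: "k = p - 1"
  obtain v where v: "v \<in> dirs E"
    using dirs_nonempty by blast
  obtain q where q: "p = Suc q" "k = q"
    using k p_gt_1 by (cases p) auto
  let ?m = "card (nonzero_dirs E \<inter> proj_line v)" and ?z = "card (zero_dirs E \<inter> proj_line v)"
  have "2 * Suc q + q * Suc q \<le> Suc q * ?m + q * ?z" "?m + ?z = q + 2" "?z \<ge> 1"
    using line_pair_bounds(1-3)[OF v] by (simp_all add: q)
  then have "2 * Suc q + q * Suc q \<le> ?m + q * (q + 2)" "?m + 1 \<le> q + 2"
    by (simp_all add: algebra_simps flip: distrib_left) 
  then show False
    by (simp add: algebra_simps)
qed

lemma two_neq_0: "p > 2 \<Longrightarrow> (2 :: 'p mod_ring) \<noteq> 0"
proof
  assume "p > 2" "(2 :: 'p mod_ring) = 0"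
  then have "CARD('p) dvd 2"
    by (intro of_nat_0_mod_ring_dvd) simp
  with \<open>p > 2\<close> show False
    using dvd_imp_le[of p 2] by simp
qed

text \<open>
  A difference \<open>v\<close> of \<open>E\<close> is normal to at least four nonzeros, hence to at most two zeros. But the
  three points of \<open>A\<close> in a plane normal to \<open>v\<close> are not collinear and determine three zeros.
\<close>

lemma not_5_3: "\<not> (p = 5 \<and> k = 3)"
proof
  assume pk: "p = 5 \<and> k = 3"
  interpret dual: spectral_pair A E k p
    by (rule dual)
  obtain v where v: "v \<in> dirs E"
    using dirs_nonempty by blast
  then have v0: "v \<noteq> 0"
    using proj_points_nonzero by (auto simp: dirs_def)
  let ?G = "{a\<in>A. dot a v = 0}"
  have cG: "card ?G = 3"
    using plane_section_card[OF v] pk by simp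
  have "line_count ?G u x < card ?G" if "u \<noteq> 0" for u x
  proof (rule ccontr)
    assume "\<not> ?thesis"
    then have "line_count A u x \<ge> 3"
      using line_count_mono[of ?G A u x] cG by simp
    from dual.line_count_bound[OF that this] show False
      using card_zero_nonzero_line[OF that, of A] dual.zero_on_line[OF that] pk by simp
  qed
  then have "3 \<le> card (dirs ?G \<inter> proj_line v)"
    using noncollinear_dirs[OF v0, of ?G 0] two_neq_0 cG pk by simp
  also have "\<dots> \<le> card (zero_dirs E \<inter> proj_line v)"
    using plane_section_dirs line_pair_bounds(4)[OF v] by (rule le_trans)
  finally show False
    using line_pair_bounds(1,2)[OF v] pk by simp
qed

text \<open>
  A difference of \<open>E\<close> is normal to at least five nonzeros, hence to at most three zeros. But the
  five points of \<open>A\<close> in a plane normal to it, no three of them collinear, determine at least four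
  zeros.
\<close>

lemma not_7_5: "\<not> (p = 7 \<and> k = 5)"
proof
  assume pk: "p = 7 \<and> k = 5"
  interpret dual: spectral_pair A E k p
    by (rule dual)
  obtain v where v: "v \<in> dirs E"
    using dirs_nonempty by blast
  then have v0: "v \<noteq> 0"
    using proj_points_nonzero by (auto simp: dirs_def)
  let ?G = "{a\<in>A. dot a v = 0}"
  have cG: "card ?G = 5"
    using plane_section_card[OF v] pk by simp
  have lines: "line_count ?G u x \<le> 2" if "u \<noteq> 0" for u x
  proof (rule ccontr)
    assume "\<not> ?thesis"
    then have "line_count A u x \<ge> 3"
      using line_count_mono[of ?G A u x] by simp
    from dual.line_count_bound[OF that this] show False
      using card_zero_nonzero_line[OF that, of A] dual.zero_on_line[OF that] pk by simp
  qed
  have "?G \<noteq> {}"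
    using cG by (metis card.empty zero_neq_numeral)
  then obtain a where "a \<in> ?G"
    by blast
  then have "5 \<le> card (dirs ?G \<inter> proj_line v) + 1"
    using pencil_dirs[OF v0 _ _ lines, of 0 a] cG by simp
  also have "\<dots> \<le> card (zero_dirs E \<inter> proj_line v) + 1"
    using plane_section_dirs line_pair_bounds(4)[OF v] by (meson add_le_mono1 le_trans)
  finally show False
    using line_pair_bounds(1,2)[OF v] pk by simp
qed

text \<open>
  Here the bounds for zeros and for directions, obtained as in the previous cases, coincide.
\<close>

lemma zero_line_7_4:
  assumes "p = 7" "k = 4" and v: "v \<in> dirs E"
  shows "card (zero_dirs E \<inter> proj_line v) = 4" "zero_dirs E \<inter> proj_line v = dirs A \<inter> proj_line v"
proof -
  interpret dual: spectral_pair A E k p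
    by (rule dual)
  have v0: "v \<noteq> 0"
    using v proj_points_nonzero by (auto simp: dirs_def)
  let ?G = "{a\<in>A. dot a v = 0}"
  have cG: "card ?G = 4"
    using plane_section_card[OF v] assms by simp
  have "line_count ?G u x < card ?G" if "u \<noteq> 0" for u x
  proof (rule ccontr)
    assume "\<not> ?thesis"
    then have "line_count A u x \<ge> 4"
      using line_count_mono[of ?G A u x] cG by simp
    from dual.line_count_bound[OF that this] show False
      using card_zero_nonzero_line[OF that, of A] dual.zero_on_line[OF that] assms by simp
  qed
  then have "4 \<le> card (dirs ?G \<inter> proj_line v)"
    using noncollinear_dirs[OF v0, of ?G 0] two_neq_0 cG assms by simp
  then have dA: "4 \<le> card (dirs A \<inter> proj_line v)"
    using plane_section_dirs by (rule le_trans)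
  then show z4: "card (zero_dirs E \<inter> proj_line v) = 4"
    using line_pair_bounds[OF v] assms by simp
  show "zero_dirs E \<inter> proj_line v = dirs A \<inter> proj_line v"
    using dirs_subset_zero z4 dA by (intro card_seteq[symmetric]) auto
qed

text \<open>
  Every zero of \<open>E\<close> is normal to a difference of \<open>E\<close>, so equality on the corresponding lines
  determines all zeros, and counting pairs of points gives their number.
\<close>

lemma zero_dirs_7_4:
  assumes "p = 7" "k = 4"
  shows "zero_dirs E = dirs A" "card (zero_dirs E) = 36"
proof -
  show "zero_dirs E = dirs A"
  proof
    show "zero_dirs E \<subseteq> dirs A"
    proof
      fix d assume d: "d \<in> zero_dirs E"
      then have dP: "d \<in> proj_points"
        by (simp add: zero_dirs_def)
      obtain v where v: "v \<in> dirs E" "v \<in> proj_line d"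
        using dirs_on_line[OF proj_points_nonzero[OF dP]] by blast
      then have "d \<in> proj_line v"
        using dP by (simp add: proj_line_def dot_commute[of d])
      then show "d \<in> dirs A"
        using zero_line_7_4(2)[OF assms v(1)] d by blast
    qed
  qed (rule dirs_subset_zero)
  have "card (zero_dirs E) * (k * p * (k - 1)) = (\<Sum>e\<in>E. \<Sum>e'\<in>E - {e}. card (zero_dirs E \<inter> proj_line (e - e')))"
    by (rule zero_dirs_pairs[symmetric]) simp
  also have "\<dots> = (\<Sum>e\<in>E. \<Sum>e'\<in>E - {e}. 4)"
  proof (intro sum.cong refl)
    fix e e' assume e: "e \<in> E" "e' \<in> E - {e}"
    then have "proj_line (e - e') = proj_line (pdir (e - e'))"
      by (intro proj_line_pdir[symmetric]) auto
    then show "card (zero_dirs E \<inter> proj_line (e - e')) = 4"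
      using zero_line_7_4(1)[OF assms pdir_diff_in_dirs[of e E e']] e by auto
  qed
  also have "\<dots> = 28 * 27 * 4"
    using card_E assms by (simp add: card_Diff_singleton)
  finally show "card (zero_dirs E) = 36"
    using assms by simp
qed

text \<open>
  The \<open>36\<close> lines given by differences of \<open>E\<close> carry four zeros each. On the other \<open>21\<close> lines the mean
  of \<open>(z - 6) * (z - 7)\<close> over the numbers \<open>z\<close> of zeros would be negative, although this product of
  consecutive integers is not.
\<close>

lemma not_7_4: "\<not> (p = 7 \<and> k = 4)"
proof
  assume pk: "p = 7 \<and> k = 4"
  interpret dual: spectral_pair A E k p
    by (rule dual)
  let ?z = "\<lambda>v. card (zero_dirs E \<inter> proj_line v)" and ?P = "proj_points :: 'p space3 set"
  have Z36: "card (zero_dirs E) = 36" and D36: "card (dirs E) = 36"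
    using zero_dirs_7_4 dual.zero_dirs_7_4 pk by simp_all
  have ZP: "zero_dirs E \<subseteq> proj_points" and DP: "dirs E \<subseteq> ?P"
    by (auto simp: zero_dirs_def dirs_def)
  have P57: "card ?P = 57"
    using card_proj_points[where 'p='p] pk by simp
  have s1: "(\<Sum>v\<in>?P. int (?z v)) = 288"
    using sum_lines_card[OF ZP] Z36 pk by (simp flip: of_nat_sum)
  have s2: "(\<Sum>v\<in>?P. (int (?z v))\<^sup>2) = 1548"
    using sum_lines_card_squared[OF ZP] Z36 pk by (simp flip: of_nat_sum of_nat_power)
  have "(\<Sum>v\<in>?P. (int (?z v) - 6) * (int (?z v) - 7)) = (\<Sum>v\<in>?P. (int (?z v))\<^sup>2 - 13 * int (?z v) + 42)"
    by (intro sum.cong refl) (simp add: power2_eq_square algebra_simps)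
  also have "\<dots> = 198"
    by (simp add: sum.distrib sum_subtractf s1 s2 P57 flip: sum_distrib_left)
  finally have total: "(\<Sum>v\<in>?P. (int (?z v) - 6) * (int (?z v) - 7)) = 198" .
  have "(\<Sum>v\<in>dirs E. (int (?z v) - 6) * (int (?z v) - 7)) = (\<Sum>v\<in>dirs E. 6)"
    using zero_line_7_4(1) pk by (intro sum.cong refl) simp
  also have "\<dots> = 216"
    by (simp add: D36)
  finally have "216 = (\<Sum>v\<in>dirs E. (int (?z v) - 6) * (int (?z v) - 7))" ..
  also have "\<dots> \<le> (\<Sum>v\<in>?P. (int (?z v) - 6) * (int (?z v) - 7))"
  proof (rule sum_mono2[OF finite DP])
    fix v
    show "0 \<le> (int (?z v) - 6) * (int (?z v) - 7)"
      by (cases "int (?z v) \<le> 6") (auto intro: mult_nonpos_nonpos mult_nonneg_nonneg)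
  qed
  finally show False
    using total by simp
qed

end

section \<open>Moments\<close>

text \<open>
  A polynomial of degree \<open>j\<close> does not vanish at all nonzero elements, so \<open>a ^ j \<noteq> 1\<close> for some \<open>a \<noteq>
  0\<close>; multiplying the variable by \<open>a\<close> permutes the terms and multiplies the sum by \<open>a ^ j\<close>.
\<close>

lemma sum_powers_mod_ring:
  assumes "j + 1 < CARD('p)"
  shows "(\<Sum>t\<in>(UNIV :: 'p::prime_card mod_ring set). t ^ j) = 0"
proof (cases "j = 0")
  case True
  then show ?thesis
    by simp
next
  case False
  let ?q = "monom 1 j - 1 :: 'p mod_ring poly"
  have "degree ?q = j"
    using False by (simp add: degree_add_eq_left degree_monom_eq flip: add_uminus_conv_diff)
  moreover have "?q \<noteq> 0"
    using calculation False by auto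
  ultimately have "card {t. poly ?q t = 0} \<le> j"
    using card_poly_roots_bound[of ?q] by simp
  also have "\<dots> < card (UNIV - {0 :: 'p mod_ring})"
    using assms by (simp add: card_Diff_subset)
  finally have "\<not> UNIV - {0 :: 'p mod_ring} \<subseteq> {t. poly ?q t = 0}"
    using card_mono[of "{t. poly ?q t = 0}" "UNIV - {0}"] by auto
  then obtain a :: "'p mod_ring" where a: "a \<noteq> 0" "a ^ j \<noteq> 1"
    by (auto simp: poly_monom)
  have "(\<Sum>t\<in>UNIV. (a * t) ^ j) = (\<Sum>t\<in>(UNIV :: 'p mod_ring set). t ^ j)"
    using a(1) by (intro sum.reindex_bij_witness[of _ "\<lambda>t. t / a" "\<lambda>t. a * t"]) auto
  then have "(a ^ j - 1) * (\<Sum>t\<in>(UNIV :: 'p mod_ring set). t ^ j) = 0"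
    by (simp add: power_mult_distrib left_diff_distrib flip: sum_distrib_left)
  then show ?thesis
    using a(2) by simp
qed

lemma fermat_mod_ring:
  "x ^ (CARD('p) - 1) = (if x = 0 then 0 else 1 :: 'p::prime_card mod_ring)"
proof (cases "x = 0")
  case False
  have "x * x ^ (CARD('p) - 1) = x ^ CARD('p)"
    using card_p_gt_1[where 'p='p] by (cases "CARD('p)") simp_all
  also have "\<dots> = x"
    using finite_field_power_card_eq_same[of x] by simp
  finally show ?thesis
    using False by simp
qed (use card_p_gt_1[where 'p='p] in simp)

text \<open>
  Power sums of a set seen along \<open>d\<close>. In \<open>d\<close> the moment of order \<open>j\<close> is a form of degree \<open>j\<close>.
\<close>

definition moment :: "('p::prime_card mod_ring ^ 'd::finite) set \<Rightarrow> nat \<Rightarrow> 'p mod_ring ^ 'd \<Rightarrow> 'p mod_ring"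
  where "moment S j d = (\<Sum>e\<in>S. dot e d ^ j)"

lemma moment_plane_count: "moment S j d = (\<Sum>t\<in>UNIV. of_nat (plane_count S d t) * t ^ j)"
  unfolding moment_def plane_count_def by (rule sum_by_dot)

lemma moment_equidistributed:
  fixes S :: "('p::prime_card mod_ring ^ 'd::finite) set"
  assumes "equidistributed S d"
  shows "moment S j d = of_nat (plane_count S d 0) * (\<Sum>t\<in>UNIV. t ^ j)"
proof -
  have "moment S j d = (\<Sum>t\<in>UNIV. of_nat (plane_count S d 0) * t ^ j)"
    unfolding moment_plane_count
    by (intro sum.cong refl arg_cong2[where f="(*)"] arg_cong[where f=of_nat] equidistributedD[OF assms])
  then show ?thesis
    by (simp add: sum_distrib_left)
qed

lemma moment_scale: "moment S j (c *s d) = c ^ j * moment S j d"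
  by (simp add: moment_def power_mult_distrib sum_distrib_left)

lemma obtain_other_point:
  fixes v :: "'p::prime_card space3"
  assumes "v \<noteq> 0"
  obtains u where "u \<in> proj_line v" "u \<noteq> d"
proof -
  have "\<not> proj_line v \<subseteq> {d}"
    using card_mono[of "{d}" "proj_line v"] card_proj_line[OF assms] card_p_gt_1[where 'p='p] by auto
  then show thesis
    using that by blast
qed

lemma proj_line_parametrization:
  fixes v :: "'p::prime_card space3"
  assumes v: "v \<noteq> 0" and d: "d \<in> proj_line v" and u: "u \<in> proj_line v" "u \<noteq> d"
    and x: "x \<in> proj_line v" "x \<noteq> d"
  obtains s c where "c \<noteq> 0" "x = c *s (u + s *s d)"
proof -
  have ind: "independent2 u d"
    using proj_points_not_parallel[of u d] u d proj_points_nonzero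
    by (intro independent2I) (auto simp: proj_line_def)
  obtain a b where ab: "x = a *s u + b *s d"
    by (rule plane_coordinates[OF v _ _ ind, of x]) (use u(1) d x(1) in \<open>auto simp: proj_line_def\<close>)
  have "a \<noteq> 0"
  proof
    assume "a = 0"
    then have "x = b *s d"
      using ab by simp
    then show False
      using proj_points_not_parallel[of d x] d x by (auto simp: proj_line_def)
  qed
  then have "x = a *s (u + (b / a) *s d)"
    using ab by (simp add: vector_add_ldistrib)
  then show thesis
    using that \<open>a \<noteq> 0\<close> by blast
qed

text \<open>
  On the line through \<open>u\<close> and \<open>d\<close> the moment is a polynomial in one variable of degree at most \<open>j\<close>,
  whose coefficient of degree \<open>j\<close> is the moment at \<open>d\<close>.
\<close>

lemma moment_zeros_on_line:
  fixes v :: "'p::prime_card space3"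
  assumes v: "v \<noteq> 0" and d: "d \<in> proj_line v" "moment S j d \<noteq> 0"
  shows "card {x\<in>proj_line v. moment S j x = 0} \<le> j"
proof -
  obtain u where u: "u \<in> proj_line v" "u \<noteq> d"
    using obtain_other_point[OF v] .
  (* the moment along the line, as a polynomial in the parameter \<open>s\<close> of the point
     \<open>u + s *s d\<close> *)
  define q where "q = (\<Sum>e\<in>S. [:dot e u, dot e d:] ^ j)"
  have poly_q: "poly q s = moment S j (u + s *s d)" for s
    by (simp add: q_def poly_sum moment_def)
  have "coeff q j = moment S j d"
  proof -
    have "coeff ([:dot e u, dot e d:] ^ j) j = dot e d ^ j" for e
    proof (cases "dot e d = 0")
      case True
      then show ?thesis
        by (cases "j = 0") (simp_all add: coeff_eq_0 poly_const_pow)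
    next
      case False
      then have "degree ([:dot e u, dot e d:] ^ j) = j"
        by (simp add: degree_power_eq)
      then show ?thesis
        using False lead_coeff_power[of "[:dot e u, dot e d:]" j] by simp
    qed
    then show ?thesis
      by (simp add: q_def coeff_sum moment_def)
  qed
  then have "q \<noteq> 0"
    using d(2) by auto
  have "degree q \<le> j"
    unfolding q_def
  proof (rule degree_sum_le)
    fix e
    have "degree ([:dot e u, dot e d:] ^ j) \<le> degree [:dot e u, dot e d:] * j"
      by (rule degree_power_le)
    also have "\<dots> \<le> 1 * j"
      by (intro mult_le_mono1) simp
    finally show "degree ([:dot e u, dot e d:] ^ j) \<le> j"
      by simp
  qed simp
  have "{x\<in>proj_line v. moment S j x = 0} \<subseteq> (\<lambda>s. pdir (u + s *s d)) ` {s. poly q s = 0}"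
  proof
    fix x assume x: "x \<in> {x\<in>proj_line v. moment S j x = 0}"
    then have xd: "x \<noteq> d"
      using d(2) by auto
    obtain s c where sc: "c \<noteq> 0" "x = c *s (u + s *s d)"
      by (rule proj_line_parametrization[OF v d(1) u, of x]) (use x xd in auto)
    have "moment S j (u + s *s d) = 0"
      using x sc moment_scale[of S j c "u + s *s d"] by simp
    moreover have "u + s *s d = (1 / c) *s x"
      using sc by simp
    then have "pdir (u + s *s d) = x"
      using pdir_scale[of x "1 / c"] x sc(1) by (simp add: proj_line_def)
    ultimately show "x \<in> (\<lambda>s. pdir (u + s *s d)) ` {s. poly q s = 0}"
      using poly_q by (intro image_eqI[of _ _ s]) simp_all
  qed
  from card_mono[OF _ this] have "card {x\<in>proj_line v. moment S j x = 0} \<le> card ((\<lambda>s. pdir (u + s *s d)) ` {s. poly q s = 0})"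
    by simp
  also have "\<dots> \<le> card {s. poly q s = 0}"
    by (rule card_image_le) simp
  also have "\<dots> \<le> degree q"
    by (rule card_poly_roots_bound[OF \<open>q \<noteq> 0\<close>])
  finally show ?thesis
    using \<open>degree q \<le> j\<close> by simp
qed

text \<open>
  By Fermat's theorem \<open>1 - (a - t) ^ (p - 1)\<close> is the indicator of \<open>a = t\<close>. Expanding the power makes
  the plane count a polynomial in \<open>t\<close>, in which \<open>t ^ i\<close> comes with the moment of order \<open>p - 1 - i\<close>.
\<close>

lemma plane_count_poly:
  fixes S :: "('p::prime_card mod_ring ^ 'd::finite) set"
  assumes s: "1 \<le> s" "s < CARD('p)" and zero: "\<And>j. j + s < CARD('p) \<Longrightarrow> moment S j d = 0"
  obtains q where "degree q < s" "\<And>t. of_nat (plane_count S d t) = poly q t"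
proof -
  let ?n = "CARD('p) - 1"
  define q where "q = (\<Sum>i<s. monom (- (of_nat (?n choose i) * moment S (?n - i) d * (-1) ^ i)) i)"
  have "of_nat (plane_count S d t) = poly q t" for t
  proof -
    have "of_nat (plane_count S d t) = (\<Sum>e\<in>S. if dot e d = t then 1 else 0 :: 'p mod_ring)"
      unfolding plane_count_def by (simp add: sum.If_cases Int_def)
    also have "\<dots> = (\<Sum>e\<in>S. 1 - ((- t) + dot e d) ^ ?n)"
      unfolding fermat_mod_ring by (intro sum.cong refl) (auto simp: add_eq_0_iff)
    also have "\<dots> = moment S 0 d - (\<Sum>e\<in>S. \<Sum>i\<le>?n. of_nat (?n choose i) * (- t) ^ i * dot e d ^ (?n - i))"
      unfolding binomial_ring sum_subtractf moment_def by simp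
    also have "moment S 0 d = 0"
      using zero[of 0] s by simp
    also have "(\<Sum>e\<in>S. \<Sum>i\<le>?n. of_nat (?n choose i) * (- t) ^ i * dot e d ^ (?n - i)) =
        (\<Sum>i\<le>?n. of_nat (?n choose i) * (- t) ^ i * moment S (?n - i) d)"
      unfolding moment_def sum_distrib_left by (rule sum.swap)
    also have "\<dots> = (\<Sum>i<s. of_nat (?n choose i) * (- t) ^ i * moment S (?n - i) d)"
      using s by (intro sum.mono_neutral_right) (auto intro!: zero)
    also have "0 - \<dots> = poly q t"
      unfolding q_def poly_sum poly_monom diff_0 sum_negf[symmetric]
      by (intro sum.cong refl) (simp add: power_minus[of t] algebra_simps)
    finally show ?thesis .
  qed
  moreover have "degree q < s"
    unfolding q_def using s(1)
    by (intro degree_sum_less) (auto intro: le_less_trans[OF degree_monom_le])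
  ultimately show thesis
    using that by blast
qed

text \<open>
  Outside this set the plane counts agree modulo \<open>p\<close> with a polynomial of degree less than \<open>s\<close>, by
  \<open>plane_count_poly\<close>.
\<close>

definition high_dirs :: "'p::prime_card space3 set \<Rightarrow> nat \<Rightarrow> 'p space3 set"
  where "high_dirs E s = {d\<in>proj_points. \<exists>j. j + s < CARD('p) \<and> moment E j d \<noteq> 0}"

text \<open>
  A moment of order \<open>j < p - s\<close> that is nonzero somewhere on the line has at most \<open>j\<close> of the \<open>p + 1\<close>
  points as zeros.
\<close>

lemma high_dirs_line:
  fixes E :: "'p::prime_card space3 set"
  assumes v: "v \<noteq> 0" and ne: "high_dirs E s \<inter> proj_line v \<noteq> {}"
  shows "card (high_dirs E s \<inter> proj_line v) \<ge> s + 2"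
proof -
  obtain d j where d: "d \<in> proj_line v" and j: "j + s < CARD('p)" "moment E j d \<noteq> 0"
    using ne unfolding high_dirs_def by blast
  let ?Z = "{x\<in>proj_line v. moment E j x = 0}"
  have "proj_line v - ?Z \<subseteq> high_dirs E s \<inter> proj_line v"
    using j(1) unfolding high_dirs_def proj_line_def by blast
  then have "card (proj_line v - ?Z) \<le> card (high_dirs E s \<inter> proj_line v)"
    by (intro card_mono) simp_all
  moreover have "card (proj_line v - ?Z) = CARD('p) + 1 - card ?Z"
    using card_proj_line[OF v] by (subst card_Diff_subset) auto
  ultimately show ?thesis
    using moment_zeros_on_line[OF v d j(2)] j(1) by linarith
qed

lemma high_dirs_subset_nonzero:
  fixes E :: "'p::prime_card space3 set"
  assumes "s \<ge> 1"
  shows "high_dirs E s \<subseteq> nonzero_dirs E"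
proof
  fix d assume "d \<in> high_dirs E s"
  then obtain j where d: "d \<in> proj_points" and j: "j + s < CARD('p)" "moment E j d \<noteq> 0"
    unfolding high_dirs_def by blast
  have "\<not> equidistributed E d"
    using moment_equidistributed[of E d j] sum_powers_mod_ring[of j, where 'p='p] j assms by auto
  then show "d \<in> nonzero_dirs E"
    using d by (simp add: nonzero_dirs_def)
qed

section \<open>Flat directions\<close>

text \<open>
  At these nonzeros the plane counts are constant modulo \<open>p\<close>.
\<close>

definition flat_dirs :: "'p::prime_card space3 set \<Rightarrow> 'p space3 set"
  where "flat_dirs E = nonzero_dirs E - high_dirs E 1"

lemma of_nat_mod_ring_eq_iff:
  "(of_nat m :: 'p::prime_card mod_ring) = of_nat n \<longleftrightarrow> m mod CARD('p) = n mod CARD('p)"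
  using of_nat_eq_iff_cong_CHAR[of m n, where 'a="'p mod_ring"] by (simp add: cong_def)

context spectral_pair
begin

text \<open>
  The plane counts are congruent modulo \<open>p\<close> and lie between \<open>0\<close> and \<open>p\<close>, but are not all equal.
\<close>

lemma flat_plane_count:
  assumes "d \<in> flat_dirs E"
  shows "plane_count E d t = 0 \<or> plane_count E d t = p"
proof -
  have d: "d \<in> proj_points" "\<not> equidistributed E d" and zero: "moment E j d = 0" if "j + 1 < p" for j
    using assms that by (auto simp: flat_dirs_def nonzero_dirs_def high_dirs_def)
  have dP: "d \<in> proj_points" "\<not> equidistributed E d"
    using assms by (auto simp: flat_dirs_def nonzero_dirs_def)
  obtain q where q: "degree q < 1" "\<And>t. of_nat (plane_count E d t) = poly q t"
    by (rule plane_count_poly[of 1 E d]) (use p_gt_1 zero in auto)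
  then obtain c where c: "q = [:c:]"
    by (auto elim: degree_eq_zeroE)
  have cong: "plane_count E d t mod p = plane_count E d s mod p" for s t
    using q(2)[of s] q(2)[of t] of_nat_mod_ring_eq_iff[of "plane_count E d t" "plane_count E d s", where 'p='p]
    by (simp add: c)
  have le: "plane_count E d t \<le> p" for t
    by (rule plane_count_le[OF proj_points_nonzero[OF dP(1)]])
  show ?thesis
  proof (rule ccontr)
    assume contr: "\<not> ?thesis"
    then have lt: "plane_count E d t mod p = plane_count E d t" "plane_count E d t > 0"
      using le[of t] by auto
    have "plane_count E d s = plane_count E d t" for s
    proof -
      have "plane_count E d s mod p = plane_count E d t"
        using cong[of s t] lt by simp
      then show ?thesis
        using le[of s] lt(2) by (cases "plane_count E d s = p") auto
    qed
    then have "equidistributed E d"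
      unfolding equidistributed_iff by (intro allI) (rule trans[OF _ sym])
    then show False
      using dP(2) by blast
  qed
qed

text \<open>
  All nonzero terms of \<open>line_identity\<close> are divisible by \<open>p\<close>, so the number of zeros is divisible by
  \<open>p\<close>, and it is neither \<open>0\<close> nor \<open>p + 1\<close>.
\<close>

lemma flat_line_tangent:
  assumes v: "v \<noteq> 0" and flat: "nonzero_dirs E \<inter> proj_line v \<subseteq> flat_dirs E"
  shows "card (nonzero_dirs E \<inter> proj_line v) = 1"
proof -
  let ?m = "card (nonzero_dirs E \<inter> proj_line v)" and ?z = "card (zero_dirs E \<inter> proj_line v)"
  have "p dvd (\<Sum>d\<in>nonzero_dirs E \<inter> proj_line v. plane_count E d (dot 0 d))"
  proof (rule dvd_sum)
    fix d assume "d \<in> nonzero_dirs E \<inter> proj_line v"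
    then have "d \<in> flat_dirs E"
      using flat by blast
    then show "p dvd plane_count E d (dot 0 d)"
      using flat_plane_count[of d "dot 0 d"] by (metis dvd_0_right dvd_refl)
  qed
  moreover have "p dvd (\<Sum>d\<in>nonzero_dirs E \<inter> proj_line v. plane_count E d (dot 0 d)) + k * ?z"
    unfolding line_identity[OF v] by simp
  ultimately have "p dvd k * ?z"
    by (simp add: dvd_add_right_iff)
  moreover have "prime p"
    using prime_card[where 'a='p] by simp
  moreover have "\<not> p dvd k"
    using k2 kp by (auto dest: dvd_imp_le)
  ultimately have "p dvd ?z"
    by (simp add: prime_dvd_mult_iff)
  then obtain c where c: "?z = p * c"
    by blast
  have mz: "?m + ?z = p + 1"
    using card_zero_nonzero_line[OF v, of E] by simp
  have "?m \<ge> 1"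
    using nonzero_on_line[OF v] by (simp add: Suc_le_eq card_gt_0_iff)
  moreover have "?z \<ge> 1"
    by (rule zero_on_line[OF v])
  ultimately have "c = 1"
    using c mz p_gt_1 by (cases c; cases "c - 1") auto
  then show ?thesis
    using c mz by simp
qed

text \<open>
  Either some nonzero on the line has a nonzero moment, and \<open>high_dirs_line\<close> applies with \<open>s = 1\<close>,
  or all of them are flat.
\<close>

lemma line_dichotomy:
  assumes v: "v \<noteq> 0"
  shows "card (nonzero_dirs E \<inter> proj_line v) = 1 \<and> nonzero_dirs E \<inter> proj_line v \<subseteq> flat_dirs E \<or>
    card (nonzero_dirs E \<inter> proj_line v) \<ge> 3"
proof (cases "high_dirs E 1 \<inter> proj_line v = {}")
  case True
  then have "nonzero_dirs E \<inter> proj_line v \<subseteq> flat_dirs E"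
    by (auto simp: flat_dirs_def)
  then show ?thesis
    using flat_line_tangent[OF v] by blast
next
  case False
  have "3 \<le> card (high_dirs E 1 \<inter> proj_line v)"
    using high_dirs_line[OF v False] by simp
  also have "\<dots> \<le> card (nonzero_dirs E \<inter> proj_line v)"
    using high_dirs_subset_nonzero[of 1 E] by (intro card_mono) auto
  finally show ?thesis
    by simp
qed

end

section \<open>Vanishing moments and overlapping translates\<close>

lemma sum_poly_dot:
  "(\<Sum>e\<in>S. poly g (dot e d)) = (\<Sum>j\<le>degree g. coeff g j * moment S j d)"
  unfolding poly_altdef moment_def sum_distrib_left by (rule sum.swap)

lemma degree_root_product: "finite R \<Longrightarrow> degree (\<Prod>r\<in>R. [:- r, 1:] :: 'a::field poly) = card R"
  by (subst degree_prod_eq_sum_degree) auto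

lemma poly_root_product_eq_0_iff:
  "finite R \<Longrightarrow> poly (\<Prod>r\<in>R. [:- r, 1:]) x = 0 \<longleftrightarrow> x \<in> (R :: 'a::field set)"
  by (auto simp: poly_prod)

text \<open>
  Testing with a polynomial that vanishes at all values but one shows that this value is attained a
  multiple of \<open>p\<close> times.
\<close>

lemma vanishing_moments_support:
  fixes S :: "('p::prime_card mod_ring ^ 'd::finite) set"
  assumes zero: "\<And>j. j \<le> J \<Longrightarrow> moment S j d = 0"
    and small: "\<And>t. plane_count S d t < CARD('p)" and "S \<noteq> {}"
  shows "card ((\<lambda>e. dot e d) ` S) \<ge> J + 2"
proof (rule ccontr)
  let ?K = "(\<lambda>e. dot e d) ` S"
  assume contr: "\<not> ?thesis"
  obtain e0 where e0: "e0 \<in> S"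
    using \<open>S \<noteq> {}\<close> by blast
  define y where "y = dot e0 d"
  define g where "g = (\<Prod>r\<in>?K - {y}. [:- r, 1:])"
  have yK: "y \<in> ?K"
    using e0 by (simp add: y_def)
  have "degree g = card ?K - 1"
    unfolding g_def using yK by (subst degree_root_product) simp_all
  then have "degree g \<le> J"
    using contr by linarith
  then have "(\<Sum>e\<in>S. poly g (dot e d)) = 0"
    unfolding sum_poly_dot by (intro sum.neutral) (simp add: zero)
  moreover have "(\<Sum>e\<in>S. poly g (dot e d)) = (\<Sum>e\<in>{e\<in>S. dot e d = y}. poly g (dot e d))"
    by (rule sum.mono_neutral_right) (auto simp: g_def poly_root_product_eq_0_iff)
  moreover have "\<dots> = of_nat (plane_count S d y) * poly g y"
    by (simp add: plane_count_def)
  moreover have "poly g y \<noteq> 0"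
    by (simp add: g_def poly_root_product_eq_0_iff)
  ultimately have "(of_nat (plane_count S d y) :: 'p mod_ring) = 0"
    by simp
  then have "CARD('p) dvd plane_count S d y"
    by (rule of_nat_0_mod_ring_dvd)
  moreover have "plane_count S d y > 0"
    unfolding plane_count_def card_gt_0_iff using e0 by (auto simp: y_def)
  ultimately show False
    using small[of y] by (auto dest: dvd_imp_le)
qed

lemma perp_two_parallel:
  fixes x d v :: "'p::prime_card space3"
  assumes "x \<in> proj_points" "d \<in> proj_points" "x \<noteq> d" "v \<in> proj_line x" "v \<in> proj_line d" "dot y x = 0" "dot y d = 0"
  shows "\<exists>c. y = c *s v"
proof (cases "y = 0")
  case True
  then show ?thesis
    by (intro exI[of _ 0]) simp
next
  case False
  obtain w where w: "proj_line x \<inter> proj_line d = {w}"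
    using card_proj_line_Int_points[OF assms(1-3)] by (auto simp: card_1_singleton_iff)
  have "pdir y \<in> {w}" "v \<in> {w}"
    unfolding w[symmetric] using assms pdir_in_proj_line[OF False] by auto
  then have "pdir y = v"
    by simp
  then show ?thesis
    using pdir(2)[OF False] by auto
qed

lemma card_fibre_le_line_count:
  fixes S :: "'p::prime_card space3 set"
  assumes "\<And>e e'. e \<in> S \<Longrightarrow> e' \<in> S \<Longrightarrow> P e \<Longrightarrow> P e' \<Longrightarrow> \<exists>c. e - e' = c *s v"
    and "\<And>y. line_count S v y \<le> m"
  shows "card {e\<in>S. P e} \<le> m"
proof (cases "{e\<in>S. P e} = {}")
  case False
  then obtain e' where e': "e' \<in> S" "P e'"
    by blast
  have "{e\<in>S. P e} \<subseteq> {e\<in>S. \<exists>c. e - e' = c *s v}"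
    using assms(1)[OF _ e'(1) _ e'(2)] by blast
  then have "card {e\<in>S. P e} \<le> line_count S v e'"
    unfolding line_count_def by (rule card_mono[OF finite])
  then show ?thesis
    using assms(2)[of e'] by (rule le_trans)
next
  case True
  then show ?thesis
    by (simp only: card.empty)
qed

text \<open>
  Assume that three directions are not determined. Projecting along such a direction maps the seven
  points bijectively onto the field, so the moments of order at most two vanish at three points of a
  projective line, hence on the whole line. Then every projection takes at least four values by
  \<open>vanishing_moments_support\<close>, which leaves at most eight ordered pairs in each direction; but \<open>42\<close>
  ordered pairs need more than five directions.
\<close>

lemma seven_points_dirs:
  fixes G :: "'p::prime_card space3 set"
  assumes p7: "CARD('p) = 7" and x: "x \<in> proj_points" and G: "\<And>a. a \<in> G \<Longrightarrow> dot a x = \<tau>" and card: "card G = 7"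
    and lines: "\<And>u y. u \<noteq> 0 \<Longrightarrow> line_count G u y \<le> 3"
  shows "card (dirs G \<inter> proj_line x) \<ge> 6"
proof (rule ccontr)
  assume contr: "\<not> ?thesis"
  let ?D = "dirs G \<inter> proj_line x"
  have x0: "x \<noteq> 0"
    by (rule proj_points_nonzero[OF x])
  have "\<not> proj_points \<subseteq> proj_line x"
    using card_mono[of "proj_line x" proj_points] card_proj_line[OF x0] p7 card_proj_points[where 'p='p] by auto
  then obtain v' where v': "v' \<in> proj_points" "dot v' x \<noteq> 0"
    by (auto simp: proj_line_def)
  have v'0: "v' \<noteq> 0"
    by (rule proj_points_nonzero[OF v'(1)])
  have "\<forall>v\<in>proj_line x. \<exists>d. proj_line v' \<inter> proj_line v = {d}"
  proof
    fix v assume "v \<in> proj_line x"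
    then have "v \<in> proj_points" "v' \<noteq> v"
      using v' by (auto simp: proj_line_def)
    then show "\<exists>d. proj_line v' \<inter> proj_line v = {d}"
      using card_proj_line_Int_points[OF v'(1)] by (auto simp: card_1_singleton_iff)
  qed
  then obtain f where f: "\<And>v. v \<in> proj_line x \<Longrightarrow> proj_line v' \<inter> proj_line v = {f v}"
    using bchoice[of "proj_line x" "\<lambda>v d. proj_line v' \<inter> proj_line v = {d}"] by blast
  have fv: "f v \<in> proj_line v'" "f v \<in> proj_line v" "v \<in> proj_line (f v)" "f v \<in> proj_points" "f v \<noteq> x" if "v \<in> proj_line x" for v
  proof -
    show 1: "f v \<in> proj_line v'" and 2: "f v \<in> proj_line v"
      using f[OF that] by auto
    then show "f v \<in> proj_points" "v \<in> proj_line (f v)"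
      using that by (auto simp: proj_line_def dot_commute[of v])
    show "f v \<noteq> x"
      using 1 v'(2) by (auto simp: proj_line_def dot_commute[of v'])
  qed
  have par: "\<exists>c. a - a' = c *s v" if "v \<in> proj_line x" "a \<in> G" "a' \<in> G" "dot a (f v) = dot a' (f v)" for v a a'
    by (rule perp_two_parallel[OF x fv(4)[OF that(1)] fv(5)[OF that(1), symmetric] that(1) fv(3)[OF that(1)]])
      (use that G in auto)
  (* within a plane normal to \<open>x\<close> the map \<open>\<lambda>a. dot a (f v)\<close> is the
     projection along \<open>v\<close>, and all these \<open>f v\<close> are distinct points of one
     projective line *)
  have inj_f: "inj_on f (proj_line x)"
  proof (rule inj_onI, rule ccontr)
    fix v w assume vw: "v \<in> proj_line x" "w \<in> proj_line x" "f v = f w" "v \<noteq> w"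
    have "card {v, w} \<le> card (proj_line x \<inter> proj_line (f v))"
      using vw fv(3)[OF vw(1)] fv(3)[OF vw(2)] by (intro card_mono) auto
    then show False
      using card_proj_line_Int_points[OF x fv(4)[OF vw(1)]] fv(5)[OF vw(1)] vw(4) by auto
  qed
  (* a direction that is not determined projects the seven points onto the whole field *)
  have missing: "moment G j (f v) = 0" if v: "v \<in> proj_line x - dirs G" and j: "j \<le> 2" for v j
  proof -
    have inj: "inj_on (\<lambda>a. dot a (f v)) G"
    proof (rule inj_onI)
      fix a a' assume a: "a \<in> G" "a' \<in> G" "dot a (f v) = dot a' (f v)"
      then obtain c where "a - a' = c *s v"
        using par[of v a a'] v by blast
      then show "a = a'"
        using v a unfolding dirs_def misses_direction_def proj_line_def by blast
    qed
    then have "(\<lambda>a. dot a (f v)) ` G = UNIV"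
      using card_image[OF inj] card p7 by (intro card_subset_eq) simp_all
    then have "moment G j (f v) = (\<Sum>t\<in>UNIV. t ^ j)"
      unfolding moment_def using sum.reindex[OF inj, of "\<lambda>t. t ^ j"] by simp
    then show ?thesis
      using sum_powers_mod_ring[of j, where 'p='p] j p7 by simp
  qed
  have "card (proj_line x - dirs G) = card (proj_line x) - card ?D"
    by (simp add: card_Diff_subset_Int Int_commute)
  then have B3: "card (proj_line x - dirs G) \<ge> 3"
    using contr card_proj_line[OF x0] p7 by simp
  have vanish: "moment G j d = 0" if d: "d \<in> proj_line v'" and j: "j \<le> 2" for d j
  proof (rule ccontr)
    assume "moment G j d \<noteq> 0"
    from moment_zeros_on_line[OF v'0 d this] have "card {x\<in>proj_line v'. moment G j x = 0} \<le> 2"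
      using j by simp
    moreover have "f ` (proj_line x - dirs G) \<subseteq> {x\<in>proj_line v'. moment G j x = 0}"
      using missing[OF _ j] fv(1) by auto
    then have "card (f ` (proj_line x - dirs G)) \<le> card {x\<in>proj_line v'. moment G j x = 0}"
      by (intro card_mono) simp_all
    moreover have "card (f ` (proj_line x - dirs G)) = card (proj_line x - dirs G)"
      by (rule card_image) (rule inj_on_subset[OF inj_f], blast)
    ultimately show False
      using B3 by simp
  qed
  let ?Off = "{z\<in>G \<times> G. fst z \<noteq> snd z}"
  have fibre: "card {z\<in>?Off. pdir (fst z - snd z) = v} \<le> 8" if v: "v \<in> ?D" for v
  proof -
    have vx: "v \<in> proj_line x" and v0: "v \<noteq> 0"
      using v proj_points_nonzero by (auto simp: proj_line_def)
    let ?n = "plane_count G (f v)"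
    let ?K = "(\<lambda>a. dot a (f v)) ` G"
    have n3: "?n t \<le> 3" for t
      unfolding plane_count_def
      by (rule card_fibre_le_line_count[of _ _ v]) (use par[OF vx] lines[OF v0] in auto)
    have "card ?K \<ge> 2 + 2"
    proof (rule vanishing_moments_support)
      show "moment G j (f v) = 0" if "j \<le> 2" for j
        using vanish[OF fv(1)[OF vx] that] .
      show "?n t < CARD('p)" for t
        using n3[of t] p7 by simp
      show "G \<noteq> {}"
        using card by auto
    qed
    have supp: "(\<Sum>t\<in>?K. g (?n t)) = (\<Sum>t\<in>UNIV. g (?n t))" if "g 0 = (0::nat)" for g
    proof (rule sum.mono_neutral_left)
      show "\<forall>t\<in>UNIV - ?K. g (?n t) = 0"
      proof
        fix t assume "t \<in> UNIV - ?K"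
        then have "{a\<in>G. dot a (f v) = t} = {}"
          by blast
        then show "g (?n t) = 0"
          using that by (simp only: plane_count_def card.empty)
      qed
    qed simp_all
    have sum7: "(\<Sum>t\<in>?K. ?n t) = 7"
      using supp[of "\<lambda>n. n"] card by (simp add: sum_plane_count)
    (* \<open>(n - 1) * (n - 3) \<le> 0\<close> for \<open>1 \<le> n \<le> 3\<close>; with at least
       four values and sum \<open>7\<close> this bounds the sum of squares by \<open>16\<close>, and
       parity improves the bound to \<open>15\<close> *)
    have "(\<Sum>t\<in>?K. (?n t)\<^sup>2 + 3) \<le> (\<Sum>t\<in>?K. 4 * ?n t)"
    proof (rule sum_mono)
      fix t assume "t \<in> ?K"
      then have "?n t \<noteq> 0"
        unfolding plane_count_def by auto
      then have "?n t = 1 \<or> ?n t = 2 \<or> ?n t = 3"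
        using n3[of t] by linarith
      then show "(?n t)\<^sup>2 + 3 \<le> 4 * ?n t"
        by auto
    qed
    then have "(\<Sum>t\<in>?K. (?n t)\<^sup>2) + 3 * card ?K \<le> 28"
      by (simp add: sum.distrib sum7 flip: sum_distrib_left)
    then have sq16: "(\<Sum>t\<in>?K. (?n t)\<^sup>2) \<le> 16"
      using \<open>card ?K \<ge> 2 + 2\<close> by linarith
    have "even (\<Sum>t\<in>?K. (?n t)\<^sup>2 + ?n t)"
      by (intro dvd_sum) simp
    then have "odd (\<Sum>t\<in>?K. (?n t)\<^sup>2)"
      by (simp add: sum.distrib sum7)
    then have sq15: "(\<Sum>t\<in>?K. (?n t)\<^sup>2) \<le> 15"
      using sq16 by (cases "(\<Sum>t\<in>?K. (?n t)\<^sup>2) = 16") auto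
    let ?F = "{z\<in>?Off. pdir (fst z - snd z) = v}" and ?Diag = "(\<lambda>a. (a, a)) ` G"
    let ?S = "SIGMA a:G. {a'\<in>G. dot a' (f v) = dot a (f v)}"
    have "?F \<union> ?Diag \<subseteq> ?S"
    proof
      fix z assume "z \<in> ?F \<union> ?Diag"
      then show "z \<in> ?S"
      proof
        assume z: "z \<in> ?F"
        then have "fst z - snd z \<noteq> 0" "pdir (fst z - snd z) = v"
          by auto
        then obtain c where c: "fst z - snd z = c *s v"
          using pdir(2)[of "fst z - snd z"] by auto
        have "dot (fst z - snd z) (f v) = 0"
          unfolding c using fv(3)[OF vx] by (simp add: proj_line_def)
        then show "z \<in> ?S"
          using z by (cases z) auto
      qed auto
    qed
    then have "card (?F \<union> ?Diag) \<le> card ?S"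
      by (intro card_mono) simp_all
    also have "card ?S = (\<Sum>a\<in>G. ?n (dot a (f v)))"
      by (simp add: plane_count_def)
    also have "\<dots> = (\<Sum>t\<in>UNIV. of_nat (card {a\<in>G. dot a (f v) = t}) * ?n t)"
      by (rule sum_by_dot)
    also have "\<dots> = (\<Sum>t\<in>UNIV. (?n t)\<^sup>2)"
      by (simp add: plane_count_def power2_eq_square)
    also have "\<dots> \<le> 15"
      using supp[of "\<lambda>n. n\<^sup>2"] sq15 by simp
    also have "card (?F \<union> ?Diag) = card ?F + card G"
    proof -
      have "card ?Diag = card G"
        by (intro card_image injI inj_onI) simp
      then show ?thesis
        by (subst card_Un_disjoint) auto
    qed
    finally show ?thesis
      using card by simp
  qed
  have off42: "card ?Off = 42"
  proof -
    have "?Off = G \<times> G - (\<lambda>a. (a, a)) ` G"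
      by auto
    moreover have "card ((\<lambda>a. (a, a)) ` G) = 7"
      by (subst card_image) (auto simp: inj_on_def card)
    moreover have "(\<lambda>a. (a, a)) ` G \<subseteq> G \<times> G"
      by auto
    ultimately show ?thesis
      by (simp add: card_Diff_subset card_cartesian_product card)
  qed
  have "?Off \<subseteq> (\<Union>v\<in>?D. {z\<in>?Off. pdir (fst z - snd z) = v})"
  proof
    fix z assume z: "z \<in> ?Off"
    then have "pdir (fst z - snd z) \<in> ?D"
      using pdir_diff_in_dirs[of "fst z" G "snd z"] pdir_in_proj_line[of "fst z - snd z" x] G by auto
    then show "z \<in> (\<Union>v\<in>?D. {z\<in>?Off. pdir (fst z - snd z) = v})"
      using z by blast
  qed
  then have "card ?Off \<le> card (\<Union>v\<in>?D. {z\<in>?Off. pdir (fst z - snd z) = v})"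
    by (intro card_mono) simp_all
  also have "\<dots> \<le> (\<Sum>v\<in>?D. card {z\<in>?Off. pdir (fst z - snd z) = v})"
    by (intro card_UN_le) simp
  also have "\<dots> \<le> (\<Sum>v\<in>?D. 8)"
    by (intro sum_mono fibre)
  finally show False
    using off42 contr by simp
qed

text \<open>
  The set \<open>E\<close> lies in at most \<open>k\<close> planes normal to \<open>d\<close>, and on the line through \<open>u\<close> and \<open>d\<close> it has
  \<open>k\<close> zeros other than \<open>d\<close>. Along this line a moment of \<open>E\<close> is a polynomial in \<open>\<tau>\<close> with mixed
  moments as coefficients. By induction it has degree less than \<open>k\<close>; it is constant, as it agrees
  with a constant at \<open>k\<close> places. So the mixed moments \<open>W r q\<close> with \<open>q < k\<close> vanish, and interpolation
  separates the contributions of the sections.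
\<close>

lemma section_moments_vanish:
  fixes E :: "('p::prime_card mod_ring ^ 'd::finite) set"
  assumes K: "card ((\<lambda>e. dot e d) ` E) \<le> k" and T: "card T \<ge> k" and k: "k \<ge> 2"
    and equi: "\<And>\<tau>. \<tau> \<in> T \<Longrightarrow> equidistributed E (u + \<tau> *s d)" and r: "r + k \<le> CARD('p)"
  shows "moment {e\<in>E. dot e d = y} r u = 0"
  using r
proof (induction r arbitrary: y rule: less_induct)
  case (less r)
  let ?K = "(\<lambda>e. dot e d) ` E"
  define a where "a l y = moment {e\<in>E. dot e d = y} l u" for l y
  define W where "W l q = (\<Sum>e\<in>E. dot e u ^ l * dot e d ^ q)" for l q
  have W: "W l q = (\<Sum>y\<in>?K. a l y * y ^ q)" for l q
  proof -
    have "W l q = (\<Sum>y\<in>?K. \<Sum>e\<in>{e\<in>E. dot e d = y}. dot e u ^ l * dot e d ^ q)"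
      unfolding W_def by (rule sum.group[symmetric]) auto
    then show ?thesis
      by (simp add: a_def moment_def sum_distrib_right)
  qed
  have W0: "W l q = 0" if "l < r" for l q
    unfolding W a_def using less.IH[OF that] less.prems that by (intro sum.neutral) auto
  define c where "c s = of_nat (card E div CARD('p)) * (\<Sum>t\<in>(UNIV :: 'p mod_ring set). t ^ s)" for s
  (* the moment of order \<open>r + q\<close> has degree at most \<open>q\<close> in
     \<open>\<tau>\<close>, because \<open>W l i = 0\<close> for \<open>l < r\<close>; its
     coefficient of \<open>\<tau> ^ q\<close> is a nonzero multiple of \<open>W r q\<close> *)
  have "W r q = 0" if q: "q < k" for q
  proof -
    define s where "s = r + q"
    have s: "s < CARD('p)"
      using less.prems q by (simp add: s_def)
    define P where "P = (\<Sum>i\<le>q. monom (of_nat (s choose i) * W (s - i) i) i)"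
    have degP: "degree (P - [:c s:]) \<le> q"
      unfolding P_def by (intro degree_diff_le degree_sum_le) (auto intro: le_trans[OF degree_monom_le])
    have "poly P \<tau> = c s" if \<tau>: "\<tau> \<in> T" for \<tau>
    proof -
      have "c s = moment E s (u + \<tau> *s d)"
      proof -
        have "plane_count E (u + \<tau> *s d) 0 = card E div CARD('p)"
          using equidistributed_plane_count[OF equi[OF \<tau>], of 0] card_p_gt_1[where 'p='p] by (metis nonzero_mult_div_cancel_left not_less_zero)
        then show ?thesis
          by (simp add: moment_equidistributed[OF equi[OF \<tau>]] c_def)
      qed
      also have "\<dots> = (\<Sum>e\<in>E. \<Sum>i\<le>s. of_nat (s choose i) * (\<tau> * dot e d) ^ i * dot e u ^ (s - i))"
        unfolding moment_def dot_add_right dot_scale_right by (subst add.commute) (simp only: binomial_ring)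
      also have "\<dots> = (\<Sum>i\<le>s. \<Sum>e\<in>E. of_nat (s choose i) * (\<tau> * dot e d) ^ i * dot e u ^ (s - i))"
        by (rule sum.swap)
      also have "\<dots> = (\<Sum>i\<le>s. of_nat (s choose i) * W (s - i) i * \<tau> ^ i)"
        by (simp add: W_def power_mult_distrib sum_distrib_left sum_distrib_right mult_ac)
      also have "\<dots> = (\<Sum>i\<le>q. of_nat (s choose i) * W (s - i) i * \<tau> ^ i)"
        by (intro sum.mono_neutral_right) (auto simp: s_def W0)
      also have "\<dots> = poly P \<tau>"
        by (simp add: P_def poly_sum poly_monom)
      finally show ?thesis ..
    qed
    then have "T \<subseteq> {t. poly (P - [:c s:]) t = 0}"
      by auto
    then have "card T \<le> card {t. poly (P - [:c s:]) t = 0}"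
      by (intro card_mono) simp_all
    have "P - [:c s:] = 0"
    proof (rule ccontr)
      assume "P - [:c s:] \<noteq> 0"
      from card_poly_roots_bound[OF this] show False
        using \<open>card T \<le> _\<close> degP T q by linarith
    qed
    then have "coeff P q = coeff [:c s:] q"
      by simp
    moreover have "coeff P q = of_nat (s choose q) * W r q"
      by (simp add: P_def coeff_sum s_def)
    moreover have "coeff [:c s:] q = 0"
    proof (cases q)
      case 0
      then have "s + 1 < CARD('p)"
        using less.prems k by (simp add: s_def)
      then have "c s = 0"
        unfolding c_def by (subst sum_powers_mod_ring) simp_all
      with 0 show ?thesis
        by simp
    qed simp
    moreover have "(of_nat (s choose q) :: 'p mod_ring) \<noteq> 0"
    proof
      assume "(of_nat (s choose q) :: 'p mod_ring) = 0"
      then have "CARD('p) dvd s choose q"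
        by (rule of_nat_0_mod_ring_dvd)
      moreover have "s choose q dvd fact s"
        using binomial_fact_lemma[of q s] by (metis dvd_triv_right le_add2 s_def)
      ultimately have "CARD('p) dvd fact s"
        by (rule dvd_trans)
      then show False
        using prime_dvd_fact_iff[OF prime_card[where 'a='p]] s by simp
    qed
    ultimately show ?thesis
      by simp
  qed
  then have Wr: "W r q = 0" if "q < k" for q
    using that .
  show ?case
  proof (cases "y \<in> ?K")
    case False
    then have "{e\<in>E. dot e d = y} = {}"
      by blast
    then show ?thesis
      by (simp only: moment_def sum.empty)
  next
    case True
    define g where "g = (\<Prod>t\<in>?K - {y}. [:- t, 1:])"
    have "degree g = card ?K - 1"
      unfolding g_def using True by (subst degree_root_product) simp_all
    then have "degree g < k"
      using K k by linarith
    then have "0 = (\<Sum>j\<le>degree g. coeff g j * W r j)"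
      by (intro sum.neutral[symmetric]) (simp add: Wr)
    also have "\<dots> = (\<Sum>j\<le>degree g. \<Sum>z\<in>?K. a r z * (coeff g j * z ^ j))"
      unfolding W by (simp add: sum_distrib_left mult_ac)
    also have "\<dots> = (\<Sum>z\<in>?K. \<Sum>j\<le>degree g. a r z * (coeff g j * z ^ j))"
      by (rule sum.swap)
    also have "\<dots> = (\<Sum>z\<in>?K. a r z * poly g z)"
      by (simp add: poly_altdef sum_distrib_left)
    also have "\<dots> = (\<Sum>z\<in>{y}. a r z * poly g z)"
      using True by (intro sum.mono_neutral_right) (auto simp: g_def poly_root_product_eq_0_iff)
    finally have "a r y * poly g y = 0"
      by simp
    moreover have "poly g y \<noteq> 0"
      by (simp add: g_def poly_root_product_eq_0_iff)
    ultimately show ?thesis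
      by (simp add: a_def)
  qed
qed

text \<open>
  Going back from a point of \<open>G\<close> in steps of \<open>\<eta>\<close> leaves \<open>G\<close> eventually. So each line of direction
  \<open>\<eta>\<close> that meets \<open>G\<close> contains a point at which this happens, and it contains at most \<open>m\<close> points of
  \<open>G\<close>.
\<close>

lemma shift_overlap:
  fixes G :: "'p::prime_card space3 set"
  assumes "\<eta> \<noteq> 0" and lines: "\<And>y. line_count G \<eta> y \<le> m" and m: "m < CARD('p)"
  shows "card G \<le> m * card {a\<in>G. a - \<eta> \<notin> G}"
proof -
  let ?H = "{a\<in>G. a - \<eta> \<notin> G}"
  have "G \<subseteq> (\<Union>h\<in>?H. {e\<in>G. \<exists>c. e - h = c *s \<eta>})"
  proof
    fix a assume a: "a \<in> G"
    have "\<exists>i. a - of_nat i *s \<eta> \<notin> G"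
    proof (rule ccontr)
      assume contr: "\<not> ?thesis"
      have "(\<lambda>c. a - c *s \<eta>) ` UNIV \<subseteq> {e\<in>G. \<exists>c. e - a = c *s \<eta>}"
      proof (clarify, intro conjI)
        fix c :: "'p mod_ring"
        obtain i where "c = of_nat i"
          using surj_of_nat_mod_ring by blast
        then show "a - c *s \<eta> \<in> G"
          using contr by blast
        show "\<exists>c'. a - c *s \<eta> - a = c' *s \<eta>"
          by (intro exI[of _ "- c"]) simp
      qed
      then have "card ((\<lambda>c. a - c *s \<eta>) ` UNIV) \<le> line_count G \<eta> a"
        unfolding line_count_def by (rule card_mono[OF finite])
      moreover have "inj (\<lambda>c. a - c *s \<eta>)"
      proof (rule injI)
        fix s t assume "a - s *s \<eta> = a - t *s \<eta>"
        then have "(s - t) *s \<eta> = 0"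
          by (simp add: vector_sub_rdistrib)
        then show "s = t"
          using assms(1) by simp
      qed
      ultimately show False
        using lines[of a] m by (simp add: card_image)
    qed
    then obtain i where i: "a - of_nat i *s \<eta> \<notin> G" and least: "\<And>j. j < i \<Longrightarrow> a - of_nat j *s \<eta> \<in> G"
      using exists_least_iff[of "\<lambda>i. a - of_nat i *s \<eta> \<notin> G"] by blast
    have "i \<noteq> 0"
      using i a by (intro notI) simp
    then obtain j where j: "i = Suc j"
      by (cases i) auto
    define h where "h = a - of_nat j *s \<eta>"
    have h: "h - \<eta> = a - of_nat i *s \<eta>"
      by (simp add: h_def j vector_sadd_rdistrib algebra_simps)
    have "h \<in> G"
      using least[of j] j by (simp add: h_def)
    then have "h \<in> ?H"
      using i unfolding h[symmetric] by blast
    moreover have "a - h = of_nat j *s \<eta>"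
      by (simp add: h_def)
    ultimately show "a \<in> (\<Union>h\<in>?H. {e\<in>G. \<exists>c. e - h = c *s \<eta>})"
      using a by blast
  qed
  from card_mono[OF _ this] have "card G \<le> card (\<Union>h\<in>?H. {e\<in>G. \<exists>c. e - h = c *s \<eta>})"
    by simp
  also have "\<dots> \<le> (\<Sum>h\<in>?H. card {e\<in>G. \<exists>c. e - h = c *s \<eta>})"
    by (intro card_UN_le) simp
  also have "\<dots> \<le> (\<Sum>h\<in>?H. m)"
    using lines by (intro sum_mono) (simp add: line_count_def)
  finally show ?thesis
    by (simp add: mult.commute)
qed

context spectral_pair
begin

section \<open>There are no flat directions\<close>

lemma flat_section:
  assumes "d \<in> flat_dirs E"
  obtains t where "plane_count E d t = p"
proof -
  have "\<exists>t. plane_count E d t \<noteq> 0"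
  proof (rule ccontr)
    assume "\<not> ?thesis"
    then have "(\<Sum>t\<in>UNIV. plane_count E d t) = 0"
      by simp
    then show False
      using sum_plane_count[of E d] card_E k2 p_gt_1 by simp
  qed
  then obtain t where "plane_count E d t \<noteq> 0"
    by blast
  then show thesis
    using flat_plane_count[OF assms, of t] that[of t] by simp
qed

lemma card_flat_values:
  assumes "d \<in> flat_dirs E"
  shows "card ((\<lambda>e. dot e d) ` E) = k"
proof -
  let ?K = "(\<lambda>e. dot e d) ` E"
  have nz: "plane_count E d t = p" if "t \<in> ?K" for t
    using flat_plane_count[OF assms, of t] that by (auto simp: plane_count_def)
  have z: "plane_count E d t = 0" if "t \<notin> ?K" for t
    using that by (auto simp: plane_count_def)
  have "k * p = (\<Sum>t\<in>UNIV. plane_count E d t)"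
    by (simp add: sum_plane_count card_E)
  also have "\<dots> = (\<Sum>t\<in>?K. plane_count E d t)"
    by (rule sum.mono_neutral_right) (auto simp: z)
  also have "\<dots> = (\<Sum>t\<in>?K. p)"
    by (intro sum.cong refl nz)
  finally show ?thesis
    using p_gt_1 by simp
qed

text \<open>
  Some plane normal to \<open>x\<close> contains \<open>p\<close> points of \<open>E\<close>; with at most \<open>k\<close> of them on a line they
  determine \<open>p - 1\<close> directions.
\<close>

lemma flat_dirs_ge:
  assumes x: "x \<in> flat_dirs E" and small: "k = 2 \<or> k = 3 \<and> p = 7"
  shows "p - 1 \<le> card (dirs E \<inter> proj_line x)"
proof -
  have xP: "x \<in> proj_points"
    using x by (auto simp: flat_dirs_def nonzero_dirs_def)
  then have x0: "x \<noteq> 0"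
    by (rule proj_points_nonzero)
  obtain t where t: "plane_count E x t = p"
    by (rule flat_section[OF x])
  define G where "G = {e\<in>E. dot e x = t}"
  have G: "card G = p" "\<And>e. e \<in> G \<Longrightarrow> dot e x = t" "G \<subseteq> E"
    using t by (auto simp: G_def plane_count_def)
  have lines: "line_count G u y \<le> k" if "u \<noteq> 0" for u y
    using line_count_mono[OF G(3), of u y] line_count_le[OF that, of y] by simp
  have "p - 1 \<le> card (dirs G \<inter> proj_line x)"
  proof (cases "k = 2")
    case True
    have "G \<noteq> {}"
      using G(1) p_gt_1 by auto
    then obtain a where "a \<in> G"
      by blast
    then show ?thesis
      using pencil_dirs[OF x0, of G t a] G(1,2) lines True by simp
  next
    case False
    then show ?thesis
      using seven_points_dirs[OF _ xP, of G t] G(1,2) lines small by simp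
  qed
  also have "\<dots> \<le> card (dirs E \<inter> proj_line x)"
    using dirs_mono[OF G(3)] by (intro card_mono) auto
  finally show ?thesis .
qed

text \<open>
  The many directions of \<open>E\<close> normal to \<open>x\<close> are zeros of \<open>A\<close> and leave room for at most two nonzeros,
  so \<open>line_dichotomy\<close> applies.
\<close>

lemma flat_partner:
  assumes x: "x \<in> flat_dirs E" and small: "k = 2 \<or> k = 3 \<and> p = 7"
  obtains d where "nonzero_dirs A \<inter> proj_line x = {d}" "d \<in> flat_dirs A"
proof -
  interpret dual: spectral_pair A E k p
    by (rule dual)
  have x0: "x \<noteq> 0"
    using x proj_points_nonzero by (auto simp: flat_dirs_def nonzero_dirs_def)
  have "card (dirs E \<inter> proj_line x) \<le> card (zero_dirs A \<inter> proj_line x)"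
    using dual.dirs_subset_zero by (intro card_mono) auto
  then have "p - 1 \<le> card (zero_dirs A \<inter> proj_line x)"
    using flat_dirs_ge[OF assms] by linarith
  then have "card (nonzero_dirs A \<inter> proj_line x) \<le> 2"
    using card_zero_nonzero_line[OF x0, of A] by simp
  then have "card (nonzero_dirs A \<inter> proj_line x) = 1" "nonzero_dirs A \<inter> proj_line x \<subseteq> flat_dirs A"
    using dual.line_dichotomy[OF x0] by auto
  then show thesis
    using that by (auto simp: card_1_singleton_iff)
qed

lemma mutual_flat_pair:
  assumes d: "d \<in> flat_dirs E" and small: "k = 2 \<or> k = 3 \<and> p = 7"
  obtains x where "x \<in> flat_dirs A" "nonzero_dirs A \<inter> proj_line d = {x}" "nonzero_dirs E \<inter> proj_line x = {d}"
proof -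
  interpret dual: spectral_pair A E k p
    by (rule dual)
  obtain x where x: "nonzero_dirs A \<inter> proj_line d = {x}" "x \<in> flat_dirs A"
    by (rule flat_partner[OF assms])
  obtain d' where d': "nonzero_dirs E \<inter> proj_line x = {d'}" "d' \<in> flat_dirs E"
    by (rule dual.flat_partner[OF x(2) small])
  have "x \<in> proj_line d"
    using x(1) by blast
  then have "d \<in> nonzero_dirs E \<inter> proj_line x"
    using d by (auto simp: flat_dirs_def nonzero_dirs_def proj_line_def dot_commute[of x])
  then show thesis
    using that[OF x(2,1)] d' by simp
qed

text \<open>
  With a single nonzero on the line, \<open>line_identity\<close> has one term.
\<close>

lemma tangent_line_count:
  assumes "v \<noteq> 0" "nonzero_dirs E \<inter> proj_line v = {d}"
  shows "plane_count E d (dot y d) = p * line_count E v y"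
proof -
  have "card (zero_dirs E \<inter> proj_line v) = p"
    using card_zero_nonzero_line[OF assms(1), of E] assms(2) by simp
  then show ?thesis
    using line_identity[OF assms(1), of y] assms(2) by simp
qed

text \<open>
  Assume \<open>k\<close> zeros on the line. The section \<open>S\<close> of \<open>E\<close> by a plane normal to \<open>d\<close> has \<open>p\<close> points, and
  by \<open>section_moments_vanish\<close> the numbers of its points on the lines of direction \<open>v\<close> are the values
  of a linear polynomial modulo \<open>p\<close>. A linear polynomial that is not constant would attain \<open>p - 1\<close>,
  but no line contains more than \<open>k\<close> points. Hence every line of direction \<open>v\<close> in that plane
  contains one point of \<open>S\<close>, although \<open>v\<close> is the direction of a difference in some section.
\<close>

lemma flat_pencil_zero:
  assumes d: "d \<in> flat_dirs E" and v: "v \<in> dirs E" "v \<in> proj_line d" and kp: "k + 1 < p" and k3: "k \<le> 3"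
  shows "card (zero_dirs E \<inter> proj_line v) < k"
proof (rule ccontr)
  assume contr: "\<not> ?thesis"
  have dP: "d \<in> proj_points" and dN: "d \<in> nonzero_dirs E"
    using d by (auto simp: flat_dirs_def nonzero_dirs_def)
  have vP: "v \<in> proj_points"
    using v(1) by (simp add: dirs_def)
  then have v0: "v \<noteq> 0"
    by (rule proj_points_nonzero)
  have dv: "d \<in> proj_line v"
    using v(2) dP by (simp add: proj_line_def dot_commute[of d])
  obtain u where u: "u \<in> proj_line v" "u \<noteq> d"
    by (rule obtain_other_point[OF v0])
  have uP: "u \<in> proj_points"
    using u(1) by (simp add: proj_line_def)
  define T where "T = {\<tau>. equidistributed E (u + \<tau> *s d)}"
  have "zero_dirs E \<inter> proj_line v \<subseteq> (\<lambda>\<tau>. pdir (u + \<tau> *s d)) ` T"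
  proof
    fix x assume x: "x \<in> zero_dirs E \<inter> proj_line v"
    then have xd: "x \<noteq> d"
      using dN by (auto simp: zero_dirs_def nonzero_dirs_def)
    obtain \<tau> c where c: "c \<noteq> 0" "x = c *s (u + \<tau> *s d)"
      by (rule proj_line_parametrization[OF v0 dv u, of x]) (use x xd in auto)
    have "equidistributed E (u + \<tau> *s d)"
      using x equidistributed_scale[OF c(1), of E "u + \<tau> *s d"] c(2) by (simp add: zero_dirs_def)
    moreover have "u + \<tau> *s d = (1 / c) *s x"
      using c by simp
    then have "pdir (u + \<tau> *s d) = x"
      using pdir_scale[of x "1 / c"] x c(1) by (simp add: proj_line_def)
    ultimately show "x \<in> (\<lambda>\<tau>. pdir (u + \<tau> *s d)) ` T"
      unfolding T_def by blast
  qed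
  then have "card (zero_dirs E \<inter> proj_line v) \<le> card T"
    by (rule surj_card_le[rotated]) simp
  then have T: "card T \<ge> k"
    using contr by simp
  obtain e e' c where e: "e \<in> E" "e' \<in> E" "e \<noteq> e'" "e - e' = c *s v" "c \<noteq> 0"
    using v(1) not_misses_direction_obtain[of E v] unfolding dirs_def by blast
  define S where "S = {a\<in>E. dot a d = dot e d}"
  have mom: "moment S r u = 0" if "r + k \<le> p" for r
    unfolding S_def
    by (rule section_moments_vanish[OF _ T k2]) (use card_flat_values[OF d] that in \<open>auto simp: T_def\<close>)
  have cell: "plane_count S u t \<le> k" for t
    unfolding plane_count_def
  proof (rule card_fibre_le_line_count)
    fix a a' assume "a \<in> S" "a' \<in> S" "dot a u = t" "dot a' u = t"
    then show "\<exists>c. a - a' = c *s v"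
      using v(2) u vP by (intro perp_two_parallel[OF dP uP u(2)[symmetric]])
        (auto simp: S_def proj_line_def dot_commute[of v])
  next
    fix y
    show "line_count S v y \<le> k"
      using line_count_mono[of S E v y] line_count_le[OF v0, of y] by (auto simp: S_def)
  qed
  have cong: "plane_count S u t mod p = plane_count S u t' mod p" for t t'
  proof -
    obtain q where q: "degree q < 2" "\<And>t. of_nat (plane_count S u t) = poly q t"
    proof (rule plane_count_poly[of 2 S u])
      show "moment S j u = 0" if "j + 2 < CARD('p)" for j
        using that k3 by (intro mom) simp
    qed (use kp k2 in auto)
    then have "q = [:coeff q 0, coeff q 1:]"
      by (intro poly_eqI) (auto simp: coeff_pCons coeff_eq_0 split: nat.split)
    then obtain a b where ab: "q = [:a, b:]"
      by blast
    (* otherwise the value \<open>-1\<close> is attained, and the plane count there is at least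
       \<open>p - 1\<close> *)
    have "b = 0"
    proof (rule ccontr)
      assume "b \<noteq> 0"
      then have "(of_nat (plane_count S u ((- 1 - a) / b) + 1) :: 'p mod_ring) = 0"
        by (simp add: q(2) ab)
      then have "CARD('p) dvd plane_count S u ((- 1 - a) / b) + 1"
        by (rule of_nat_0_mod_ring_dvd)
      then show False
        using cell[of "(- 1 - a) / b"] kp by (auto dest: dvd_imp_le)
    qed
    then show ?thesis
      using q(2)[of t] q(2)[of t'] of_nat_mod_ring_eq_iff[of "plane_count S u t" "plane_count S u t'", where 'p='p]
      by (simp add: ab)
  qed
  then have const: "plane_count S u t = plane_count S u t'" for t t'
    using cell[of t] cell[of t'] kp mod_less by (metis add_lessD1 le_less_trans)
  have "card S = p"
    using flat_plane_count[OF d, of "dot e d"] e(1) by (auto simp: S_def plane_count_def)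
  moreover have "card S = p * plane_count S u (dot e u)"
  proof -
    have "equidistributed S u"
      unfolding equidistributed_iff using const by blast
    from equidistributed_plane_count[OF this, of "dot e u"] show ?thesis
      by simp
  qed
  ultimately have "plane_count S u (dot e u) = 1"
    using p_gt_1 by simp
  moreover have "{e, e'} \<subseteq> {a\<in>S. dot a u = dot e u}"
  proof -
    have e': "e = e' + c *s v"
      using e(4) by (simp add: algebra_simps)
    have "dot v d = 0" "dot v u = 0"
      using v(2) u(1) by (auto simp: proj_line_def dot_commute[of v])
    then have "dot e' d = dot e d" "dot e' u = dot e u"
      unfolding e' by simp_all
    then show ?thesis
      using e(1,2) by (simp add: S_def)
  qed
  then have "card {e, e'} \<le> plane_count S u (dot e u)"
    unfolding plane_count_def by (rule card_mono[OF finite])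
  ultimately show False
    using e(3) by simp
qed

text \<open>
  By \<open>tangent_line_count\<close> a section of \<open>A\<close> normal to \<open>x\<close> meets every line of direction \<open>d\<close> in its
  plane, and the plane \<open>dot z v = s\<close> contains such a line.
\<close>

lemma flat_pair_lift:
  assumes x: "x \<in> flat_dirs A" "nonzero_dirs A \<inter> proj_line d = {x}" and d: "d \<in> proj_points"
    and v: "v \<in> dirs E" "v \<in> proj_line d" and y: "y \<in> (\<lambda>a. dot a x) ` A"
  obtains b where "b \<in> A" "dot b x = y" "dot b v = s"
proof -
  interpret dual: spectral_pair A E k p
    by (rule dual)
  have xP: "x \<in> proj_points" and vP: "v \<in> proj_points"
    using x(1) v(1) by (auto simp: flat_dirs_def nonzero_dirs_def dirs_def)
  have "x \<noteq> v"
    using x(1) v(1) dual.dirs_subset_zero by (auto simp: flat_dirs_def nonzero_dirs_def zero_dirs_def)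
  have "card {z. dot z x = y \<and> dot z v = s} = p"
    using card_line[OF proj_points_nonzero[OF xP] proj_points_not_parallel[OF xP vP \<open>x \<noteq> v\<close>]] by simp
  then have "{z. dot z x = y \<and> dot z v = s} \<noteq> {}"
    using p_gt_1 by (intro notI) (simp only: card.empty)
  then obtain z where z: "dot z x = y" "dot z v = s"
    by blast
  have "plane_count A x (dot z x) \<noteq> 0"
    unfolding plane_count_def z(1) using y by auto
  then have "line_count A d z \<noteq> 0"
    using dual.tangent_line_count[OF proj_points_nonzero[OF d] x(2), of z] by auto
  then obtain b c where b: "b \<in> A" "b - z = c *s d"
    unfolding line_count_def by auto
  have bz: "b = z + c *s d"
    using b(2) by (simp add: algebra_simps)
  have "dot d x = 0" "dot d v = 0"
    using x(2) v(2) by (auto simp: proj_line_def dot_commute[of d])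
  then show thesis
    using that[of b] b(1) z unfolding bz by simp
qed

text \<open>
  The set \<open>A\<close> consists of two sections normal to \<open>x\<close>. Let \<open>v\<close> be a direction of \<open>E\<close> normal to \<open>d\<close>. A
  plane normal to \<open>v\<close> meets both sections, and the joining differences have a single direction by
  \<open>flat_pencil_zero\<close>; so one section is a translate of the other by some \<open>\<delta>\<close> orthogonal to \<open>v\<close>. Two
  choices of \<open>v\<close> give different translations, whose difference is a period of a section. Then the
  section contains a line, which has more than \<open>k\<close> points.
\<close>

lemma no_flat_dirs_2:
  assumes k: "k = 2" and p5: "p \<ge> 5"
  shows "flat_dirs E = {}"
proof (rule ccontr)
  interpret dual: spectral_pair A E k p
    by (rule dual)
  assume "flat_dirs E \<noteq> {}"
  then obtain d where d: "d \<in> flat_dirs E"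
    by blast
  obtain x where x: "x \<in> flat_dirs A" "nonzero_dirs A \<inter> proj_line d = {x}"
    by (rule mutual_flat_pair[OF d]) (use k in auto)
  have dP: "d \<in> proj_points"
    using d by (auto simp: flat_dirs_def nonzero_dirs_def)
  have dx: "dot d x = 0"
    using x(2) by (auto simp: proj_line_def dot_commute[of d])
  let ?V = "dirs E \<inter> proj_line d"
  have "card ?V \<ge> p - 1"
    by (rule flat_dirs_ge[OF d]) (simp add: k)
  then have "card ?V \<ge> 2"
    using p5 by linarith
  then obtain v v' where v: "v \<in> ?V" "v' \<in> ?V" "v \<noteq> v'"
    by (rule card_ge_2_obtain)
  obtain y1 y2 where y: "(\<lambda>a. dot a x) ` A = {y1, y2}" "y1 \<noteq> y2"
    using dual.card_flat_values[OF x(1)] k by (auto simp: card_2_iff)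
  define G where "G y = {a\<in>A. dot a x = y}" for y
  have cG: "card (G y) = p" if "y \<in> {y1, y2}" for y
    using dual.flat_plane_count[OF x(1), of y] that unfolding y(1)[symmetric] by (auto simp: G_def plane_count_def)
  have shift: "\<exists>\<delta>. dot \<delta> x = y2 - y1 \<and> dot \<delta> v = 0 \<and> (\<forall>a\<in>G y1. a + \<delta> \<in> G y2)" if v: "v \<in> ?V" for v
  proof -
    have "card (dirs A \<inter> proj_line v) \<le> card (zero_dirs E \<inter> proj_line v)"
      using dirs_subset_zero by (intro card_mono) auto
    then have one: "card (dirs A \<inter> proj_line v) \<le> Suc 0"
      using flat_pencil_zero[OF d, of v] v k p5 by simp
    have pd: "pdir (b - a) \<in> dirs A \<inter> proj_line v" if "a \<in> G y1" "b \<in> G y2" "dot b v = dot a v" for a b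
      using that y(2) pdir_diff_in_dirs[of b A a] pdir_in_proj_line[of "b - a" v] by (auto simp: G_def)
    have "G y1 \<noteq> {}"
      using cG[of y1] p_gt_1 by auto
    then obtain a0 where a0: "a0 \<in> G y1"
      by blast
    obtain b0 where b0: "b0 \<in> A" "dot b0 x = y2" "dot b0 v = dot a0 v"
      by (rule flat_pair_lift[OF x dP, of v y2 "dot a0 v"]) (use v y in auto)
    have "a + (b0 - a0) \<in> G y2" if a: "a \<in> G y1" for a
    proof -
      obtain b where b: "b \<in> A" "dot b x = y2" "dot b v = dot a v"
        by (rule flat_pair_lift[OF x dP, of v y2 "dot a v"]) (use v y in auto)
      have "pdir (b - a) = pdir (b0 - a0)"
        using one pd[of a b] pd[of a0 b0] a a0 b b0 unfolding card_le_Suc0_iff_eq[OF finite] by (auto simp: G_def)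
      moreover have "b - a \<noteq> 0" "b0 - a0 \<noteq> 0"
        using a a0 b b0 y(2) by (auto simp: G_def)
      ultimately obtain c where c: "b - a = c *s (b0 - a0)"
        using pdir_parallel by blast
      have "dot (b - a) x = c * dot (b0 - a0) x"
        unfolding c by (rule dot_scale_left)
      then have "c = 1"
        using a a0 b b0 y(2) by (simp add: G_def)
      then have "a + (b0 - a0) = b"
        using c by (simp add: algebra_simps)
      then show ?thesis
        using b by (simp add: G_def)
    qed
    then show ?thesis
      using a0 b0 by (intro exI[of _ "b0 - a0"]) (simp add: G_def)
  qed
  obtain \<delta> where \<delta>: "dot \<delta> x = y2 - y1" "dot \<delta> v = 0" "\<And>a. a \<in> G y1 \<Longrightarrow> a + \<delta> \<in> G y2"
    using shift[OF v(1)] by blast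
  obtain \<delta>' where \<delta>': "dot \<delta>' v' = 0" "\<And>a. a \<in> G y1 \<Longrightarrow> a + \<delta>' \<in> G y2"
    using shift[OF v(2)] by blast
  have "\<delta> \<noteq> \<delta>'"
  proof
    assume "\<delta> = \<delta>'"
    then obtain c where "\<delta> = c *s d"
      using perp_two_parallel[of v v' d \<delta>] v \<delta>(2) \<delta>'(1) dP by (auto simp: dirs_def proj_line_def dot_commute[of d])
    then show False
      using \<delta>(1) dx y(2) by simp
  qed
  have onto: "(\<lambda>a. a + \<delta>') ` G y1 = G y2"
    using \<delta>'(2) cG[of y1] cG[of y2] by (intro card_subset_eq) (auto simp: card_image inj_on_def)
  have "{a\<in>G y1. a - (\<delta>' - \<delta>) \<notin> G y1} = {}"
  proof -
    have "a - (\<delta>' - \<delta>) \<in> G y1" if a: "a \<in> G y1" for a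
    proof -
      obtain a' where "a' \<in> G y1" "a + \<delta> = a' + \<delta>'"
        using \<delta>(3)[OF a] unfolding onto[symmetric] by blast
      moreover from this have "a - (\<delta>' - \<delta>) = a'"
        by (simp add: algebra_simps)
      ultimately show ?thesis
        by simp
    qed
    then show ?thesis
      by blast
  qed
  moreover have "card (G y1) \<le> k * card {a\<in>G y1. a - (\<delta>' - \<delta>) \<notin> G y1}"
  proof (rule shift_overlap)
    fix z
    show "line_count (G y1) (\<delta>' - \<delta>) z \<le> k"
      using line_count_mono[of "G y1" A "\<delta>' - \<delta>" z] dual.line_count_le[of "\<delta>' - \<delta>" z] \<open>\<delta> \<noteq> \<delta>'\<close>
      by (auto simp: G_def)
  qed (use \<open>\<delta> \<noteq> \<delta>'\<close> kp in auto)
  ultimately have "card (G y1) = 0"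
    by (simp only: card.empty mult_0_right le_0_eq)
  then show False
    using cG[of y1] p_gt_1 by simp
qed

text \<open>
  The set \<open>A\<close> consists of three sections of seven points. Let \<open>v\<close> be a direction of \<open>E\<close> normal to
  \<open>d\<close>. The points of \<open>A\<close> in a plane normal to \<open>v\<close> determine at most two directions by
  \<open>flat_pencil_zero\<close>, so points \<open>a\<close>, \<open>b\<close> of the first two sections are collinear with one of the
  third; its position is given by a ratio \<open>r\<close> that depends on the sections only. At least six
  directions \<open>v\<close> are available, so for each \<open>b\<close> this happens for all but one point \<open>a\<close>. Two choices
  of \<open>b\<close> then make the first section meet a translate of itself in five points, while
  \<open>shift_overlap\<close> allows four.
\<close>

lemma no_flat_dirs_3:
  assumes k: "k = 3" and p7: "p = 7"
  shows "flat_dirs E = {}"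
proof (rule ccontr)
  interpret dual: spectral_pair A E k p
    by (rule dual)
  assume "flat_dirs E \<noteq> {}"
  then obtain d where d: "d \<in> flat_dirs E"
    by blast
  obtain x where x: "x \<in> flat_dirs A" "nonzero_dirs A \<inter> proj_line d = {x}"
    by (rule mutual_flat_pair[OF d]) (use k p7 in auto)
  have dP: "d \<in> proj_points"
    using d by (auto simp: flat_dirs_def nonzero_dirs_def)
  have dx: "dot d x = 0"
    using x(2) by (auto simp: proj_line_def dot_commute[of d])
  let ?V = "dirs E \<inter> proj_line d"
  have V6: "card ?V \<ge> 6"
    using flat_dirs_ge[OF d] k p7 by simp
  obtain y1 y2 y3 where y: "(\<lambda>a. dot a x) ` A = {y1, y2, y3}" "y1 \<noteq> y2" "y2 \<noteq> y3" "y1 \<noteq> y3"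
    using dual.card_flat_values[OF x(1)] k by (auto simp: card_3_iff)
  define G where "G y = {a\<in>A. dot a x = y}" for y
  have cG: "card (G y) = 7" if "y \<in> {y1, y2, y3}" for y
    using dual.flat_plane_count[OF x(1), of y] that p7 unfolding y(1)[symmetric]
    by (auto simp: G_def plane_count_def)
  (* the position of the third section between the first two, seen along \<open>x\<close> *)
  define r where "r = (y3 - y1) / (y2 - y1)"
  have r: "r \<noteq> 0" "1 - r \<noteq> 0"
    using y(2-4) by (auto simp: r_def field_simps)
  have third: "a + r *s (b - a) \<in> G y3" if v: "v \<in> ?V" and ab: "a \<in> G y1" "b \<in> G y2" "dot b v = dot a v" for v a b
  proof -
    obtain c where c: "c \<in> A" "dot c x = y3" "dot c v = dot a v"
      by (rule flat_pair_lift[OF x dP, of v y3 "dot a v"]) (use v y in auto)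
    have ne: "a \<noteq> b" "a \<noteq> c" "b \<noteq> c"
      using ab c y(2-4) by (auto simp: G_def)
    have "\<not> independent2 (b - a) (c - a)"
    proof
      assume ind: "independent2 (b - a) (c - a)"
      have "pdir (z - w) \<in> dirs A \<inter> proj_line v" if "z \<in> {a, b, c}" "w \<in> {a, b, c}" "z \<noteq> w" for z w
        using that ab c pdir_diff_in_dirs[of z A w] pdir_in_proj_line[of "z - w" v] by (auto simp: G_def)
      then have "{pdir (b - a), pdir (c - a), pdir (c - a - (b - a))} \<subseteq> dirs A \<inter> proj_line v"
        using ne by simp
      then have "3 \<le> card (dirs A \<inter> proj_line v)"
        using triangle_pdirs[OF ind] card_mono[of "dirs A \<inter> proj_line v"] by (metis finite)
      also have "\<dots> \<le> card (zero_dirs E \<inter> proj_line v)"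
        using dirs_subset_zero by (intro card_mono) auto
      finally show False
        using flat_pencil_zero[OF d, of v] v k p7 by simp
    qed
    then obtain s where s: "c - a = s *s (b - a)"
      using independent2I[of "b - a" "c - a"] ne(1) by auto
    have "dot (c - a) x = s * dot (b - a) x"
      unfolding s by (rule dot_scale_left)
    then have "s = r"
      using ab c y(2) by (simp add: r_def G_def field_simps)
    then have "a + r *s (b - a) = c"
      using s by (simp add: algebra_simps)
    then show ?thesis
      using c by (simp add: G_def)
  qed
  define B where "B b = {a\<in>G y1. a + r *s (b - a) \<in> G y3}" for b
  have B6: "card (B b) \<ge> 6" if b: "b \<in> G y2" for b
  proof -
    have "\<forall>v\<in>?V. \<exists>a. a \<in> G y1 \<and> dot b v = dot a v"
    proof
      fix v assume v: "v \<in> ?V"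
      obtain a where "a \<in> A" "dot a x = y1" "dot a v = dot b v"
        by (rule flat_pair_lift[OF x dP, of v y1 "dot b v"]) (use v y in auto)
      then show "\<exists>a. a \<in> G y1 \<and> dot b v = dot a v"
        by (intro exI[of _ a]) (simp add: G_def)
    qed
    then obtain f where f: "\<And>v. v \<in> ?V \<Longrightarrow> f v \<in> G y1 \<and> dot b v = dot (f v) v"
      using bchoice[of ?V "\<lambda>v a. a \<in> G y1 \<and> dot b v = dot a v"] by blast
    have "inj_on f ?V"
    proof (rule inj_onI, rule ccontr)
      fix v v' assume v: "v \<in> ?V" "v' \<in> ?V" "f v = f v'" "v \<noteq> v'"
      have "\<exists>c. b - f v = c *s d"
      proof (rule perp_two_parallel)
        show "v \<in> proj_points" "v' \<in> proj_points" "v \<noteq> v'" "d \<in> proj_line v" "d \<in> proj_line v'"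
          using v dP by (auto simp: dirs_def proj_line_def dot_commute[of d])
        show "dot (b - f v) v = 0" "dot (b - f v) v' = 0"
          using f[OF v(1)] f[OF v(2)] v(3) by simp_all
      qed
      then obtain c where c: "b - f v = c *s d"
        by blast
      have "dot (b - f v) x = 0"
        unfolding c using dx by simp
      then show False
        using f[OF v(1)] b y(2) by (simp add: G_def)
    qed
    moreover have "f ` ?V \<subseteq> B b"
      using f third b by (auto simp: B_def)
    ultimately have "card ?V \<le> card (B b)"
      by (rule card_inj_on_le) simp
    then show ?thesis
      using V6 by simp
  qed
  have "card (G y2) \<ge> 2"
    using cG[of y2] by simp
  then obtain b b' where b: "b \<in> G y2" "b' \<in> G y2" "b \<noteq> b'"
    by (rule card_ge_2_obtain)
  let ?f = "\<lambda>b a. a + r *s (b - a)"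
  have f_eq: "?f b a = (1 - r) *s a + r *s b" for a b
    by (simp add: vector_sub_rdistrib vector_ssub_ldistrib algebra_simps)
  have inj: "inj (?f b)" for b
  proof (rule injI)
    fix a a' assume "?f b a = ?f b a'"
    then have "(1 - r) *s a = (1 - r) *s a'"
      unfolding f_eq by (simp only: add_right_cancel)
    then have "(1 - r) *s (a - a') = 0"
      by (simp only: vector_ssub_ldistrib diff_self)
    then have "1 - r = 0 \<or> a - a' = 0"
      by (simp only: scale_eq_0_iff)
    then show "a = a'"
      using r(2) by simp
  qed
  have img: "card (?f b ` B b) \<ge> 6" "?f b ` B b \<subseteq> G y3" if "b \<in> G y2" for b
    using B6[OF that] inj[of b] by (auto simp: B_def card_image inj_on_subset)
  have "card (?f b ` B b \<union> ?f b' ` B b') \<le> card (G y3)"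
    using img(2)[OF b(1)] img(2)[OF b(2)] by (intro card_mono) simp_all
  then have common: "card (?f b ` B b \<inter> ?f b' ` B b') \<ge> 5"
    using img(1)[OF b(1)] img(1)[OF b(2)] card_Un_Int[of "?f b ` B b" "?f b' ` B b'"] cG[of y3] by simp
  (* the images of \<open>a\<close> under \<open>b\<close> and of \<open>a'\<close> under
     \<open>b'\<close> coincide iff \<open>a - a' = \<eta>\<close> *)
  define \<eta> where "\<eta> = (r / (1 - r)) *s (b' - b)"
  have \<eta>0: "\<eta> \<noteq> 0"
    using r b(3) by (simp add: \<eta>_def)
  have "?f b ` B b \<inter> ?f b' ` B b' \<subseteq> ?f b ` {a\<in>G y1. a - \<eta> \<in> G y1}"
  proof
    fix z assume "z \<in> ?f b ` B b \<inter> ?f b' ` B b'"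
    then obtain a a' where a: "a \<in> B b" "z = ?f b a" "a' \<in> B b'" "z = ?f b' a'"
      by blast
    have "(1 - r) *s (a - a') = r *s (b' - b)"
      using a(2,4) unfolding f_eq by (simp add: vector_ssub_ldistrib algebra_simps)
    then have "(1 / (1 - r)) *s ((1 - r) *s (a - a')) = (1 / (1 - r)) *s (r *s (b' - b))"
      by (simp only:)
    moreover have "1 / (1 - r) * (1 - r) = 1" "1 / (1 - r) * r = r / (1 - r)"
      using r(2) by simp_all
    ultimately have "a - a' = \<eta>"
      by (simp only: vector_smult_assoc vector_smult_lid \<eta>_def)
    then have "a - \<eta> = a'"
      by (simp add: algebra_simps)
    then show "z \<in> ?f b ` {a\<in>G y1. a - \<eta> \<in> G y1}"
      using a by (auto simp: B_def)
  qed
  then have "card (?f b ` B b \<inter> ?f b' ` B b') \<le> card {a\<in>G y1. a - \<eta> \<in> G y1}"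
    by (rule surj_card_le[rotated]) simp
  then have good: "card {a\<in>G y1. a - \<eta> \<in> G y1} \<ge> 5"
    using common by simp
  have "G y1 = {a\<in>G y1. a - \<eta> \<in> G y1} \<union> {a\<in>G y1. a - \<eta> \<notin> G y1}"
    by blast
  then have "card (G y1) = card {a\<in>G y1. a - \<eta> \<in> G y1} + card {a\<in>G y1. a - \<eta> \<notin> G y1}"
    by (subst card_Un_disjoint[symmetric]) auto
  moreover have "card (G y1) \<le> k * card {a\<in>G y1. a - \<eta> \<notin> G y1}"
  proof (rule shift_overlap[OF \<eta>0])
    fix z
    show "line_count (G y1) \<eta> z \<le> k"
      using line_count_mono[of "G y1" A \<eta> z] dual.line_count_le[OF \<eta>0, of z] by (auto simp: G_def)
  qed (use kp in simp)
  ultimately show False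
    using good cG[of y1] k by simp
qed

lemma line_ge_3:
  assumes "flat_dirs E = {}" "v \<noteq> 0"
  shows "card (nonzero_dirs E \<inter> proj_line v) \<ge> 3"
  using line_dichotomy[OF assms(2)] assms(1) nonzero_on_line[OF assms(2)] by auto

end

abbreviation "digits7 \<equiv> [0, 1, 2, 3, 4, 5, 6 :: nat]"

section \<open>Plane counts modulo seven\<close>

text \<open>
  The residues \<open>c + a * x\<^sup>2\<close>: up to an affine change of variable, the values of an arbitrary
  polynomial of degree two.
\<close>

definition quadratic_values :: "nat \<Rightarrow> nat \<Rightarrow> nat list"
  where "quadratic_values a c = map (\<lambda>i. (c + a * i\<^sup>2) mod 7) digits7"

text \<open>
  A bound for the number of full lines, with three points each, in two given directions among \<open>n \<le>
  7\<close> points of a plane; see \<open>section_units_bound\<close>.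
\<close>

definition section_units :: "nat \<Rightarrow> nat"
  where "section_units n = (if n < 3 then 0 else if n < 5 then 1 else if n < 7 then 2 else 3)"

text \<open>
  The entries of \<open>r\<close> are plane counts modulo \<open>7\<close>. A count \<open>7\<close> appears as the entry \<open>0\<close>, and for a
  set of \<open>21\<close> points the number of these counts is \<open>(21 - sum_list r) / 7\<close>. So the two inequalities
  bound the sum of squares by \<open>105\<close> and the sum of \<open>section_units\<close> by \<open>7\<close>, with the contributions
  \<open>49\<close> and \<open>3\<close> of each count \<open>7\<close> added.
\<close>

definition admissible_profile :: "nat list \<Rightarrow> bool"
  where "admissible_profile r \<longleftrightarrow> list_ex odd r \<and>
    (sum_list r \<le> 21 \<longrightarrow>
      sum_list (map (\<lambda>x. x * x) r) + 7 * (21 - sum_list r) \<le> 105 \<and>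
      7 * sum_list (map section_units r) + 3 * (21 - sum_list r) \<le> 49)"

lemma admissible_quadratic_values:
  "list_all (\<lambda>a. list_all (\<lambda>c. admissible_profile (quadratic_values a c)) digits7) [1, 2, 3, 4, 5, 6]"
  by code_simp

lemma admissible_digits7: "admissible_profile digits7"
  by (simp add: admissible_profile_def section_units_def)

lemma nth_quadratic_values: "i < 7 \<Longrightarrow> quadratic_values a c ! i = (c + a * i\<^sup>2) mod 7"
proof -
  assume "i < 7"
  have digits: "digits7 = [0..<7]"
    by (simp add: upt_rec)
  show ?thesis
    unfolding quadratic_values_def digits using \<open>i < 7\<close> by (subst nth_map) simp_all
qed

lemma nth_digits7: "i < 7 \<Longrightarrow> digits7 ! i = i"
proof -
  assume "i < 7"
  have "digits7 = [0..<7]"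
    by (simp add: upt_rec)
  then show ?thesis
    using \<open>i < 7\<close> by (simp only: nth_upt)
qed

text \<open>
  An affine change of variable, which permutes the planes, brings a polynomial of degree at most two
  to the form \<open>t\<close> or \<open>c + a * t\<^sup>2\<close>. A constant polynomial is excluded by the nonzero moment.
\<close>

lemma plane_count_profile:
  fixes S :: "('p::prime_card mod_ring ^ 'd::finite) set"
  assumes p7: "CARD('p) = 7" and q: "degree q < 3" "\<And>t. of_nat (plane_count S d t) = poly q t"
    and nonconst: "j + 1 < CARD('p)" "moment S j d \<noteq> 0"
  shows "\<exists>m r. (\<forall>i<7. \<exists>t. m i = plane_count S d t) \<and>
    (\<forall>F :: nat \<Rightarrow> nat. (\<Sum>t\<in>UNIV. F (plane_count S d t)) = (\<Sum>i<7. F (m i))) \<and>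
    (\<forall>i<7. m i mod 7 = r ! i) \<and> length r = 7 \<and> admissible_profile r \<and> (degree q < 2 \<longrightarrow> r = digits7)"
proof -
  let ?n = "plane_count S d"
  define q0 q1 q2 where "q0 = coeff q 0" "q1 = coeff q 1" "q2 = coeff q 2"
  have "q = [:q0, q1, q2:]"
    using q(1) by (intro poly_eqI) (auto simp: q0_q1_q2_def coeff_pCons coeff_eq_0 numeral_2_eq_2 split: nat.split)
  then have pq: "poly q t = q0 + q1 * t + q2 * t\<^sup>2" for t
    by (simp add: algebra_simps power2_eq_square)
  have sum_reindex: "(\<Sum>t\<in>UNIV. F (?n t)) = (\<Sum>i<7. F (?n (g (of_nat i))))" if "bij g"
    for F :: "nat \<Rightarrow> nat" and g :: "'p mod_ring \<Rightarrow> 'p mod_ring"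
  proof -
    have "(\<Sum>t\<in>UNIV. F (?n t)) = (\<Sum>s\<in>UNIV. F (?n (g s)))"
      using sum.reindex_bij_betw[OF that, of "\<lambda>t. F (?n t)"] by simp
    then show ?thesis
      by (simp add: sum_mod_ring_of_nat p7)
  qed
  have residue: "?n t mod 7 = b mod 7" if "poly q t = of_nat b" for t b
    using of_nat_mod_ring_eq_iff[of "?n t" b, where 'p='p] q(2)[of t] that p7 by simp
  show ?thesis
  proof (cases "q2 = 0")
    case True
    have "q1 \<noteq> 0"
    proof
      assume "q1 = 0"
      then have "of_nat (?n t) = q0" for t
        using q(2)[of t] True by (simp add: pq)
      then have "moment S j d = q0 * (\<Sum>t\<in>UNIV. t ^ j)"
        by (simp add: moment_plane_count sum_distrib_left)
      then show False
        using sum_powers_mod_ring[OF nonconst(1)] nonconst(2) by simp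
    qed
    let ?g = "\<lambda>s. (s - q0) / q1"
    have "bij ?g"
      using \<open>q1 \<noteq> 0\<close> by (intro o_bij[of "\<lambda>t. q0 + q1 * t"]) (auto simp: fun_eq_iff)
    show ?thesis
    proof (intro exI[of _ "\<lambda>i. ?n (?g (of_nat i))"] exI[of _ digits7] conjI allI impI)
      fix i :: nat assume "i < 7"
      have "poly q (?g (of_nat i)) = of_nat i"
        using \<open>q1 \<noteq> 0\<close> True by (simp add: pq)
      then show "?n (?g (of_nat i)) mod 7 = digits7 ! i"
        using residue[of "?g (of_nat i)" i] \<open>i < 7\<close> nth_digits7[of i] by simp
    qed (use sum_reindex[OF \<open>bij ?g\<close>] admissible_digits7 in auto)
  next
    case False
    have two: "(2 :: 'p mod_ring) \<noteq> 0"
      using of_nat_mod_ring_eq_iff[of 2 0, where 'p='p] p7 by simp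
    have four: "(4 :: 'p mod_ring) \<noteq> 0"
      using of_nat_mod_ring_eq_iff[of 4 0, where 'p='p] p7 by simp
    define h where "h = - q1 / (2 * q2)"
    have square: "poly q (h + s) = (q0 - q1\<^sup>2 / (4 * q2)) + q2 * s\<^sup>2" for s
    proof -
      have h2: "q2 * h * 2 = - q1"
        using two False by (simp add: h_def)
      have "q2 * h\<^sup>2 * 4 * q2 = q1\<^sup>2"
      proof -
        have "q2 * h\<^sup>2 * 4 * q2 = (q2 * h * 2)\<^sup>2"
          by (simp add: power2_eq_square)
        then show ?thesis
          by (simp add: h2)
      qed
      then have hh: "q2 * h\<^sup>2 = q1\<^sup>2 / (4 * q2)"
        using four False by (simp add: field_simps)
      have "q1 * h = - 2 * (q2 * h\<^sup>2)"
        using h2 by (simp add: power2_eq_square algebra_simps)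
      moreover have "poly q (h + s) = q0 + (q1 * h + q2 * h\<^sup>2) + (q1 + q2 * h * 2) * s + q2 * s\<^sup>2"
        by (simp add: pq power2_eq_square algebra_simps)
      ultimately show ?thesis
        by (simp add: h2 hh)
    qed
    obtain a where a: "a < 7" "q2 = of_nat a"
      using surj_of_nat_mod_ring[of q2] p7 by auto
    obtain c where c: "c < 7" "q0 - q1\<^sup>2 / (4 * q2) = of_nat c"
      using surj_of_nat_mod_ring[of "q0 - q1\<^sup>2 / (4 * q2)"] p7 by auto
    have "a \<noteq> 0"
      using a(2) False by (intro notI) simp
    have bij: "bij (\<lambda>s. h + s)"
      by (intro o_bij[of "\<lambda>t. t - h"]) (auto simp: fun_eq_iff)
    show ?thesis
    proof (intro exI[of _ "\<lambda>i. ?n (h + of_nat i)"] exI[of _ "quadratic_values a c"] conjI allI impI)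
      fix i :: nat assume "i < 7"
      have "poly q (h + of_nat i) = of_nat (c + a * i\<^sup>2)"
        by (simp add: square c(2)[symmetric] a(2))
      then show "?n (h + of_nat i) mod 7 = quadratic_values a c ! i"
        using residue \<open>i < 7\<close> by (simp add: nth_quadratic_values)
    next
      have "a \<in> set [1, 2, 3, 4, 5, 6]"
        using a(1) \<open>a \<noteq> 0\<close> by auto
      moreover have "c \<in> set digits7"
        using c(1) by auto
      ultimately show "admissible_profile (quadratic_values a c)"
        using admissible_quadratic_values unfolding list_all_iff by blast
    next
      assume "degree q < 2"
      then have "q2 = 0"
        by (simp add: q0_q1_q2_def coeff_eq_0)
      then show "quadratic_values a c = digits7"
        using False by simp
    qed (use sum_reindex[OF bij] in \<open>auto simp: quadratic_values_def\<close>)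
  qed
qed

context spectral_pair
begin

text \<open>
  Plane counts are at most \<open>7\<close>, so they are determined by their residues, except that the residue
  \<open>0\<close> stands for \<open>0\<close> or \<open>7\<close>.
\<close>

lemma high_plane_count_profile:
  assumes p7: "p = 7" and d: "d \<in> high_dirs E 1" "d \<notin> high_dirs E s" and s: "1 \<le> s" "s \<le> 3"
  shows "\<exists>m r. (\<forall>i<7. \<exists>t. m i = plane_count E d t) \<and>
    (\<forall>F :: nat \<Rightarrow> nat. (\<Sum>t\<in>UNIV. F (plane_count E d t)) = (\<Sum>i<7. F (m i))) \<and>
    (\<forall>i<7. m i = r ! i \<or> r ! i = 0 \<and> m i = 7) \<and> length r = 7 \<and> admissible_profile r \<and>
    (s \<le> 2 \<longrightarrow> r = digits7)"
proof -
  have dP: "d \<in> proj_points"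
    using d(1) by (simp add: high_dirs_def)
  obtain j where j: "j + 1 < CARD('p)" "moment E j d \<noteq> 0"
    using d(1) unfolding high_dirs_def by blast
  have zero: "moment E j d = 0" if "j + s < CARD('p)" for j
    using d(2) dP that unfolding high_dirs_def by blast
  obtain q where q: "degree q < s" "\<And>t. of_nat (plane_count E d t) = poly q t"
    by (rule plane_count_poly[of s E d]) (use s p7 zero in auto)
  have c7: "CARD('p) = 7"
    by (simp add: p7)
  have q3: "degree q < 3"
    using q(1) s by simp
  obtain m r where mr: "\<And>i. i < 7 \<Longrightarrow> \<exists>t. m i = plane_count E d t"
    "\<And>F :: nat \<Rightarrow> nat. (\<Sum>t\<in>UNIV. F (plane_count E d t)) = (\<Sum>i<7. F (m i))"
    "\<And>i. i < 7 \<Longrightarrow> m i mod 7 = r ! i" "length r = 7" "admissible_profile r" "degree q < 2 \<Longrightarrow> r = digits7"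
    using plane_count_profile[OF c7 q3 q(2) j] by auto
  have "m i = r ! i \<or> r ! i = 0 \<and> m i = 7" if i: "i < 7" for i
  proof -
    obtain t where "m i = plane_count E d t"
      using mr(1)[OF i] by blast
    then have "m i \<le> 7"
      using plane_count_le[OF proj_points_nonzero[OF dP], of t] p7 by simp
    then show ?thesis
      using mr(3)[OF i] by (cases "m i = 7") auto
  qed
  moreover have "r = digits7" if "s \<le> 2"
    using mr(6) q(1) that by simp
  ultimately show ?thesis
    using mr(1,2,4,5) by blast
qed

text \<open>
  The residues are \<open>0, \<dots>, 6\<close>, with sum \<open>21\<close>; so a set of \<open>14\<close> points cannot have them and a set of
  \<open>21\<close> points has them as plane counts.
\<close>

lemma linear_plane_count:
  assumes p7: "p = 7" and d: "d \<in> high_dirs E 1" "d \<notin> high_dirs E 2"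
  shows "k \<noteq> 2" "k = 3 \<Longrightarrow> (\<Sum>t\<in>UNIV. (plane_count E d t)\<^sup>2) = 91"
proof -
  obtain m r where mr: "\<And>i. i < 7 \<Longrightarrow> \<exists>t. m i = plane_count E d t"
    "\<And>F :: nat \<Rightarrow> nat. (\<Sum>t\<in>UNIV. F (plane_count E d t)) = (\<Sum>i<7. F (m i))"
    "\<And>i. i < 7 \<Longrightarrow> m i = r ! i \<or> r ! i = 0 \<and> m i = 7" "length r = 7" "admissible_profile r" "r = digits7"
    using high_plane_count_profile[OF p7 d] by auto
  note r = mr(6)
  have m: "m 0 = 0 \<or> m 0 = 7" "m 1 = 1" "m 2 = 2" "m 3 = 3" "m 4 = 4" "m 5 = 5" "m 6 = 6"
    using mr(3)[of 0] mr(3)[of 1] mr(3)[of 2] mr(3)[of 3] mr(3)[of 4] mr(3)[of 5] mr(3)[of 6]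
    unfolding r by simp_all
  have seven: "(\<Sum>i<7. F (m i)) = F (m 0) + F 1 + F 2 + F 3 + F 4 + F 5 + F 6" for F :: "nat \<Rightarrow> nat"
  proof -
    have "{..<7::nat} = {0, 1, 2, 3, 4, 5, 6}"
      by auto
    then show ?thesis
      using m by (simp del: One_nat_def)
  qed
  have total: "k * 7 = m 0 + 21"
    using mr(2)[of "\<lambda>n. n"] seven[of "\<lambda>n. n"] sum_plane_count[of E d] card_E p7 by simp
  then show "k \<noteq> 2"
    by auto
  show "(\<Sum>t\<in>UNIV. (plane_count E d t)\<^sup>2) = 91" if "k = 3"
    using mr(2)[of "\<lambda>n. n\<^sup>2"] seven[of "\<lambda>n. n\<^sup>2"] total that by simp
qed

lemma quadratic_plane_count:
  assumes p7: "p = 7" and d: "d \<in> high_dirs E 1" "d \<notin> high_dirs E 3"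
  shows "\<exists>t. odd (plane_count E d t)"
    and "k = 3 \<Longrightarrow> (\<Sum>t\<in>UNIV. (plane_count E d t)\<^sup>2) \<le> 105"
    and "k = 3 \<Longrightarrow> (\<Sum>t\<in>UNIV. section_units (plane_count E d t)) \<le> 7"
proof -
  obtain m r where mr: "\<And>i. i < 7 \<Longrightarrow> \<exists>t. m i = plane_count E d t"
    "\<And>F :: nat \<Rightarrow> nat. (\<Sum>t\<in>UNIV. F (plane_count E d t)) = (\<Sum>i<7. F (m i))"
    "\<And>i. i < 7 \<Longrightarrow> m i = r ! i \<or> r ! i = 0 \<and> m i = 7" "length r = 7" "admissible_profile r"
    using high_plane_count_profile[OF p7 d] by auto
  have lists: "sum_list (map F r) = (\<Sum>i<7. F (r ! i))" for F :: "nat \<Rightarrow> nat"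
    by (simp add: sum_list_sum_nth mr(4) atLeast0LessThan)
  have "list_ex odd r"
    using mr(5) by (simp add: admissible_profile_def)
  then obtain i where i: "i < 7" "odd (r ! i)"
    using mr(4) by (auto simp: list_ex_length)
  then have "m i = r ! i"
    using mr(3)[OF i(1)] by auto
  then show "\<exists>t. odd (plane_count E d t)"
    using i mr(1)[OF i(1)] by metis
  assume k: "k = 3"
  have sum21: "(\<Sum>i<7. m i) = 21"
    using mr(2)[of "\<lambda>n. n"] sum_plane_count[of E d] card_E p7 k by simp
  have "(\<Sum>i<7. r ! i) \<le> (\<Sum>i<7. m i)"
    using mr(3) by (intro sum_mono) fastforce
  then have le21: "(\<Sum>i<7. r ! i) \<le> 21"
    by (simp add: sum21)
  have adm: "(\<Sum>i<7. r ! i * r ! i) + 7 * (21 - (\<Sum>i<7. r ! i)) \<le> 105"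
    "7 * (\<Sum>i<7. section_units (r ! i)) + 3 * (21 - (\<Sum>i<7. r ! i)) \<le> 49"
    using mr(5) le21 lists[of "\<lambda>x. x"] lists[of "\<lambda>x. x * x"] lists[of section_units]
    by (simp_all add: admissible_profile_def)
  (* both sides agree termwise: a count \<open>7\<close> with residue \<open>0\<close> gives
     \<open>49\<close> on either side *)
  have "(\<Sum>i<7. (m i)\<^sup>2 + 7 * r ! i) = (\<Sum>i<7. r ! i * r ! i + 7 * m i)"
  proof (rule sum.cong[OF refl])
    fix i :: nat assume "i \<in> {..<7}"
    then show "(m i)\<^sup>2 + 7 * r ! i = r ! i * r ! i + 7 * m i"
      using mr(3)[of i] by (auto simp: power2_eq_square)
  qed
  then have "(\<Sum>i<7. (m i)\<^sup>2) + 7 * (\<Sum>i<7. r ! i) = (\<Sum>i<7. r ! i * r ! i) + 7 * 21"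
    by (simp only: sum.distrib sum21 flip: sum_distrib_left)
  then show "(\<Sum>t\<in>UNIV. (plane_count E d t)\<^sup>2) \<le> 105"
    using adm(1) le21 mr(2)[of "\<lambda>n. n\<^sup>2"] by linarith
  have "(\<Sum>i<7. 7 * section_units (m i) + 3 * r ! i) = (\<Sum>i<7. 7 * section_units (r ! i) + 3 * m i)"
  proof (rule sum.cong[OF refl])
    fix i :: nat assume "i \<in> {..<7}"
    then show "7 * section_units (m i) + 3 * r ! i = 7 * section_units (r ! i) + 3 * m i"
      using mr(3)[of i] by (auto simp: section_units_def)
  qed
  then have "7 * (\<Sum>i<7. section_units (m i)) + 3 * (\<Sum>i<7. r ! i) = 7 * (\<Sum>i<7. section_units (r ! i)) + 3 * 21"
    by (simp only: sum.distrib sum21 flip: sum_distrib_left)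
  then show "(\<Sum>t\<in>UNIV. section_units (plane_count E d t)) \<le> 7"
    using adm(2) le21 mr(2)[of section_units] by linarith
qed

end

section \<open>Lines with few zeros\<close>

lemma quadratic_line_sum:
  fixes X :: "'p::prime_card space3 set" and a b :: int
  assumes "X \<subseteq> proj_points"
  shows "(\<Sum>v\<in>proj_points. (int (card (X \<inter> proj_line v)) - a) * (int (card (X \<inter> proj_line v)) - b)) =
    int (card X) * (int (card X) + int CARD('p)) - (a + b) * (int CARD('p) + 1) * int (card X)
    + a * b * ((int CARD('p))\<^sup>2 + int CARD('p) + 1)"
proof -
  let ?z = "\<lambda>v. card (X \<inter> proj_line v)"
  have squares: "(\<Sum>v\<in>proj_points. (int (?z v))\<^sup>2) = int (card X) * (int (card X) + int CARD('p))"
    using arg_cong[OF sum_lines_card_squared[OF assms], of int] by simp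
  have linear: "(\<Sum>v\<in>proj_points. int (?z v)) = (int CARD('p) + 1) * int (card X)"
    using arg_cong[OF sum_lines_card[OF assms], of int] by (simp add: algebra_simps)
  have "(\<Sum>v\<in>proj_points. (int (?z v) - a) * (int (?z v) - b)) =
      (\<Sum>v\<in>proj_points. (int (?z v))\<^sup>2 - (a + b) * int (?z v) + a * b)"
    by (intro sum.cong) (auto simp: algebra_simps power2_eq_square)
  also have "\<dots> = (\<Sum>v\<in>proj_points. (int (?z v))\<^sup>2) - (a + b) * (\<Sum>v\<in>proj_points. int (?z v))
      + a * b * int (card (proj_points :: 'p space3 set))"
    by (simp add: sum.distrib sum_subtractf sum_distrib_left)
  also have "\<dots> = int (card X) * (int (card X) + int CARD('p)) - (a + b) * (int CARD('p) + 1) * int (card X)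
    + a * b * ((int CARD('p))\<^sup>2 + int CARD('p) + 1)"
    by (simp add: squares linear card_proj_points algebra_simps)
  finally show ?thesis .
qed

text \<open>
  The left-hand side is the sum of \<open>(z - a) * (z - b)\<close> over all lines, \<open>z\<close> being the number of
  points of \<open>X\<close> on the line; only the lines in \<open>W\<close> contribute positive terms.
\<close>

lemma quadratic_line_bound:
  fixes X :: "'p::prime_card space3 set" and a b :: int
  assumes X: "X \<subseteq> proj_points"
    and between: "\<And>v. v \<in> proj_points \<Longrightarrow> v \<notin> W \<Longrightarrow> a \<le> int (card (X \<inter> proj_line v)) \<and> int (card (X \<inter> proj_line v)) \<le> b"
    and except: "\<And>v. v \<in> W \<Longrightarrow> (int (card (X \<inter> proj_line v)) - a) * (int (card (X \<inter> proj_line v)) - b) \<le> int c"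
    and W: "card W \<le> w" "W \<subseteq> proj_points"
  shows "int (card X) * (int (card X) + int CARD('p)) - (a + b) * (int CARD('p) + 1) * int (card X)
    + a * b * ((int CARD('p))\<^sup>2 + int CARD('p) + 1) \<le> int (w * c)"
proof -
  let ?f = "\<lambda>v. (int (card (X \<inter> proj_line v)) - a) * (int (card (X \<inter> proj_line v)) - b)"
  have "sum ?f (proj_points - W) \<le> 0"
    using between by (intro sum_nonpos mult_nonneg_nonpos) auto
  moreover have "sum ?f W \<le> (\<Sum>v\<in>W. int c)"
    using except by (intro sum_mono) auto
  moreover have "(\<Sum>v\<in>W. int c) \<le> int (w * c)"
    using W(1) by (simp add: mult_right_mono)
  moreover have "sum ?f proj_points = sum ?f (proj_points - W) + sum ?f W"
    using W(2) by (intro sum.subset_diff) auto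
  ultimately show ?thesis
    using quadratic_line_sum[OF X, of a b] by linarith
qed

text \<open>
  Each further line meets the union of the previous ones in at most as many points as there are
  previous lines.
\<close>

lemma card_Union_lines:
  fixes W :: "'p::prime_card space3 set"
  assumes "W \<subseteq> proj_points"
  shows "card W * (2 * (CARD('p) + 1)) \<le> 2 * card (\<Union>v\<in>W. proj_line v) + card W * (card W - 1)"
proof -
  have "finite W"
    by simp
  then show ?thesis
    using assms
  proof (induction W rule: finite_induct)
    case empty
    then show ?case
      by simp
  next
    case (insert w W)
    let ?U = "\<Union>v\<in>W. proj_line v"
    have "card (?U \<inter> proj_line w) \<le> (\<Sum>v\<in>W. card (proj_line v \<inter> proj_line w))"
      using card_UN_le[of W "\<lambda>v. proj_line v \<inter> proj_line w"] by (simp add: Int_UN_distrib2)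
    also have "\<dots> = card W"
      using insert by (subst sum.cong[OF refl card_proj_line_Int_points]) auto
    finally have "card (?U \<inter> proj_line w) \<le> card W" .
    moreover have "card ?U + card (proj_line w) = card (?U \<union> proj_line w) + card (?U \<inter> proj_line w)"
      by (intro card_Un_Int) auto
    moreover have "card (proj_line w) = CARD('p) + 1"
      using insert by (intro card_proj_line proj_points_nonzero) auto
    moreover have "(\<Union>v\<in>insert w W. proj_line v) = ?U \<union> proj_line w"
      by auto
    moreover have "card (insert w W) = Suc (card W)"
      using insert by simp
    moreover have "card W * (card W - 1) + 2 * card W = Suc (card W) * card W"
      by (cases "card W") auto
    ultimately show ?case
      using insert.IH insert.prems by (simp add: algebra_simps)
  qed
qed

lemma obtain_joining_line:
  fixes x d :: "'p::prime_card space3"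
  assumes "x \<in> proj_points" "d \<in> proj_points"
  obtains v where "v \<in> proj_line x" "v \<in> proj_line d"
proof -
  have "card (proj_line x \<inter> proj_line d) > 0"
  proof (cases "x = d")
    case True
    then show ?thesis
      using card_proj_line[OF proj_points_nonzero[OF assms(1)]] by simp
  next
    case False
    then show ?thesis
      using card_proj_line_Int_points[OF assms] by simp
  qed
  then show thesis
    using that by (auto simp: card_gt_0_iff)
qed

text \<open>
  The lines through a point of \<open>high_dirs E s\<close> cover the plane, and each contains at least \<open>s + 2\<close>
  points of that set.
\<close>

lemma card_points_off_high:
  fixes E :: "'p::prime_card space3 set"
  assumes "high_dirs E s \<noteq> {}"
  shows "card (proj_points - high_dirs E s) \<le> (CARD('p) + 1) * (CARD('p) - 1 - s)"
proof -
  let ?H = "high_dirs E s"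
  obtain d where d: "d \<in> ?H"
    using assms by auto
  then have dP: "d \<in> proj_points"
    by (simp add: high_dirs_def)
  have line: "card (proj_line v - ?H) \<le> CARD('p) - 1 - s" if "v \<in> proj_line d" for v
  proof -
    have v: "v \<in> proj_points"
      using that proj_line_subset by blast
    then have "?H \<inter> proj_line v \<noteq> {}"
      using in_proj_line_commute[OF v dP] that d by auto
    then have "card (?H \<inter> proj_line v) \<ge> s + 2"
      using high_dirs_line[OF proj_points_nonzero[OF v]] by simp
    moreover have "card (proj_line v - ?H) + card (?H \<inter> proj_line v) = card (proj_line v)"
      using card_Int_Diff[of "proj_line v" ?H] by (simp add: Int_commute)
    ultimately show ?thesis
      using card_proj_line[OF proj_points_nonzero[OF v]] by simp
  qed
  have "proj_points - ?H \<subseteq> (\<Union>v\<in>proj_line d. proj_line v - ?H)"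
  proof
    fix x assume x: "x \<in> proj_points - ?H"
    then obtain v where v: "v \<in> proj_line x" "v \<in> proj_line d"
      using obtain_joining_line dP by blast
    then have "x \<in> proj_line v"
      using in_proj_line_commute[of x v] proj_line_subset x by blast
    then show "x \<in> (\<Union>v\<in>proj_line d. proj_line v - ?H)"
      using v x by blast
  qed
  then have "card (proj_points - ?H) \<le> card (\<Union>v\<in>proj_line d. proj_line v - ?H)"
    by (intro card_mono) auto
  also have "\<dots> \<le> (\<Sum>v\<in>proj_line d. card (proj_line v - ?H))"
    by (intro card_UN_le) auto
  also have "\<dots> \<le> (\<Sum>v\<in>proj_line d. CARD('p) - 1 - s)"
    using line by (intro sum_mono)
  finally show ?thesis
    using card_proj_line[OF proj_points_nonzero[OF dP]] by simp
qed

text \<open>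
  A line is represented by its dual point.
\<close>

definition lines_off :: "'p::prime_card space3 set \<Rightarrow> 'p space3 set"
  where "lines_off X = {v\<in>proj_points. X \<inter> proj_line v = {}}"

text \<open>
  Such lines consist of the few points outside \<open>high_dirs E s\<close>, so there are only few of them.
\<close>

lemma card_lines_off_high:
  fixes E :: "'p::prime_card space3 set"
  assumes "high_dirs E s \<noteq> {}" and r: "r \<le> card (lines_off (high_dirs E s))"
  shows "r * (2 * (CARD('p) + 1)) \<le> 2 * ((CARD('p) + 1) * (CARD('p) - 1 - s)) + r * (r - 1)"
proof -
  obtain W where W: "W \<subseteq> lines_off (high_dirs E s)" "card W = r"
    using obtain_subset_with_card_n[OF r] by blast
  have "(\<Union>v\<in>W. proj_line v) \<subseteq> proj_points - high_dirs E s"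
    using W(1) proj_line_subset by (fastforce simp: lines_off_def)
  then have "card (\<Union>v\<in>W. proj_line v) \<le> (CARD('p) + 1) * (CARD('p) - 1 - s)"
    using card_points_off_high[OF assms(1)] card_mono[of "proj_points - high_dirs E s" "\<Union>v\<in>W. proj_line v"] by simp
  moreover have "W \<subseteq> proj_points"
    using W(1) by (auto simp: lines_off_def)
  ultimately show ?thesis
    using card_Union_lines[of W] W(2) by simp
qed

section \<open>Ordered pairs by direction\<close>

text \<open>
  The number of ordered pairs of distinct points of \<open>E\<close> whose difference has direction \<open>v\<close>.
\<close>

definition dir_pairs :: "'p::prime_card space3 set \<Rightarrow> 'p space3 \<Rightarrow> nat"
  where "dir_pairs E v = (\<Sum>e\<in>E. card {e'\<in>E - {e}. pdir (e - e') = v})"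

lemma line_count_eq_Suc:
  fixes E :: "'p::prime_card space3 set"
  assumes e: "e \<in> E" and v: "v \<in> proj_points"
  shows "line_count E v e = Suc (card {e'\<in>E - {e}. pdir (e - e') = v})"
proof -
  have parallel: "(\<exists>c. x - e = c *s v) \<longleftrightarrow> pdir (e - x) = v" if "x \<noteq> e" for x
  proof
    assume "\<exists>c. x - e = c *s v"
    then obtain c where c: "x - e = c *s v"
      by blast
    then have "e - x = (- c) *s v"
      by (auto simp: vec_eq_iff algebra_simps)
    moreover have "c \<noteq> 0"
      using c that by auto
    ultimately show "pdir (e - x) = v"
      using pdir_scale[OF v, of "- c"] by simp
  next
    assume "pdir (e - x) = v"
    moreover have "e - x \<noteq> 0"
      using that by auto
    ultimately obtain c where "e - x = c *s v"
      using pdir(2)[of "e - x"] by auto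
    then have "x - e = (- c) *s v"
      by (auto simp: vec_eq_iff algebra_simps)
    then show "\<exists>c. x - e = c *s v"
      by blast
  qed
  have "{x\<in>E. \<exists>c. x - e = c *s v} = insert e {e'\<in>E - {e}. pdir (e - e') = v}"
  proof (intro Set.set_eqI iffI)
    fix x assume "x \<in> {x\<in>E. \<exists>c. x - e = c *s v}"
    then show "x \<in> insert e {e'\<in>E - {e}. pdir (e - e') = v}"
      using parallel[of x] by auto
  next
    fix x assume x: "x \<in> insert e {e'\<in>E - {e}. pdir (e - e') = v}"
    show "x \<in> {x\<in>E. \<exists>c. x - e = c *s v}"
    proof (cases "x = e")
      case True
      then show ?thesis
        using e by (auto intro!: exI[of _ 0])
    next
      case False
      then show ?thesis
        using parallel[of x] x by auto
    qed
  qed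
  then show ?thesis
    by (simp add: line_count_def)
qed

lemma sum_line_count:
  assumes "v \<in> proj_points"
  shows "(\<Sum>e\<in>E. line_count E v e) = dir_pairs E v + card E"
proof -
  have "(\<Sum>e\<in>E. line_count E v e) = (\<Sum>e\<in>E. card {e'\<in>E - {e}. pdir (e - e') = v} + 1)"
    using assms by (intro sum.cong) (auto simp: line_count_eq_Suc)
  also have "\<dots> = dir_pairs E v + card E"
    unfolding sum.distrib dir_pairs_def by simp
  finally show ?thesis .
qed

lemma dir_pairs_eq_0: "v \<notin> dirs E \<Longrightarrow> dir_pairs E v = 0"
  using pdir_diff_in_dirs[of _ E] by (fastforce simp: dir_pairs_def card_eq_0_iff)

lemma dirs_subset: "dirs E \<subseteq> proj_points"
  by (auto simp: dirs_def)

lemma sum_dirs_eq: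
  fixes f :: "'p::prime_card space3 \<Rightarrow> nat"
  shows "(\<Sum>v\<in>dirs E. dir_pairs E v * f v) = (\<Sum>v\<in>proj_points. dir_pairs E v * f v)"
  by (intro sum.mono_neutral_left dirs_subset) (auto simp: dir_pairs_eq_0)

lemma sum_pairs_by_dir:
  fixes f :: "'p::prime_card space3 \<Rightarrow> nat"
  shows "(\<Sum>e\<in>E. \<Sum>e'\<in>E - {e}. f (pdir (e - e'))) = (\<Sum>v\<in>dirs E. dir_pairs E v * f v)"
proof -
  have inner: "(\<Sum>e'\<in>E - {e}. f (pdir (e - e'))) = (\<Sum>v\<in>proj_points. card {e'\<in>E - {e}. pdir (e - e') = v} * f v)" for e
  proof -
    have "(\<Sum>e'\<in>E - {e}. f (pdir (e - e'))) =
        (\<Sum>v\<in>proj_points. \<Sum>e'\<in>{e'\<in>E - {e}. pdir (e - e') = v}. f (pdir (e - e')))"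
      by (intro sum.group[symmetric]) (auto intro!: pdir(1))
    also have "\<dots> = (\<Sum>v\<in>proj_points. \<Sum>e'\<in>{e'\<in>E - {e}. pdir (e - e') = v}. f v)"
      by (intro sum.cong) auto
    finally show ?thesis
      by simp
  qed
  show ?thesis
    unfolding inner sum_dirs_eq by (subst sum.swap) (simp add: dir_pairs_def sum_distrib_right)
qed

lemma sum_dir_pairs:
  fixes E :: "'p::prime_card space3 set"
  shows "(\<Sum>v\<in>dirs E. dir_pairs E v) = card E * (card E - 1)"
proof -
  have "(\<Sum>v\<in>dirs E. dir_pairs E v * 1) = (\<Sum>e\<in>E. \<Sum>e'\<in>E - {e}. 1)"
    by (rule sum_pairs_by_dir[symmetric])
  then show ?thesis
    by (simp add: card_Diff_singleton)
qed

definition parallel_class :: "'p::prime_card space3 set \<Rightarrow> 'p space3 \<Rightarrow> 'p space3 \<Rightarrow> 'p space3 set"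
  where "parallel_class E v e = {x\<in>E. \<exists>c. x - e = c *s v}"

lemma card_parallel_class: "card (parallel_class E v e) = line_count E v e"
  by (simp add: parallel_class_def line_count_def)

lemma parallel_class_refl: "e \<in> E \<Longrightarrow> e \<in> parallel_class E v e"
  by (auto simp: parallel_class_def intro!: exI[of _ 0])

lemma parallel_class_eq:
  fixes v :: "'p::prime_card space3"
  assumes "x \<in> parallel_class E v e"
  shows "parallel_class E v x = parallel_class E v e"
proof -
  obtain c where c: "x - e = c *s v"
    using assms by (auto simp: parallel_class_def)
  have "(\<exists>b. y - x = b *s v) \<longleftrightarrow> (\<exists>b. y - e = b *s v)" for y
  proof
    assume "\<exists>b. y - x = b *s v"
    then obtain b where "y - x = b *s v" ..
    then have "y - e = (b + c) *s v"
      using c by (simp add: vec_eq_iff algebra_simps)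
    then show "\<exists>b. y - e = b *s v" ..
  next
    assume "\<exists>b. y - e = b *s v"
    then obtain b where "y - e = b *s v" ..
    then have "y - x = (b - c) *s v"
      using c by (simp add: vec_eq_iff algebra_simps)
    then show "\<exists>b. y - x = b *s v" ..
  qed
  then show ?thesis
    by (simp add: parallel_class_def)
qed

lemma line_count_parallel: "x \<in> parallel_class E v e \<Longrightarrow> line_count E v x = line_count E v e"
  using parallel_class_eq[of x E v e] by (simp flip: card_parallel_class)

text \<open>
  The lines of direction \<open>v\<close> partition \<open>F\<close>.
\<close>

lemma card_parallel_classes:
  fixes E :: "'p::prime_card space3 set"
  assumes F: "F \<subseteq> E" "\<And>e. e \<in> F \<Longrightarrow> parallel_class E v e \<subseteq> F" and m: "\<And>e. e \<in> F \<Longrightarrow> line_count E v e = m"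
  shows "m * card (parallel_class E v ` F) = card F"
proof -
  have union: "\<Union> (parallel_class E v ` F) = F"
    using F parallel_class_refl[of _ E v] by blast
  have "m * card (parallel_class E v ` F) = card (\<Union> (parallel_class E v ` F))"
  proof (rule card_partition)
    fix c assume "c \<in> parallel_class E v ` F"
    then show "card c = m"
      using m by (auto simp: card_parallel_class)
  next
    fix c c' assume cc: "c \<in> parallel_class E v ` F" "c' \<in> parallel_class E v ` F" "c \<noteq> c'"
    show "c \<inter> c' = {}"
    proof (rule ccontr)
      assume "c \<inter> c' \<noteq> {}"
      then obtain x where "x \<in> c" "x \<in> c'"
        by blast
      then show False
        using cc parallel_class_eq[of x E v] by auto
    qed
  qed auto
  then show ?thesis
    by (simp add: union)
qed

lemma parallel_class_plane:
  assumes "d \<in> proj_line v"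
  shows "parallel_class E v e \<subseteq> {x. dot x d = dot e d}"
proof
  fix x assume "x \<in> parallel_class E v e"
  then obtain c where "x - e = c *s v"
    by (auto simp: parallel_class_def)
  then have "dot (x - e) d = c * dot v d"
    by simp
  moreover have "dot v d = 0"
    using assms by (simp add: proj_line_def dot_commute)
  ultimately show "x \<in> {x. dot x d = dot e d}"
    by simp
qed

lemma dvd_plane_count:
  fixes E :: "'p::prime_card space3 set"
  assumes "\<And>e. e \<in> E \<Longrightarrow> line_count E v e = m" "d \<in> proj_line v"
  shows "m dvd plane_count E d t"
proof -
  have "m * card (parallel_class E v ` {e\<in>E. dot e d = t}) = card {e\<in>E. dot e d = t}"
    using assms(1) parallel_class_plane[OF assms(2), of E]
    by (intro card_parallel_classes) (auto simp: parallel_class_def)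
  then show ?thesis
    unfolding plane_count_def by (intro dvdI) (rule sym)
qed

context spectral_pair
begin

lemma dir_pairs_weight:
  assumes "X \<subseteq> zero_dirs E"
  shows "(\<Sum>v\<in>dirs E. dir_pairs E v * card (X \<inter> proj_line v)) = card X * (k * p * (k - 1))"
proof -
  have "(\<Sum>e\<in>E. \<Sum>e'\<in>E - {e}. card (X \<inter> proj_line (e - e'))) =
      (\<Sum>e\<in>E. \<Sum>e'\<in>E - {e}. card (X \<inter> proj_line (pdir (e - e'))))"
    by (intro sum.cong) (auto simp: proj_line_pdir)
  then show ?thesis
    using sum_pairs_by_dir[where f = "\<lambda>v. card (X \<inter> proj_line v)" and E = E] zero_dirs_pairs[OF assms] by simp
qed

lemma dir_pairs_le: "dir_pairs E v \<le> k * p * (k - 1)"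
proof (cases "v \<in> dirs E")
  case True
  then have v: "v \<in> proj_points"
    using dirs_subset by blast
  have "(\<Sum>e\<in>E. line_count E v e) \<le> (\<Sum>e\<in>E. k)"
    using line_count_le[OF proj_points_nonzero[OF v]] by (intro sum_mono) auto
  then have "dir_pairs E v + k * p \<le> k * p * k"
    using sum_line_count[OF v, of E] by (simp add: card_E mult.commute)
  then show ?thesis
    by (simp add: algebra_simps)
qed (simp add: dir_pairs_eq_0)

text \<open>
  The plane through \<open>e\<close> normal to the zero \<open>l\<close> contains \<open>k\<close> points, and all its points other than
  \<open>e\<close> lie in the direction \<open>v\<close> from \<open>e\<close>.
\<close>

lemma single_direction_line_count:
  assumes l: "l \<in> dirs A" and v: "dirs E \<inter> proj_line l = {v}" and e: "e \<in> E"
  shows "line_count E v e = k"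
proof -
  have "l \<in> zero_dirs E"
    using l dirs_subset_zero by blast
  have vP: "v \<in> proj_points"
    using v dirs_subset by blast
  have "{x\<in>E. dot x l = dot e l} \<subseteq> parallel_class E v e"
  proof
    fix x assume x: "x \<in> {x\<in>E. dot x l = dot e l}"
    show "x \<in> parallel_class E v e"
    proof (cases "x = e")
      case False
      have "pdir (x - e) \<in> dirs E \<inter> proj_line l"
        using pdir_diff_in_dirs[of x E e] x e False by (simp add: pdir_in_proj_line)
      then have "pdir (x - e) = v"
        using v by blast
      then show ?thesis
        using pdir(2)[of "x - e"] False x by (auto simp: parallel_class_def)
    qed (simp add: parallel_class_refl e)
  qed
  then have "card {x\<in>E. dot x l = dot e l} \<le> line_count E v e"
    unfolding card_parallel_class[symmetric] by (intro card_mono) auto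
  moreover have "card {x\<in>E. dot x l = dot e l} = k"
    using zero_plane_count[OF \<open>l \<in> zero_dirs E\<close>] by (simp add: plane_count_def)
  ultimately show ?thesis
    using line_count_le[OF proj_points_nonzero[OF vP], of e] by simp
qed

lemma zero_line_le_high:
  assumes "v \<in> proj_points" "v \<notin> lines_off (high_dirs E s)" "1 \<le> s"
  shows "card (zero_dirs E \<inter> proj_line v) + s + 1 \<le> p"
proof -
  have "high_dirs E s \<inter> proj_line v \<noteq> {}"
    using assms by (auto simp: lines_off_def)
  then have "s + 2 \<le> card (high_dirs E s \<inter> proj_line v)"
    using high_dirs_line[OF proj_points_nonzero[OF assms(1)]] by simp
  also have "\<dots> \<le> card (nonzero_dirs E \<inter> proj_line v)"
    using high_dirs_subset_nonzero[OF assms(3), of E] by (intro card_mono) auto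
  finally show ?thesis
    using card_zero_nonzero_line[OF proj_points_nonzero[OF assms(1)], of E] by simp
qed

lemma zero_dirs_subset: "zero_dirs E \<subseteq> proj_points"
  by (auto simp: zero_dirs_def)

text \<open>
  Every line carries between one and three zeros, so \<open>(z - 1) * (z - 3)\<close> is never positive; but its
  sum over all lines is a quadratic polynomial with negative discriminant.
\<close>

lemma not_5_2: "\<not> (p = 5 \<and> k = 2)"
proof
  assume pk: "p = 5 \<and> k = 2"
  have "int (card (zero_dirs E)) * (int (card (zero_dirs E)) + int CARD('p))
      - (1 + 3) * (int CARD('p) + 1) * int (card (zero_dirs E))
      + 1 * 3 * ((int CARD('p))\<^sup>2 + int CARD('p) + 1) \<le> int (0 * 0)"
  proof (rule quadratic_line_bound[OF zero_dirs_subset, where W = "{}"])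
    fix v :: "'p space3" assume "v \<in> proj_points"
    then have v: "v \<noteq> 0"
      by (rule proj_points_nonzero)
    have "card (nonzero_dirs E \<inter> proj_line v) \<ge> 3"
      using pk by (intro line_ge_3 no_flat_dirs_2 v) auto
    then show "1 \<le> int (card (zero_dirs E \<inter> proj_line v)) \<and> int (card (zero_dirs E \<inter> proj_line v)) \<le> 3"
      using zero_on_line[OF v] card_zero_nonzero_line[OF v, of E] pk by simp
  qed auto
  then have "(2 * int (card (zero_dirs E)) - 19)\<^sup>2 + 11 \<le> 0"
    using pk by (simp add: power2_eq_square algebra_simps)
  then show False
    by (smt (verit) zero_le_power2)
qed

end

section \<open>Few zeros over the field with seven elements\<close>

text \<open>
  The situation for \<open>p = 7\<close> after the exclusion of flat directions.
\<close>

locale spectral_pair_7 = spectral_pair E A k p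
  for E A :: "'p::prime_card space3 set" and k p :: nat +
  assumes p7: "p = 7" and no_flat: "flat_dirs E = {}" "flat_dirs A = {}"
begin

lemma dual_7: "spectral_pair_7 A E k p"
  using dual p7 no_flat by (simp add: spectral_pair_7_def spectral_pair_7_axioms_def)

lemma nonzero_high_1: "nonzero_dirs E \<subseteq> high_dirs E 1"
  using no_flat by (auto simp: flat_dirs_def)

lemma zero_line_range:
  assumes "v \<in> proj_points"
  shows "1 \<le> card (zero_dirs E \<inter> proj_line v)" "card (zero_dirs E \<inter> proj_line v) \<le> 5"
  using zero_on_line[OF proj_points_nonzero[OF assms]] line_ge_3[OF no_flat(1) proj_points_nonzero[OF assms]]
    card_zero_nonzero_line[OF proj_points_nonzero[OF assms], of E] p7 by simp_all

text \<open>
  At most three lines miss \<open>high_dirs E 3\<close>; all others carry at most three zeros.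
\<close>

lemma zero_dirs_bound_3:
  assumes "high_dirs E 3 \<noteq> {}" and le: "\<And>v. v \<in> proj_points \<Longrightarrow> card (zero_dirs E \<inter> proj_line v) \<le> b" and b: "3 \<le> b"
  shows "(int (card (zero_dirs E)))\<^sup>2 - 25 * int (card (zero_dirs E)) + 171 \<le> int (3 * ((b - 1) * (b - 3)))"
proof -
  have "\<not> 4 \<le> card (lines_off (high_dirs E 3))"
    using card_lines_off_high[OF assms(1), of 4] p7 by auto
  then have few: "card (lines_off (high_dirs E 3)) \<le> 3"
    by simp
  have "int (card (zero_dirs E)) * (int (card (zero_dirs E)) + int CARD('p))
      - (1 + 3) * (int CARD('p) + 1) * int (card (zero_dirs E))
      + 1 * 3 * ((int CARD('p))\<^sup>2 + int CARD('p) + 1) \<le> int (3 * ((b - 1) * (b - 3)))"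
  proof (rule quadratic_line_bound[OF zero_dirs_subset _ _ few])
    fix v :: "'p space3" assume "v \<in> proj_points" "v \<notin> lines_off (high_dirs E 3)"
    then show "1 \<le> int (card (zero_dirs E \<inter> proj_line v)) \<and> int (card (zero_dirs E \<inter> proj_line v)) \<le> 3"
      using zero_line_range[of v] zero_line_le_high[of v 3] p7 by simp
  next
    fix v assume "v \<in> lines_off (high_dirs E 3)"
    then have v: "v \<in> proj_points"
      by (simp add: lines_off_def)
    let ?z = "card (zero_dirs E \<inter> proj_line v)"
    show "(int ?z - 1) * (int ?z - 3) \<le> int ((b - 1) * (b - 3))"
    proof (cases "?z \<le> 3")
      case True
      then have "(int ?z - 1) * (int ?z - 3) \<le> 0"
        using zero_line_range(1)[OF v] by (intro mult_nonneg_nonpos) auto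
      then show ?thesis
        by linarith
    next
      case False
      then have "(int ?z - 1) * (int ?z - 3) \<le> (int b - 1) * (int b - 3)"
        using le[OF v] by (intro mult_mono) auto
      then show ?thesis
        using b by (simp add: of_nat_diff)
    qed
  qed (auto simp: lines_off_def)
  then show ?thesis
    using p7 by (simp add: power2_eq_square algebra_simps)
qed

text \<open>
  At most five lines miss \<open>high_dirs E 2\<close>; all others carry at most four zeros.
\<close>

lemma zero_dirs_bound_2:
  assumes "high_dirs E 2 \<noteq> {}" 
  shows "(int (card (zero_dirs E)))\<^sup>2 - 33 * int (card (zero_dirs E)) + 228 \<le> 20"
proof -
  have "\<not> 6 \<le> card (lines_off (high_dirs E 2))"
    using card_lines_off_high[OF assms(1), of 6] p7 by auto
  then have few: "card (lines_off (high_dirs E 2)) \<le> 5"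
    by simp
  have "int (card (zero_dirs E)) * (int (card (zero_dirs E)) + int CARD('p))
      - (1 + 4) * (int CARD('p) + 1) * int (card (zero_dirs E))
      + 1 * 4 * ((int CARD('p))\<^sup>2 + int CARD('p) + 1) \<le> int (5 * 4)"
  proof (rule quadratic_line_bound[OF zero_dirs_subset _ _ few])
    fix v :: "'p space3" assume "v \<in> proj_points" "v \<notin> lines_off (high_dirs E 2)"
    then show "1 \<le> int (card (zero_dirs E \<inter> proj_line v)) \<and> int (card (zero_dirs E \<inter> proj_line v)) \<le> 4"
      using zero_line_range[of v] zero_line_le_high[of v 2] p7 by simp
  next
    fix v assume "v \<in> lines_off (high_dirs E 2)"
    then have v: "v \<in> proj_points"
      by (simp add: lines_off_def)
    let ?z = "card (zero_dirs E \<inter> proj_line v)"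
    have "?z = 1 \<or> ?z = 2 \<or> ?z = 3 \<or> ?z = 4 \<or> ?z = 5"
      using zero_line_range[OF v] by linarith
    then show "(int ?z - 1) * (int ?z - 4) \<le> int 4"
      by auto
  qed (auto simp: lines_off_def)
  then show ?thesis
    using p7 by (simp add: power2_eq_square algebra_simps)
qed

text \<open>
  By \<open>linear_plane_count\<close> no profile of \<open>14\<close> points is linear.
\<close>

lemma high_2_if_k_2:
  assumes "k = 2"
  shows "nonzero_dirs E \<subseteq> high_dirs E 2"
  using linear_plane_count(1)[OF p7] nonzero_high_1 assms by blast

lemma zero_line_le_4:
  assumes "k = 2" "v \<in> proj_points"
  shows "card (zero_dirs E \<inter> proj_line v) \<le> 4"
proof -
  have "nonzero_dirs E \<inter> proj_line v \<noteq> {}"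
    by (rule nonzero_on_line[OF proj_points_nonzero[OF assms(2)]])
  then have "v \<notin> lines_off (high_dirs E 2)"
    using high_2_if_k_2[OF assms(1)] by (auto simp: lines_off_def)
  then show ?thesis
    using zero_line_le_high[OF assms(2), of 2] p7 by simp
qed

text \<open>
  Here \<open>(z - 1) * (z - 4)\<close> is never positive.
\<close>

lemma zero_dirs_le_23:
  assumes "k = 2"
  shows "card (zero_dirs E) \<le> 23"
proof (rule ccontr)
  assume "\<not> ?thesis"
  then have "24 \<le> card (zero_dirs E)"
    by simp
  then obtain x where x: "card (zero_dirs E) = 24 + x"
    using le_Suc_ex by blast
  have "int (card (zero_dirs E)) * (int (card (zero_dirs E)) + int CARD('p))
      - (1 + 4) * (int CARD('p) + 1) * int (card (zero_dirs E))
      + 1 * 4 * ((int CARD('p))\<^sup>2 + int CARD('p) + 1) \<le> int (0 * 0)"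
    by (rule quadratic_line_bound[OF zero_dirs_subset, where W = "{}"])
      (use zero_line_range(1) zero_line_le_4[OF assms] in fastforce)+
  then have "12 + 15 * int x + int x * int x \<le> 0"
    using p7 by (simp add: power2_eq_square algebra_simps x)
  then show False
    by (smt (verit) mult_nonneg_nonneg of_nat_0_le_iff)
qed

text \<open>
  With at most four zeros on the exceptional lines, \<open>zero_dirs_bound_3\<close> is a quadratic inequality
  with negative discriminant.
\<close>

lemma no_high_3_if_k_2:
  assumes "k = 2"
  shows "high_dirs E 3 = {}"
proof (rule ccontr)
  assume "high_dirs E 3 \<noteq> {}"
  then have "(int (card (zero_dirs E)))\<^sup>2 - 25 * int (card (zero_dirs E)) + 171 \<le> int (3 * ((4 - 1) * (4 - 3)))"
    using zero_line_le_4[OF assms] by (intro zero_dirs_bound_3) auto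
  then have "(2 * int (card (zero_dirs E)) - 25)\<^sup>2 + 23 \<le> 0"
    by (simp add: power2_eq_square algebra_simps)
  then show False
    by (smt (verit) zero_le_power2)
qed

text \<open>
  If a plane normal to \<open>l\<close> had a single direction \<open>v\<close>, the lines of direction \<open>v\<close> would pair up the
  points of \<open>E\<close>. Then all plane counts along a nonzero normal to \<open>v\<close> would be even, contrary to
  \<open>quadratic_plane_count\<close>.
\<close>

lemma two_dirs_if_k_2:
  assumes k: "k = 2" and l: "l \<in> dirs A"
  shows "2 \<le> card (dirs E \<inter> proj_line l)"
proof (rule ccontr)
  assume "\<not> ?thesis"
  moreover have "l \<in> proj_points"
    using l dirs_subset by blast
  then have "dirs E \<inter> proj_line l \<noteq> {}"
    by (intro dirs_on_line proj_points_nonzero)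
  then have "card (dirs E \<inter> proj_line l) > 0"
    by (simp add: card_gt_0_iff)
  ultimately have "card (dirs E \<inter> proj_line l) = 1"
    by simp
  then obtain v where v: "dirs E \<inter> proj_line l = {v}"
    by (rule card_1_singletonE)
  then have "v \<noteq> 0"
    using dirs_subset proj_points_nonzero by blast
  then obtain d where d: "d \<in> nonzero_dirs E" "d \<in> proj_line v"
    using nonzero_on_line by blast
  then obtain t where "odd (plane_count E d t)"
    using quadratic_plane_count(1)[OF p7, of d] nonzero_high_1 no_high_3_if_k_2[OF k] by blast
  moreover have "k dvd plane_count E d t"
    using single_direction_line_count[OF l v] by (rule dvd_plane_count[OF _ d(2)])
  ultimately show False
    using k by simp
qed

text \<open>
  Every difference of \<open>A\<close> is normal to at least two directions of \<open>E\<close>. Double counting gives \<open>26\<close>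
  directions of \<open>E\<close>, which are zeros of \<open>A\<close>.
\<close>

lemma k_not_2: "k \<noteq> 2"
proof
  assume k: "k = 2"
  interpret D: spectral_pair_7 A E k p
    by (rule dual_7)
  have "(\<Sum>v\<in>dirs A. dir_pairs A v * 2) \<le> (\<Sum>v\<in>dirs A. dir_pairs A v * card (dirs E \<inter> proj_line v))"
    using two_dirs_if_k_2[OF k] by (intro sum_mono mult_left_mono) auto
  also have "\<dots> = card (dirs E) * (k * p * (k - 1))"
    by (rule D.dir_pairs_weight[OF D.dirs_subset_zero])
  finally have "26 \<le> card (dirs E)"
    using k p7 card_A by (simp add: sum_dir_pairs flip: sum_distrib_right)
  moreover have "card (dirs E) \<le> card (zero_dirs A)"
    by (intro card_mono D.dirs_subset_zero) auto
  ultimately show False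
    using D.zero_dirs_le_23[OF k] by simp
qed

end

context spectral_pair
begin

section \<open>Three points in each plane\<close>

text \<open>
  Sums of squares of plane counts count pairs in a common plane; over the planes through lines of
  direction \<open>v\<close> they are controlled by \<open>sum_planes_through_line\<close>.
\<close>

lemma sum_squares_pencil:
  assumes v: "v \<in> proj_points"
  shows "(\<Sum>d\<in>proj_line v. \<Sum>t\<in>UNIV. (plane_count E d t)\<^sup>2) = p * (dir_pairs E v + k * p) + k * p * (k * p)"
proof -
  have square: "(\<Sum>t\<in>UNIV. (plane_count E d t)\<^sup>2) = (\<Sum>e\<in>E. plane_count E d (dot e d))" for d
    using sum_by_dot[of "\<lambda>t. plane_count E d t" d E] by (simp add: plane_count_def power2_eq_square)
  have "(\<Sum>d\<in>proj_line v. \<Sum>t\<in>UNIV. (plane_count E d t)\<^sup>2) = (\<Sum>e\<in>E. \<Sum>d\<in>proj_line v. plane_count E d (dot e d))"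
    unfolding square by (rule sum.swap)
  also have "\<dots> = (\<Sum>e\<in>E. p * line_count E v e + k * p)"
    using sum_planes_through_line[OF proj_points_nonzero[OF v], of E] by (simp add: card_E)
  also have "\<dots> = p * (\<Sum>e\<in>E. line_count E v e) + k * p * (k * p)"
    by (simp add: sum.distrib card_E flip: sum_distrib_left)
  finally show ?thesis
    by (simp add: sum_line_count[OF v] card_E)
qed

text \<open>
  Each plane normal to a zero contains \<open>k\<close> points, hence \<open>k * (k - 1)\<close> ordered pairs.
\<close>

lemma sum_dir_pairs_zero_plane:
  assumes "l \<in> zero_dirs E"
  shows "(\<Sum>v\<in>dirs E \<inter> proj_line l. dir_pairs E v) = k * p * (k - 1)"
proof -
  have "{l} \<subseteq> zero_dirs E"
    using assms by simp
  then have "(\<Sum>v\<in>dirs E. dir_pairs E v * card ({l} \<inter> proj_line v)) = k * p * (k - 1)"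
    using dir_pairs_weight[of "{l}"] by simp
  moreover have "(\<Sum>v\<in>dirs E. dir_pairs E v * card ({l} \<inter> proj_line v)) = (\<Sum>v\<in>dirs E. if v \<in> proj_line l then dir_pairs E v else 0)"
  proof (rule sum.cong[OF refl])
    fix v assume "v \<in> dirs E"
    then have "v \<in> proj_points"
      using dirs_subset by blast
    moreover have "l \<in> proj_points"
      using assms zero_dirs_subset by blast
    ultimately have "l \<in> proj_line v \<longleftrightarrow> v \<in> proj_line l"
      by (intro in_proj_line_commute)
    then show "dir_pairs E v * card ({l} \<inter> proj_line v) = (if v \<in> proj_line l then dir_pairs E v else 0)"
      by auto
  qed
  ultimately show ?thesis
    by (simp add: sum.inter_restrict)
qed

lemma dirs_inter_proj_line_nonempty:
  assumes "l \<in> proj_points"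
  shows "card (dirs E \<inter> proj_line l) \<ge> 1"
  using dirs_on_line[OF proj_points_nonzero[OF assms]] by (simp add: Suc_le_eq card_gt_0_iff)

end

lemma parallel_class_Int:
  fixes v w :: "'p::prime_card space3"
  assumes vw: "v \<in> proj_points" "w \<in> proj_points" "v \<noteq> w"
    and x: "x \<in> parallel_class E v e" "x \<in> parallel_class E w e'"
    and y: "y \<in> parallel_class E v e" "y \<in> parallel_class E w e'"
  shows "x = y"
proof (rule ccontr)
  assume "x \<noteq> y"
  have "y \<in> parallel_class E v x" "y \<in> parallel_class E w x"
    using x y parallel_class_eq by blast+
  then have "\<exists>a. y - x = a *s v" "\<exists>b. y - x = b *s w"
    unfolding parallel_class_def by blast+
  then obtain a b where ab: "y - x = a *s v" "y - x = b *s w"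
    by blast
  have "a \<noteq> 0" "b \<noteq> 0"
    using ab \<open>x \<noteq> y\<close> by auto
  then show False
    using pdir_scale[OF vw(1), of a] pdir_scale[OF vw(2), of b] ab vw(3) by metis
qed

text \<open>
  Inclusion and exclusion: a line of direction \<open>v\<close> and one of direction \<open>w\<close> have at most one common
  point.
\<close>

lemma grid_card:
  fixes v w :: "'p::prime_card space3"
  assumes vw: "v \<in> proj_points" "w \<in> proj_points" "v \<noteq> w" and F: "F \<subseteq> E" "F' \<subseteq> E"
  shows "card F + card F' \<le> card (F \<union> F') + card (parallel_class E v ` F) * card (parallel_class E w ` F')"
proof -
  have "inj_on (\<lambda>x. (parallel_class E v x, parallel_class E w x)) (F \<inter> F')"
  proof (rule inj_onI)
    fix x y
    assume xy: "x \<in> F \<inter> F'" "y \<in> F \<inter> F'"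
      and eq: "(parallel_class E v x, parallel_class E w x) = (parallel_class E v y, parallel_class E w y)"
    then have "x \<in> E" "y \<in> E"
      using F by auto
    then have "x \<in> parallel_class E v y" "x \<in> parallel_class E w y" "y \<in> parallel_class E v y" "y \<in> parallel_class E w y"
      using eq parallel_class_refl[of x E] parallel_class_refl[of y E] by auto
    then show "x = y"
      by (rule parallel_class_Int[OF vw])
  qed
  then have "card (F \<inter> F') \<le> card ((parallel_class E v ` F) \<times> (parallel_class E w ` F'))"
    by (rule card_inj_on_le) auto
  then have "card (F \<inter> F') \<le> card (parallel_class E v ` F) * card (parallel_class E w ` F')"
    by (simp only: card_cartesian_product)
  moreover have "card F + card F' = card (F \<union> F') + card (F \<inter> F')"
    by (intro card_Un_Int) auto
  ultimately show ?thesis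
    by simp
qed

text \<open>
  The hypotheses are those satisfied by \<open>a\<close> and \<open>b\<close> full lines of two directions in a plane with \<open>n\<close>
  points, by \<open>grid_card\<close>.
\<close>

lemma section_units_bound:
  assumes "3 * a + 3 * b \<le> n + a * b" "n \<le> 7" "3 * a \<le> n" "3 * b \<le> n"
  shows "a + b \<le> section_units n"
proof -
  have "a \<in> {0, 1, 2}" "b \<in> {0, 1, 2}"
    using assms by auto
  then show ?thesis
    using assms by (auto simp: section_units_def)
qed

locale spectral_pair_7_3 = spectral_pair_7 E A k p
  for E A :: "'p::prime_card space3 set" and k p :: nat +
  assumes k3: "k = 3"
begin

lemma dual_7_3: "spectral_pair_7_3 A E k p"
  using dual_7 k3 by (simp add: spectral_pair_7_3_def spectral_pair_7_3_axioms_def)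

lemma card_7_3: "card E = 21" "card A = 21"
  using card_E card_A p7 k3 by simp_all

lemma line_identity_7_3:
  assumes "v \<in> proj_points"
  shows "(\<Sum>d\<in>nonzero_dirs E \<inter> proj_line v. plane_count E d (dot x d)) + 3 * card (zero_dirs E \<inter> proj_line v) =
    7 * line_count E v x + 21"
    and "card (nonzero_dirs E \<inter> proj_line v) + card (zero_dirs E \<inter> proj_line v) = 8"
  using line_identity[OF proj_points_nonzero[OF assms], of x] card_zero_nonzero_line[OF proj_points_nonzero[OF assms], of E]
  by (simp_all add: p7 k3)

lemma plane_count_le_7: "d \<in> proj_points \<Longrightarrow> plane_count E d t \<le> 7"
  using plane_count_le[OF proj_points_nonzero, of d t] p7 by simp

text \<open>
  Two such directions span a plane that contains nine points of \<open>E\<close>, three on each of three parallel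
  lines.
\<close>

lemma full_direction_unique:
  assumes v: "v \<in> proj_points" "\<And>e. e \<in> E \<Longrightarrow> line_count E v e = 3"
    and w: "w \<in> proj_points" "\<And>e. e \<in> E \<Longrightarrow> line_count E w e = 3"
  shows "v = w"
proof (rule ccontr)
  assume "v \<noteq> w"
  have "E \<noteq> {}"
    using card_7_3 by auto
  then obtain e where e: "e \<in> E"
    by blast
  obtain d where d: "d \<in> proj_line v" "d \<in> proj_line w"
    using obtain_joining_line[OF v(1) w(1)] by blast
  then have dP: "d \<in> proj_points"
    using proj_line_subset by blast
  let ?L = "parallel_class E v e"
  have "card (\<Union>x\<in>?L. parallel_class E w x) = (\<Sum>x\<in>?L. card (parallel_class E w x))"
  proof (rule card_UN_disjoint)
    show "\<forall>x\<in>?L. \<forall>y\<in>?L. x \<noteq> y \<longrightarrow> parallel_class E w x \<inter> parallel_class E w y = {}"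
    proof (intro ballI impI, rule ccontr)
      fix x y assume xy: "x \<in> ?L" "y \<in> ?L" "x \<noteq> y" and "parallel_class E w x \<inter> parallel_class E w y \<noteq> {}"
      then obtain z where "z \<in> parallel_class E w x" "z \<in> parallel_class E w y"
        by blast
      then have "parallel_class E w x = parallel_class E w y"
        using parallel_class_eq by metis
      moreover have "x \<in> parallel_class E w x" "y \<in> parallel_class E w y"
        using xy parallel_class_refl by (auto simp: parallel_class_def)
      ultimately show False
        using parallel_class_Int[OF v(1) w(1) \<open>v \<noteq> w\<close> xy(1) _ xy(2), of x] xy(3) by simp
    qed
  qed auto
  also have "\<dots> = (\<Sum>x\<in>?L. 3)"
    using w(2) by (intro sum.cong) (auto simp: card_parallel_class, auto simp: parallel_class_def)
  also have "\<dots> = 9"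
    using v(2)[OF e] by (simp add: card_parallel_class)
  finally have "9 = card (\<Union>x\<in>?L. parallel_class E w x)" ..
  also have "\<dots> \<le> card {x\<in>E. dot x d = dot e d}"
  proof (rule card_mono)
    show "(\<Union>x\<in>?L. parallel_class E w x) \<subseteq> {x\<in>E. dot x d = dot e d}"
    proof
      fix y assume "y \<in> (\<Union>x\<in>?L. parallel_class E w x)"
      then obtain x where x: "x \<in> ?L" "y \<in> parallel_class E w x"
        by blast
      have "y \<in> E"
        using x(2) by (simp add: parallel_class_def)
      moreover have "dot x d = dot e d" "dot y d = dot x d"
        using parallel_class_plane[OF d(1), of E e] parallel_class_plane[OF d(2), of E x] x by blast+
      ultimately show "y \<in> {x\<in>E. dot x d = dot e d}"
        by simp
    qed
  qed simp
  finally show False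
    using plane_count_le_7[OF dP, of "dot e d"] by (simp add: plane_count_def)
qed

text \<open>
  Along \<open>d\<close> normal to \<open>v\<close> all plane counts are divisible by three, so they are at most six. With at
  least two zeros on the line, \<open>line_identity\<close> at a point of \<open>E\<close> leaves no room for a nonzero term
  less than six. Then the counts along a nonzero add up to a multiple of six instead of \<open>21\<close>.
\<close>

lemma full_direction_zero:
  assumes v: "v \<in> proj_points" "\<And>e. e \<in> E \<Longrightarrow> line_count E v e = 3"
  shows "card (zero_dirs E \<inter> proj_line v) \<le> 1"
proof (rule ccontr)
  assume "\<not> ?thesis"
  then have z2: "card (zero_dirs E \<inter> proj_line v) \<ge> 2"
    by simp
  have le6: "plane_count E d t \<le> 6" if "d \<in> proj_line v" for d t
  proof -
    have "3 dvd plane_count E d t"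
      by (rule dvd_plane_count[OF v(2) that])
    moreover have "plane_count E d t \<le> 7"
      using that proj_line_subset by (intro plane_count_le_7) blast
    ultimately show ?thesis
      by presburger
  qed
  have six: "plane_count E d (dot e d) = 6" if d: "d \<in> nonzero_dirs E \<inter> proj_line v" and e: "e \<in> E" for d e
  proof (rule ccontr)
    assume "\<not> ?thesis"
    then have "plane_count E d (dot e d) < 6"
      using le6[of d "dot e d"] d by simp
    then have "(\<Sum>d\<in>nonzero_dirs E \<inter> proj_line v. plane_count E d (dot e d)) < (\<Sum>d\<in>nonzero_dirs E \<inter> proj_line v. 6)"
      using le6 d by (intro sum_strict_mono_ex1) auto
    then show False
      using line_identity_7_3(1)[OF v(1), of e] line_identity_7_3(2)[OF v(1)] v(2)[OF e] z2 by simp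
  qed
  obtain d where d: "d \<in> nonzero_dirs E \<inter> proj_line v"
    using nonzero_on_line[OF proj_points_nonzero[OF v(1)]] by blast
  have "6 dvd (\<Sum>t\<in>UNIV. plane_count E d t)"
  proof (rule dvd_sum)
    fix t
    show "6 dvd plane_count E d t"
    proof (cases "{e\<in>E. dot e d = t} = {}")
      case True
      then show ?thesis
        by (simp only: plane_count_def card.empty dvd_0_right)
    next
      case False
      then obtain e where "e \<in> E" "dot e d = t"
        by blast
      then show ?thesis
        using six[OF d, of e] by simp
    qed
  qed
  then show False
    by (simp add: sum_plane_count card_7_3)
qed

text \<open>
  If the planes normal to \<open>l\<close> have a single direction \<open>v\<close>, all points lie on full lines of direction
  \<open>v\<close>. This determines \<open>v\<close> by \<open>full_direction_unique\<close>, and \<open>l\<close> is the only zero normal to \<open>v\<close> by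
  \<open>full_direction_zero\<close>.
\<close>

lemma single_direction_unique:
  assumes l: "l \<in> dirs A" "card (dirs E \<inter> proj_line l) = 1" and l': "l' \<in> dirs A" "card (dirs E \<inter> proj_line l') = 1"
  shows "l = l'"
proof -
  obtain v where v: "dirs E \<inter> proj_line l = {v}"
    using l(2) by (rule card_1_singletonE)
  obtain v' where v': "dirs E \<inter> proj_line l' = {v'}"
    using l'(2) by (rule card_1_singletonE)
  have vP: "v \<in> proj_points" "v' \<in> proj_points"
    using v v' dirs_subset by blast+
  have full: "line_count E v e = 3" "line_count E v' e = 3" if "e \<in> E" for e
    using single_direction_line_count[OF l(1) v that] single_direction_line_count[OF l'(1) v' that] k3 by simp_all
  then have "v = v'"
    using full_direction_unique vP by blast
  have lP: "l \<in> proj_points" "l' \<in> proj_points"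
    using l(1) l'(1) dirs_subset by blast+
  have "l \<in> zero_dirs E \<inter> proj_line v" "l' \<in> zero_dirs E \<inter> proj_line v"
    using l(1) l'(1) dirs_subset_zero v v' \<open>v = v'\<close> in_proj_line_commute[OF lP(1) vP(1)] in_proj_line_commute[OF lP(2) vP(2)]
    by auto
  moreover have "card (zero_dirs E \<inter> proj_line v) \<le> 1"
    using full_direction_zero vP(1) full(1) by blast
  ultimately show ?thesis
    by (metis card_le_Suc0_iff_eq finite One_nat_def)
qed

text \<open>
  All directions \<open>l\<close> of \<open>A\<close> with at most one exception are normal to at least two directions of \<open>E\<close>,
  and at most \<open>42\<close> of the \<open>420\<close> ordered pairs of \<open>A\<close> have the exceptional direction.
\<close>

lemma card_dirs_ge_19: "card (dirs E) \<ge> 19"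
proof -
  interpret D: spectral_pair_7_3 A E k p
    by (rule dual_7_3)
  let ?r = "\<lambda>l. card (dirs E \<inter> proj_line l)" and ?C = "dir_pairs A"
  let ?S = "{l\<in>dirs A. ?r l = 1}"
  have r1: "?r l \<ge> 1" if "l \<in> dirs A" for l
    using that dirs_subset by (intro dirs_inter_proj_line_nonempty) blast
  have S: "(\<Sum>l\<in>?S. ?C l) \<le> 42"
  proof -
    have "card ?S \<le> 1"
      unfolding One_nat_def card_le_Suc0_iff_eq[OF finite] using single_direction_unique by auto
    moreover have "(\<Sum>l\<in>?S. ?C l) \<le> (\<Sum>l\<in>?S. 42)"
      using D.dir_pairs_le p7 k3 by (intro sum_mono) simp
    ultimately show ?thesis
      by simp
  qed
  have "(\<Sum>l\<in>dirs A. ?C l * 2) \<le> (\<Sum>l\<in>dirs A. ?C l * ?r l + (if ?r l = 1 then ?C l else 0))"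
  proof (rule sum_mono)
    fix l assume "l \<in> dirs A"
    then show "?C l * 2 \<le> ?C l * ?r l + (if ?r l = 1 then ?C l else 0)"
      using r1[of l] by (cases "?r l = 1") auto
  qed
  also have "\<dots> = (\<Sum>l\<in>dirs A. ?C l * ?r l) + (\<Sum>l\<in>?S. ?C l)"
    by (simp add: sum.distrib sum.inter_filter)
  also have "(\<Sum>l\<in>dirs A. ?C l * ?r l) = card (dirs E) * 42"
    using D.dir_pairs_weight[OF D.dirs_subset_zero] p7 k3 by simp
  finally have "(\<Sum>l\<in>dirs A. ?C l * 2) \<le> card (dirs E) * 42 + 42"
    using S by simp
  then show ?thesis
    using sum_dir_pairs[of A] by (simp add: card_7_3 flip: sum_distrib_right)
qed

text \<open>
  Otherwise \<open>zero_dirs_bound_3\<close> limits the number of zeros to less than \<open>19\<close>, although the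
  directions of \<open>A\<close> are zeros.
\<close>

lemma no_high_3: "high_dirs E 3 = {}"
proof (rule ccontr)
  interpret D: spectral_pair_7_3 A E k p
    by (rule dual_7_3)
  assume "high_dirs E 3 \<noteq> {}"
  then have bound: "(int (card (zero_dirs E)))\<^sup>2 - 25 * int (card (zero_dirs E)) + 171 \<le> int (3 * ((5 - 1) * (5 - 3)))"
    using zero_line_range(2) by (intro zero_dirs_bound_3) auto
  have "19 \<le> card (zero_dirs E)"
    using D.card_dirs_ge_19 card_mono[OF _ dirs_subset_zero] by fastforce
  then obtain x where "card (zero_dirs E) = 19 + x"
    using le_Suc_ex by blast
  then have "33 + 13 * int x + int x * int x \<le> 0"
    using bound by (simp add: power2_eq_square algebra_simps)
  then show False
    by (smt (verit) mult_nonneg_nonneg of_nat_0_le_iff)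
qed

text \<open>
  By \<open>quadratic_plane_count\<close> each nonzero contributes at most \<open>105\<close> to \<open>sum_squares_pencil\<close>, and
  each zero contributes \<open>63\<close>.
\<close>

lemma dir_pairs_bound:
  assumes v: "v \<in> proj_points"
  shows "dir_pairs E v + 6 * card (zero_dirs E \<inter> proj_line v) \<le> 36"
proof -
  let ?Q = "\<lambda>d. \<Sum>t\<in>UNIV. (plane_count E d t)\<^sup>2"
  have "proj_line v = (nonzero_dirs E \<inter> proj_line v) \<union> (zero_dirs E \<inter> proj_line v)"
    using proj_line_subset[of v] by (auto simp: nonzero_dirs_def zero_dirs_def)
  then have "sum ?Q (proj_line v) = sum ?Q ((nonzero_dirs E \<inter> proj_line v) \<union> (zero_dirs E \<inter> proj_line v))"
    by simp
  also have "\<dots> = sum ?Q (nonzero_dirs E \<inter> proj_line v) + sum ?Q (zero_dirs E \<inter> proj_line v)"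
    by (rule sum.union_disjoint) (auto simp: nonzero_dirs_def zero_dirs_def)
  also have "\<dots> \<le> (\<Sum>d\<in>nonzero_dirs E \<inter> proj_line v. 105) + (\<Sum>d\<in>zero_dirs E \<inter> proj_line v. 63)"
  proof (intro add_mono sum_mono)
    fix d assume "d \<in> nonzero_dirs E \<inter> proj_line v"
    then show "?Q d \<le> 105"
      using quadratic_plane_count(2)[OF p7 _ _ k3] nonzero_high_1 no_high_3 by blast
  next
    fix d assume "d \<in> zero_dirs E \<inter> proj_line v"
    then show "?Q d \<le> 63"
      using zero_plane_count[of d] by (simp add: k3 p7)
  qed
  finally have "7 * (dir_pairs E v + 21) + 441 \<le> 105 * card (nonzero_dirs E \<inter> proj_line v) + 63 * card (zero_dirs E \<inter> proj_line v)"
    using sum_squares_pencil[OF v] by (simp add: k3 p7)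
  then show ?thesis
    using line_identity_7_3(2)[OF v] by arith
qed

lemma sum_dir_pairs_plane:
  assumes "l \<in> dirs A"
  shows "(\<Sum>v\<in>dirs E \<inter> proj_line l. dir_pairs E v) = 42"
  using sum_dir_pairs_zero_plane[of l] assms dirs_subset_zero p7 k3 by auto

text \<open>
  A single direction would carry all \<open>42\<close> pairs, more than \<open>dir_pairs_bound\<close> allows.
\<close>

lemma two_dirs_in_plane:
  assumes l: "l \<in> dirs A"
  shows "2 \<le> card (dirs E \<inter> proj_line l)"
proof (rule ccontr)
  assume "\<not> ?thesis"
  moreover have "card (dirs E \<inter> proj_line l) \<ge> 1"
    using l dirs_subset by (intro dirs_inter_proj_line_nonempty) blast
  ultimately have "card (dirs E \<inter> proj_line l) = 1"
    by simp
  then obtain v where v: "dirs E \<inter> proj_line l = {v}"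
    by (rule card_1_singletonE)
  then have "dir_pairs E v = 42"
    using sum_dir_pairs_plane[OF l] by simp
  moreover have "v \<in> proj_points"
    using v dirs_subset by blast
  ultimately show False
    using dir_pairs_bound[of v] by simp
qed

text \<open>
  The directions that carry the maximal number \<open>24\<close> of ordered pairs allowed by \<open>dir_pairs_le_24\<close>,
  arranged in full lines of three points.
\<close>

definition heavy_dirs :: "'p space3 set"
  where "heavy_dirs = {v\<in>dirs E. dir_pairs E v = 24 \<and> (\<forall>e\<in>E. line_count E v e = 1 \<or> line_count E v e = 3)}"

lemma dir_pairs_full_lines:
  assumes v: "v \<in> proj_points" and one_three: "\<And>e. e \<in> E \<Longrightarrow> line_count E v e = 1 \<or> line_count E v e = 3"
  shows "dir_pairs E v = 2 * card {e\<in>E. line_count E v e = 3}" "3 dvd card {e\<in>E. line_count E v e = 3}"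
proof -
  have "(\<Sum>e\<in>E. line_count E v e) = (\<Sum>e\<in>E. 1 + (if line_count E v e = 3 then 2 else 0))"
    using one_three by (intro sum.cong) auto
  also have "\<dots> = card E + (\<Sum>e\<in>{e\<in>E. line_count E v e = 3}. 2)"
    unfolding sum.distrib by (simp only: sum.inter_filter[OF finite] card_eq_sum)
  finally show "dir_pairs E v = 2 * card {e\<in>E. line_count E v e = 3}"
    using sum_line_count[OF v, of E] by simp
  have "3 * card (parallel_class E v ` {e\<in>E. line_count E v e = 3}) = card {e\<in>E. line_count E v e = 3}"
    by (rule card_parallel_classes) (auto simp: line_count_parallel, auto simp: parallel_class_def)
  then show "3 dvd card {e\<in>E. line_count E v e = 3}"
    by (rule dvdI[OF sym])
qed

text \<open>
  Each heavy direction has four full lines. Take the planes that contain two given heavy directions.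
  In every such plane the number of full lines is at most \<open>section_units\<close> of its plane count, and
  these bounds add up to at most seven, whereas there are eight full lines.
\<close>

lemma heavy_dirs_unique:
  assumes v: "v \<in> heavy_dirs" and w: "w \<in> heavy_dirs"
  shows "v = w"
proof (rule ccontr)
  assume "v \<noteq> w"
  have vw: "v \<in> proj_points" "w \<in> proj_points"
    using v w dirs_subset by (auto simp: heavy_dirs_def)
  obtain u where u: "u \<in> proj_line v" "u \<in> proj_line w"
    using obtain_joining_line[OF vw] by blast
  then have uP: "u \<in> proj_points"
    using proj_line_subset by blast
  (* the points on full lines of direction \<open>x\<close>, and the number of these lines, in each
     plane normal to \<open>u\<close> *)
  define F where "F x t = {e\<in>{e\<in>E. line_count E x e = 3}. dot e u = t}" for x t
  define a where "a x t = card (parallel_class E x ` F x t)" for x t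
  have a: "3 * a x t = card (F x t)" if x: "u \<in> proj_line x" for x t
    unfolding a_def
  proof (rule card_parallel_classes)
    show "F x t \<subseteq> E"
      by (auto simp: F_def)
    show "line_count E x e = 3" if "e \<in> F x t" for e
      using that by (simp add: F_def)
    show "parallel_class E x e \<subseteq> F x t" if e: "e \<in> F x t" for e
    proof
      fix y assume y: "y \<in> parallel_class E x e"
      then have "y \<in> E" "dot y u = dot e u" "line_count E x y = line_count E x e"
        using parallel_class_plane[OF x, of E e] line_count_parallel[OF y] by (auto simp: parallel_class_def)
      then show "y \<in> F x t"
        using e by (simp add: F_def)
    qed
  qed
  have sum_a: "(\<Sum>t\<in>UNIV. a x t) = 4" if "x \<in> heavy_dirs" "u \<in> proj_line x" for x
  proof -
    have "dir_pairs E x = 2 * card {e\<in>E. line_count E x e = 3}"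
      using that(1) dirs_subset by (intro dir_pairs_full_lines(1)) (auto simp: heavy_dirs_def)
    then have "card {e\<in>E. line_count E x e = 3} = 12"
      using that(1) by (simp add: heavy_dirs_def)
    then have "(\<Sum>t\<in>UNIV. card (F x t)) = 12"
      using sum_plane_count[of "{e\<in>E. line_count E x e = 3}" u] by (simp add: plane_count_def F_def)
    then have "3 * (\<Sum>t\<in>UNIV. a x t) = 12"
      using a[OF that(2)] by (simp add: sum_distrib_left)
    then show ?thesis
      by simp
  qed
  have units: "a v t + a w t \<le> section_units (plane_count E u t)" for t
  proof (rule section_units_bound)
    have sub: "F v t \<subseteq> {e\<in>E. dot e u = t}" "F w t \<subseteq> {e\<in>E. dot e u = t}"
      by (auto simp: F_def)
    then show "3 * a v t \<le> plane_count E u t" "3 * a w t \<le> plane_count E u t"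
      unfolding a[OF u(1)] a[OF u(2)] plane_count_def by (auto intro!: card_mono)
    have "card (F v t \<union> F w t) \<le> plane_count E u t"
      unfolding plane_count_def using sub by (intro card_mono) auto
    then show "3 * a v t + 3 * a w t \<le> plane_count E u t + a v t * a w t"
      using grid_card[OF vw \<open>v \<noteq> w\<close>, of "F v t" E "F w t"] sub a[OF u(1)] a[OF u(2)]
      unfolding a_def by fastforce
    show "plane_count E u t \<le> 7"
      by (rule plane_count_le_7[OF uP])
  qed
  have "(\<Sum>t\<in>UNIV. section_units (plane_count E u t)) \<le> 7"
  proof (cases "u \<in> zero_dirs E")
    case True
    then have "plane_count E u t = 3" for t
      using zero_plane_count k3 by simp
    then show ?thesis
      using p7 by (simp add: section_units_def)
  next
    case False
    then have "u \<in> nonzero_dirs E"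
      using uP by (simp add: zero_dirs_def nonzero_dirs_def)
    then show ?thesis
      using quadratic_plane_count(3)[OF p7 _ _ k3] nonzero_high_1 no_high_3 by blast
  qed
  moreover have "(\<Sum>t\<in>UNIV. a v t + a w t) \<le> (\<Sum>t\<in>UNIV. section_units (plane_count E u t))"
    using units by (intro sum_mono)
  ultimately show False
    using sum_a[OF v u(1)] sum_a[OF w u(2)] by (simp add: sum.distrib)
qed

lemma zero_line_ge_2:
  assumes "v \<in> dirs E"
  shows "2 \<le> card (zero_dirs E \<inter> proj_line v)"
proof -
  interpret D: spectral_pair_7_3 A E k p
    by (rule dual_7_3)
  have "2 \<le> card (dirs A \<inter> proj_line v)"
    by (rule D.two_dirs_in_plane[OF assms])
  also have "\<dots> \<le> card (zero_dirs E \<inter> proj_line v)"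
    using dirs_subset_zero by (intro card_mono) auto
  finally show ?thesis .
qed

lemma dir_pairs_le_24: "v \<in> dirs E \<Longrightarrow> dir_pairs E v \<le> 24"
  using dir_pairs_bound[of v] zero_line_ge_2[of v] dirs_subset[of E] by fastforce

text \<open>
  The three points of \<open>E\<close> in a plane normal to \<open>l\<close> would determine three directions if they were not
  collinear; so two of them cannot be alone on their line.
\<close>

lemma collinear_sections:
  assumes l: "l \<in> dirs A" and two: "card (dirs E \<inter> proj_line l) \<le> 2" and v: "v \<in> dirs E" "v \<in> proj_line l" and e: "e \<in> E"
  shows "line_count E v e = 1 \<or> line_count E v e = 3"
proof (rule ccontr)
  assume not_one_three: "\<not> ?thesis"
  have vP: "v \<in> proj_points"
    using v(1) dirs_subset by blast
  have lP: "l \<in> proj_points"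
    using l dirs_subset by blast
  have lv: "l \<in> proj_line v"
    using v(2) in_proj_line_commute[OF lP vP] by simp
  have "line_count E v e = 2"
    using not_one_three line_count_pos[OF e, of v] line_count_le[OF proj_points_nonzero[OF vP], of e] k3 by auto
  then have card_class: "card (parallel_class E v e) = 2"
    by (simp add: card_parallel_class)
  define G where "G = {x\<in>E. dot x l = dot e l}"
  have "l \<in> zero_dirs E"
    using l dirs_subset_zero by blast
  then have card_G: "card G = 3"
    using zero_plane_count[of l "dot e l"] k3 by (simp add: plane_count_def G_def)
  have "e \<in> G"
    using e by (simp add: G_def)
  have class_G: "parallel_class E v e \<subseteq> G"
    using parallel_class_plane[OF lv, of E e] by (auto simp: G_def parallel_class_def)
  obtain e' where e': "e' \<in> parallel_class E v e" "e' \<noteq> e"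
    using card_class by (metis card_2_iff')
  obtain g where g: "g \<in> G" "g \<notin> parallel_class E v e"
    using card_G card_class class_G by (metis card_mono finite numeral_le_iff semiring_norm(72) subsetI numeral_eq_iff subset_antisym semiring_norm(89))
  have "line_count G u y < card G" if "u \<noteq> 0" for u y
  proof (rule ccontr)
    assume "\<not> ?thesis"
    then have "card G \<le> card (parallel_class G u y)"
      by (simp add: card_parallel_class)
    then have "parallel_class G u y = G"
      by (intro card_seteq) (auto simp: parallel_class_def)
    then have "parallel_class G u e = G"
      using \<open>e \<in> G\<close> parallel_class_eq[of e G u y] by simp
    then have "e' \<in> parallel_class G u e" "g \<in> parallel_class G u e"
      using g(1) e'(1) class_G by auto
    then obtain b c where bc: "e' - e = c *s u" "g - e = b *s u"
      unfolding parallel_class_def by blast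
    obtain a where a: "e' - e = a *s v"
      using e'(1) by (auto simp: parallel_class_def)
    have "c \<noteq> 0"
      using bc(1) e'(2) by auto
    then have "u = (a / c) *s v"
      using bc(1) a by (simp add: vec_eq_iff field_simps)
    then have "g - e = (b * (a / c)) *s v"
      using bc(2) by (simp add: vector_smult_assoc)
    then show False
      using g by (auto simp: parallel_class_def G_def)
  qed
  then have "card G \<le> card (dirs G \<inter> proj_line l)"
    using card_G two_neq_0 p7 by (intro noncollinear_dirs[where \<tau> = "dot e l"] proj_points_nonzero[OF lP]) (auto simp: G_def)
  also have "\<dots> \<le> card (dirs E \<inter> proj_line l)"
    using dirs_mono[of G E] by (intro card_mono) (auto simp: G_def)
  finally show False
    using two card_G by simp
qed

text \<open>
  The planes normal to \<open>l\<close> have two directions, which share the \<open>42\<close> ordered pairs. By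
  \<open>collinear_sections\<close> both numbers are divisible by six, and neither exceeds \<open>24\<close>; so they are \<open>18\<close>
  and \<open>24\<close>.
\<close>

lemma heavy_dir_if_zero_line_2:
  assumes l: "l \<in> dirs A" and z: "card (zero_dirs A \<inter> proj_line l) = 2"
  obtains v where "v \<in> heavy_dirs" "l \<in> proj_line v" "card (zero_dirs E \<inter> proj_line v) = 2"
proof -
  note obtained = that
  interpret D: spectral_pair_7_3 A E k p
    by (rule dual_7_3)
  have lP: "l \<in> proj_points"
    using l dirs_subset by blast
  have "card (dirs E \<inter> proj_line l) \<le> 2"
    unfolding z[symmetric] using D.dirs_subset_zero by (intro card_mono) auto
  then have two: "card (dirs E \<inter> proj_line l) = 2"
    using two_dirs_in_plane[OF l] by simp
  then obtain v w where vw: "dirs E \<inter> proj_line l = {v, w}" "v \<noteq> w"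
    by (meson card_2_iff)
  have six: "6 dvd dir_pairs E x" if "x \<in> dirs E \<inter> proj_line l" for x
  proof -
    have "x \<in> proj_points"
      using that dirs_subset by blast
    moreover have "line_count E x e = 1 \<or> line_count E x e = 3" if "e \<in> E" for e
      using collinear_sections[OF l] two \<open>x \<in> dirs E \<inter> proj_line l\<close> that by simp
    ultimately show ?thesis
      using dir_pairs_full_lines[of x] by (auto elim!: dvdE)
  qed
  have found: thesis if x: "x \<in> dirs E \<inter> proj_line l" "dir_pairs E x = 24" for x
  proof (rule obtained)
    have xP: "x \<in> proj_points"
      using x dirs_subset by blast
    show "x \<in> heavy_dirs"
      using x collinear_sections[OF l] two by (simp add: heavy_dirs_def)
    show "l \<in> proj_line x"
      using x in_proj_line_commute[OF lP xP] by simp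
    show "card (zero_dirs E \<inter> proj_line x) = 2"
      using dir_pairs_bound[OF xP] zero_line_ge_2[of x] x by simp
  qed
  have "dir_pairs E v + dir_pairs E w = 42"
    using sum_dir_pairs_plane[OF l] vw by simp
  moreover have "6 dvd dir_pairs E v" "6 dvd dir_pairs E w" "dir_pairs E v \<le> 24" "dir_pairs E w \<le> 24"
    using six dir_pairs_le_24 vw(1) by blast+
  ultimately have "dir_pairs E v = 24 \<or> dir_pairs E w = 24"
    by presburger
  then show thesis
    using found vw(1) by blast
qed

text \<open>
  All such \<open>l\<close> are zeros normal to the heavy direction, and it is normal to two zeros only.
\<close>

lemma few_zero_lines_2: "card {l\<in>dirs A. card (zero_dirs A \<inter> proj_line l) = 2} \<le> 2"
proof (cases "{l\<in>dirs A. card (zero_dirs A \<inter> proj_line l) = 2} = {}")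
  case True
  show ?thesis
    unfolding True by simp
next
  case False
  then obtain l v where v: "v \<in> heavy_dirs" "card (zero_dirs E \<inter> proj_line v) = 2"
    using heavy_dir_if_zero_line_2 by blast
  have "{l\<in>dirs A. card (zero_dirs A \<inter> proj_line l) = 2} \<subseteq> zero_dirs E \<inter> proj_line v"
  proof
    fix l assume l: "l \<in> {l\<in>dirs A. card (zero_dirs A \<inter> proj_line l) = 2}"
    then obtain w where w: "w \<in> heavy_dirs" "l \<in> proj_line w"
      using heavy_dir_if_zero_line_2 by blast
    then have "w = v"
      using heavy_dirs_unique v(1) by blast
    then show "l \<in> zero_dirs E \<inter> proj_line v"
      using w(2) l dirs_subset_zero by blast
  qed
  then show ?thesis
    unfolding v(2)[symmetric] by (rule card_mono[OF finite])
qed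

text \<open>
  A direction of \<open>E\<close> is normal to at least three zeros, apart from at most two exceptional
  directions with two zeros and at most \<open>24\<close> ordered pairs each. Counting ordered pairs together
  with zeros normal to them gives \<open>42 * card (zero_dirs E) \<ge> 3 * 420 - 48\<close>.
\<close>

lemma card_zero_dirs_ge_29: "card (zero_dirs E) \<ge> 29"
proof -
  interpret D: spectral_pair_7_3 A E k p
    by (rule dual_7_3)
  let ?z = "\<lambda>v. card (zero_dirs E \<inter> proj_line v)" and ?C = "dir_pairs E"
  let ?S = "{v\<in>dirs E. ?z v = 2}"
  have "(\<Sum>v\<in>?S. ?C v) \<le> (\<Sum>v\<in>?S. 24)"
    using dir_pairs_le_24 by (intro sum_mono) simp
  then have S: "(\<Sum>v\<in>?S. ?C v) \<le> 48"
    using D.few_zero_lines_2 by simp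
  have "(\<Sum>v\<in>dirs E. ?C v * 3) \<le> (\<Sum>v\<in>dirs E. ?C v * ?z v + (if ?z v = 2 then ?C v else 0))"
  proof (rule sum_mono)
    fix v assume "v \<in> dirs E"
    then show "?C v * 3 \<le> ?C v * ?z v + (if ?z v = 2 then ?C v else 0)"
      using zero_line_ge_2[of v] by (cases "?z v = 2") auto
  qed
  also have "\<dots> = (\<Sum>v\<in>dirs E. ?C v * ?z v) + (\<Sum>v\<in>?S. ?C v)"
    by (simp add: sum.distrib sum.inter_filter)
  also have "(\<Sum>v\<in>dirs E. ?C v * ?z v) = card (zero_dirs E) * 42"
    using dir_pairs_weight[of "zero_dirs E"] p7 k3 by simp
  finally have "(\<Sum>v\<in>dirs E. ?C v * 3) \<le> card (zero_dirs E) * 42 + 48"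
    using S by simp
  then show ?thesis
    using sum_dir_pairs[of E] by (simp add: card_7_3 flip: sum_distrib_right)
qed

text \<open>
  If all profiles were linear, \<open>linear_plane_count\<close> would turn \<open>dir_pairs_bound\<close> into the equation
  \<open>dir_pairs E v = 20 - 4 * z\<close>, whose values are divisible by four and do not add up to \<open>42\<close>.
\<close>

lemma high_2_nonempty: "high_dirs E 2 \<noteq> {}"
proof
  assume empty: "high_dirs E 2 = {}"
  have four: "4 dvd dir_pairs E v" if v: "v \<in> proj_points" for v
  proof -
    let ?Q = "\<lambda>d. \<Sum>t\<in>UNIV. (plane_count E d t)\<^sup>2"
    have "proj_line v = (nonzero_dirs E \<inter> proj_line v) \<union> (zero_dirs E \<inter> proj_line v)"
      using proj_line_subset[of v] by (auto simp: nonzero_dirs_def zero_dirs_def)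
    then have "sum ?Q (proj_line v) = sum ?Q ((nonzero_dirs E \<inter> proj_line v) \<union> (zero_dirs E \<inter> proj_line v))"
      by simp
    also have "\<dots> = sum ?Q (nonzero_dirs E \<inter> proj_line v) + sum ?Q (zero_dirs E \<inter> proj_line v)"
      by (rule sum.union_disjoint) (auto simp: nonzero_dirs_def zero_dirs_def)
    also have "sum ?Q (nonzero_dirs E \<inter> proj_line v) = (\<Sum>d\<in>nonzero_dirs E \<inter> proj_line v. 91)"
      using linear_plane_count(2)[OF p7 _ _ k3] nonzero_high_1 empty by (intro sum.cong) blast+
    also have "sum ?Q (zero_dirs E \<inter> proj_line v) = (\<Sum>d\<in>zero_dirs E \<inter> proj_line v. 63)"
      using zero_plane_count k3 p7 by (intro sum.cong) auto
    finally have "7 * (dir_pairs E v + 21) + 441 = 91 * card (nonzero_dirs E \<inter> proj_line v) + 63 * card (zero_dirs E \<inter> proj_line v)"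
      using sum_squares_pencil[OF v] by (simp add: k3 p7)
    then show ?thesis
      using line_identity_7_3(2)[OF v] by presburger
  qed
  obtain l where "l \<in> dirs A"
    using spectral_pair.dirs_nonempty[OF dual] by blast
  moreover have "4 dvd (\<Sum>v\<in>dirs E \<inter> proj_line l. dir_pairs E v)"
    using four dirs_subset by (intro dvd_sum) blast
  ultimately show False
    using sum_dir_pairs_plane by simp
qed

lemma contradiction_7_3: False
proof -
  obtain x where "card (zero_dirs E) = 29 + x"
    using card_zero_dirs_ge_29 le_Suc_ex by blast
  then have "92 + 25 * int x + int x * int x \<le> 0"
    using zero_dirs_bound_2[OF high_2_nonempty] by (simp add: power2_eq_square algebra_simps)
  then show False
    by (smt (verit) mult_nonneg_nonneg of_nat_0_le_iff)
qed

end

lemma (in spectral_pair) no_spectral_pair_5_7: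
  assumes "p = 5 \<or> p = 7"
  shows False
proof -
  interpret D: spectral_pair A E k p
    by (rule dual)
  have no_flat: "flat_dirs E = {}" "flat_dirs A = {}" if "k = 2 \<or> k = 3 \<and> p = 7"
    using that assms no_flat_dirs_2 D.no_flat_dirs_2 no_flat_dirs_3 D.no_flat_dirs_3 by auto
  have "\<not> (p = 7 \<and> k = 2)"
  proof
    assume pk: "p = 7 \<and> k = 2"
    interpret spectral_pair_7 E A k p
      using no_flat pk by unfold_locales auto
    show False
      using k_not_2 pk by simp
  qed
  moreover have "\<not> (p = 7 \<and> k = 3)"
  proof
    assume pk: "p = 7 \<and> k = 3"
    interpret spectral_pair_7_3 E A k p
      using no_flat pk by unfold_locales auto
    show False
      by (rule contradiction_7_3)
  qed
  ultimately show False
    using assms k2 kp not_k_pred not_5_2 not_5_3 not_7_4 not_7_5 by presburger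
qed

theorem theorem1:
  fixes E :: "('p::prime_card mod_ring ^ 3) set"
  assumes "CARD('p) \<in> {5, 7}"
    and "E \<noteq> {}"
  shows "spectral E \<longleftrightarrow> tiles E"
proof
  assume "spectral E"
  show "tiles E"
  proof (rule spectral_imp_tiles_from_middle[OF _ assms(2) \<open>spectral E\<close>])
    fix A k
    assume pair: "card E = k * CARD('p)" "card A = card E" "orthogonal_frequencies E A" "2 \<le> k" "k < CARD('p)"
    interpret spectral_pair E A k "CARD('p)"
      by unfold_locales (use pair orthogonal_frequencies_dual[OF pair(2,3)] in simp_all)
    show False
      by (rule no_spectral_pair_5_7) (use assms(1) in blast)
  qed
qed (rule tiles_imp_spectral)

end
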